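(* The generalised energy $\mathcal G$ of the Crouzeix–Raviart discretisation of the Poisson problem satisfies the lower diamond estimate: for every $m\in\mathbb N$ and every lower diamond $(\mathcal T^\wedge,\mathcal T_\vee;\mathcal T_1,\dots,\mathcal T_m)$ in $\mathbb T$, $$\mathcal G(\mathcal T^\wedge)-\mathcal G(\mathcal T_\vee)\eqsim\sum_{j=1}^m\big(\mathcal G(\mathcal T_j)-\mathcal G(\mathcal T_\vee)\big).$$
   Context: $\Omega\subset\mathbb R^2$ is a bounded polygonal domain and $\mathcal T_\bot$ a conforming triangulation of $\Omega$ into closed triangles, each triangle having a designated refinement edge (the edge opposite its newest vertex), such that the matching assumption holds: if $T,T'\in\mathcal T_\bot$ and $T\cap T'$ is the refinement edge of $T$, then it is the refinement edge of $T'$. Newest vertex bisection splits a triangle by joining its newest vertex to the midpoint of its refinement edge; this midpoint is the newest vertex of both children. $\mathbb T$ is the set of all conforming triangulations obtained from $\mathcal T_\bot$ by finitely many newest vertex bisections; $\mathcal T\le\mathcal T_\star$ means that $\mathcal T_\star$ is a refinement of $\mathcal T$. $(\mathbb T,\le)$ is a lattice with meet $\wedge$ (finest common coarsening) and join $\vee$ (coarsest common refinement). $\mathcal S(\mathcal T)$ is the set of sides (edges, including boundary edges) of $\mathcal T$. $h_{\mathcal T}|_T:=|T|^{1/2}$ for $T\in\mathcal T$; $\Omega(\mathcal U):=\operatorname{interior}\bigcup_{T\in\mathcal U}T$ for $\mathcal U\subset\mathcal T$. $\|\cdot\|_\omega$ is the $L^2(\omega)$ norm. For $\{\mathcal T_1,\dots,\mathcal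 T_m\}\subset\mathbb T$, $(\mathcal T^\wedge,\mathcal T_\vee;\mathcal T_1,\dots,\mathcal T_m)$ is a lower diamond in $\mathbb T$ if $\mathcal T^\wedge=\bigwedge_{j=1}^m\mathcal T_j$, $\mathcal T_\vee=\bigvee_{j=1}^m\mathcal T_j$ and the sets $\Omega(\mathcal T_j\setminus\mathcal T_\vee)$, $j=1,\dots,m$, are pairwise disjoint. For interior $S=T_1\cap T_2$, $[\![v]\!]|_S:=(v|_{T_1}-v|_{T_2})|_S$, and $[\![v]\!]|_S:=v|_S$ for $S\subset\partial\Omega$. $\mathrm{CR}^1_0(\mathcal T)$ is the space of $v\in L^2(\Omega)$ with $v|_T$ affine for each $T\in\mathcal T$ and $\int_S[\![v]\!]\,ds=0$ for all $S\in\mathcal S(\mathcal T)$. $\nabla_{NC}$ is the piecewise gradient. Let $f\in L^2(\Omega)$; $u_{\mathcal T}\in\mathrm{CR}^1_0(\mathcal T)$ solves $\int_\Omega\nabla_{NC}u_{\mathcal T}\cdot\nabla_{NC}v\,dx=\int_\Omega fv\,dx$ for all $v\in\mathrm{CR}^1_0(\mathcal T)$. For $v\in H^1_0(\Omega)$ or $v\in\mathrm{CR}^1_0(\mathcal T_\star)$ with $\mathcal T_\star\ge\mathcal T$ (and linear combinations), $\mathcal I_{\mathcal T}v\in\mathrm{CR}^1_0(\mathcal T)$ is defined by $\int_S\mathcal I_{\mathcal T}v\,ds=\int_Sv\,ds$ for all $S\in\mathcal S(\mathcal T)$. $\Lambda>0$ is a fixed constant with $\|h_{\mathcal T}^{-1}(v-\mathcal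 I_{\mathcal T}v)\|_T\le\Lambda\|\nabla_{NC}(v-\mathcal I_{\mathcal T}v)\|_T$ for all such $v$, all $\mathcal T\in\mathbb T$, $T\in\mathcal T$. Fix $\gamma>2\Lambda^2$ and set $\mathcal G(\mathcal T):=-\int_\Omega\big(\frac12|\nabla_{NC}u_{\mathcal T}|^2-fu_{\mathcal T}\big)dx+\gamma\|h_{\mathcal T}f\|_\Omega^2$ for $\mathcal T\in\mathbb T$. $A\eqsim B$ means $c^{-1}A\le B\le cA$ with a constant $c>0$ depending only on $\gamma$, $\Lambda$ and $\mathcal T_\bot$ (in particular independent of $m$ and of the diamond). *)

theory Defs
  imports "HOL-Analysis.Analysis"
begin

section \<open>Triangles and newest vertex bisection\<close>

text \<open>
  A triangle carries its newest vertex and the set of the two end points of its refinement edge,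
  so that equality of values of this type is equality of triangles with the same marking.
\<close>

datatype triangle = Triangle (newest_vertex: "real^2") (ref_ends: "(real^2) set")

definition vertices :: "triangle \<Rightarrow> (real^2) set" where
  "vertices T = insert (newest_vertex T) (ref_ends T)"

definition region :: "triangle \<Rightarrow> (real^2) set" where
  "region T = convex hull (vertices T)"

definition ref_edge :: "triangle \<Rightarrow> (real^2) set" where
  "ref_edge T = convex hull (ref_ends T)"

definition proper_triangle :: "triangle \<Rightarrow> bool" where
  "proper_triangle T \<longleftrightarrow>
     card (ref_ends T) = 2 \<and> newest_vertex T \<notin> ref_ends T \<and> \<not> affine_dependent (vertices T)"

definition sides_of :: "triangle \<Rightarrow> (real^2) set set" where
  "sides_of T = {closed_segment a b | a b. a \<in> vertices T \<and> b \<in> vertices T \<and> a \<noteq> b}"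

definition sides :: "triangle set \<Rightarrow> (real^2) set set" where
  "sides \<T> = (\<Union>T\<in>\<T>. sides_of T)"

text \<open>The midpoint of the refinement edge is half the sum of its two end points.\<close>

definition children :: "triangle \<Rightarrow> triangle set" where
  "children T =
     (\<lambda>a. Triangle ((1/2) *\<^sub>R (\<Sum>x\<in>ref_ends T. x)) {newest_vertex T, a}) ` ref_ends T"

definition nvb_step :: "triangle set \<Rightarrow> triangle set \<Rightarrow> bool" where
  "nvb_step \<P> \<Q> \<longleftrightarrow> (\<exists>T\<in>\<P>. \<Q> = (\<P> - {T}) \<union> children T)"

definition coarser_eq :: "triangle set \<Rightarrow> triangle set \<Rightarrow> bool" where
  "coarser_eq \<P> \<Q> \<longleftrightarrow> nvb_step\<^sup>*\<^sup>* \<P> \<Q>"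

section \<open>Domain and triangulations\<close>

text \<open>
  The condition that the domain is the interior of its closure excludes slits; along a slit a side
  would be both an intersection of two triangles and part of the boundary.
\<close>

definition polygonal_domain :: "(real^2) set \<Rightarrow> bool" where
  "polygonal_domain \<Omega> \<longleftrightarrow>
     open \<Omega> \<and> connected \<Omega> \<and> bounded \<Omega> \<and> \<Omega> \<noteq> {} \<and> interior (closure \<Omega>) = \<Omega> \<and>
     (\<exists>\<F>. finite \<F> \<and> (\<forall>S\<in>\<F>. \<exists>a b. a \<noteq> b \<and> S = closed_segment a b) \<and> frontier \<Omega> = \<Union>\<F>)"

definition conforming_triangulation :: "(real^2) set \<Rightarrow> triangle set \<Rightarrow> bool" where
  "conforming_triangulation \<Omega> \<T> \<longleftrightarrow>
     finite \<T> \<and> (\<forall>T\<in>\<T>. proper_triangle T) \<and> inj_on region \<T> \<and>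
     triangulation (region ` \<T>) \<and> (\<Union>T\<in>\<T>. region T) = closure \<Omega>"

definition matching :: "triangle set \<Rightarrow> bool" where
  "matching \<T> \<longleftrightarrow>
     (\<forall>T\<in>\<T>. \<forall>T'\<in>\<T>. region T \<inter> region T' = ref_edge T \<longrightarrow> region T \<inter> region T' = ref_edge T')"

definition refinements :: "(real^2) set \<Rightarrow> triangle set \<Rightarrow> triangle set set" where
  "refinements \<Omega> \<T>\<^sub>0 = {\<T>. coarser_eq \<T>\<^sub>0 \<T> \<and> conforming_triangulation \<Omega> \<T>}"

definition subdomain :: "triangle set \<Rightarrow> (real^2) set" where
  "subdomain \<U> = interior (\<Union>T\<in>\<U>. region T)"

definition is_meet :: "triangle set set \<Rightarrow> triangle set set \<Rightarrow> triangle set \<Rightarrow> bool" where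
  "is_meet \<TT> A \<M> \<longleftrightarrow>
     \<M> \<in> \<TT> \<and> (\<forall>\<T>\<in>A. coarser_eq \<M> \<T>) \<and>
     (\<forall>\<L>\<in>\<TT>. (\<forall>\<T>\<in>A. coarser_eq \<L> \<T>) \<longrightarrow> coarser_eq \<L> \<M>)"

definition is_join :: "triangle set set \<Rightarrow> triangle set set \<Rightarrow> triangle set \<Rightarrow> bool" where
  "is_join \<TT> A \<J> \<longleftrightarrow>
     \<J> \<in> \<TT> \<and> (\<forall>\<T>\<in>A. coarser_eq \<T> \<J>) \<and>
     (\<forall>\<K>\<in>\<TT>. (\<forall>\<T>\<in>A. coarser_eq \<T> \<K>) \<longrightarrow> coarser_eq \<J> \<K>)"

definition lower_diamond ::
  "triangle set set \<Rightarrow> nat \<Rightarrow> triangle set \<Rightarrow> triangle set \<Rightarrow> (nat \<Rightarrow> triangle set) \<Rightarrow> bool" where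
  "lower_diamond \<TT> m \<M> \<J> \<T>s \<longleftrightarrow>
     (\<forall>j\<in>{1..m}. \<T>s j \<in> \<TT>) \<and> is_meet \<TT> (\<T>s ` {1..m}) \<M> \<and> is_join \<TT> (\<T>s ` {1..m}) \<J> \<and>
     disjoint_family_on (\<lambda>j. subdomain (\<T>s j - \<J>)) {1..m}"

section \<open>Square integrable functions and integrals over sides\<close>

definition L2 :: "(real^2) set \<Rightarrow> (real^2 \<Rightarrow> 'b::euclidean_space) \<Rightarrow> bool" where
  "L2 \<omega> v \<longleftrightarrow>
     v \<in> borel_measurable (lebesgue_on \<omega>) \<and> integrable (lebesgue_on \<omega>) (\<lambda>x. (norm (v x))\<^sup>2)"

definition L2_norm :: "(real^2) set \<Rightarrow> (real^2 \<Rightarrow> 'b::euclidean_space) \<Rightarrow> real" where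
  "L2_norm \<omega> v = sqrt (LINT x|lebesgue_on \<omega>. (norm (v x))\<^sup>2)"

text \<open>
  The integral with respect to arc length over a segment, parametrised affinely over \<open>{0..1}\<close>;
  it does not depend on the orientation of the segment (\<open>side_integral_closed_segment\<close> below).
\<close>

definition side_integral :: "(real^2) set \<Rightarrow> (real^2 \<Rightarrow> real) \<Rightarrow> real" where
  "side_integral S p =
     (THE I. \<exists>a b. S = closed_segment a b \<and> I = dist a b * integral {0..1} (\<lambda>t. p (linepath a b t)))"

lemma side_integral_closed_segment:
  "side_integral (closed_segment a b) p = dist a b * integral {0..1} (\<lambda>t. p (linepath a b t))"
proof -
  have swap: "integral {0..1} (\<lambda>t. p (linepath d c t)) = integral {0..1} (\<lambda>t. p (linepath c d t))"
    for c d :: "real^2"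
  proof -
    have "integral {0..1} (\<lambda>t. p (linepath d c t))
        = integral {-1..0} ((\<lambda>t. p (linepath d c t)) \<circ> (+) 1)"
      by (subst integral_shift_Icc_real) simp
    also have "\<dots> = integral {-1..0} (\<lambda>t. p (linepath c d (- t)))"
      by (simp add: linepath_def o_def add.commute)
    also have "\<dots> = integral {0..1} (\<lambda>t. p (linepath c d t))"
      using Henstock_Kurzweil_Integration.integral_reflect_real[of 1 0 "\<lambda>t. p (linepath c d t)"] by simp
    finally show ?thesis .
  qed
  show ?thesis
    unfolding side_integral_def
    by (rule the_equality) (auto simp: closed_segment_eq doubleton_eq_iff dist_commute swap)
qed

section \<open>Crouzeix-Raviart functions\<close>

text \<open>
  Elements of \<open>L2\<close> are identified up to null sets. If \<open>v\<close> is affine on the triangle \<open>T\<close>, then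
  \<open>affine_rep T v\<close> is the unique \<open>(a, g)\<close> with \<open>v x = a + g \<bullet> x\<close> for almost all \<open>x\<close> in \<open>T\<close>;
  \<open>side_trace T v\<close> is the continuous representative on the closed triangle, used on the sides of \<open>T\<close>.
\<close>

definition affine_on_triangle :: "triangle \<Rightarrow> (real^2 \<Rightarrow> real) \<Rightarrow> bool" where
  "affine_on_triangle T v \<longleftrightarrow> (\<exists>a g. AE x in lebesgue_on (region T). v x = a + g \<bullet> x)"

definition affine_rep :: "triangle \<Rightarrow> (real^2 \<Rightarrow> real) \<Rightarrow> real \<times> (real^2)" where
  "affine_rep T v = (THE (a, g). AE x in lebesgue_on (region T). v x = a + g \<bullet> x)"

lemma affine_rep_eq:
  assumes "proper_triangle T" "AE x in lebesgue_on (region T). v x = a + g \<bullet> x"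
  shows "affine_rep T v = (a, g)"
proof -
  have fin: "finite (ref_ends T)"
    using assms(1) by (intro card_ge_0_finite) (simp add: proper_triangle_def)
  then have card: "card (vertices T) = Suc DIM(real^2)"
    using assms(1) by (simp add: proper_triangle_def vertices_def)
  have ne: "interior (region T) \<noteq> {}"
    using assms(1) interior_convex_hull_eq_empty[OF card]
    by (simp add: region_def proper_triangle_def)
  have meas: "region T \<in> sets lebesgue"
    using fin unfolding region_def vertices_def
    by (intro lmeasurable_compact[THEN fmeasurableD] compact_convex_hull finite_imp_compact) simp
  have "b = a \<and> h = g" if AE: "AE x in lebesgue_on (region T). v x = b + h \<bullet> x" for b h
  proof -
    define D where "D = interior (region T) \<inter> {x. (a - b) + (g - h) \<bullet> x \<noteq> 0}"
    have "AE x in lebesgue_on (region T). (a - b) + (g - h) \<bullet> x = 0"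
      using assms(2) AE by eventually_elim (simp add: inner_diff_left)
    then have "AE x in lebesgue. x \<in> region T \<longrightarrow> (a - b) + (g - h) \<bullet> x = 0"
      using meas by (simp add: AE_restrict_space_iff)
    then have "AE x in lebesgue. x \<notin> D"
      by (rule eventually_mono) (use interior_subset[of "region T"] in \<open>unfold D_def, blast\<close>)
    moreover have "open D"
      unfolding D_def by (intro open_Int open_interior open_Collect_neq continuous_intros)
    moreover have "{x \<in> space lebesgue. \<not> x \<notin> D} = D"
      unfolding space_completion by (simp add: space_lborel)
    moreover have "D \<in> sets lebesgue"
      using \<open>open D\<close> by (simp add: borel_open)
    ultimately have "D \<in> null_sets lebesgue"
      using AE_iff_null[of lebesgue "\<lambda>x. x \<notin> D"] by metis
    then have "negligible D"
      by (simp add: negligible_iff_null_sets)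
    then have "D = {}"
      using \<open>open D\<close> open_not_negligible by blast
    then have zero: "(a - b) + (g - h) \<bullet> x = 0" if "x \<in> interior (region T)" for x
      using that by (auto simp: D_def)
    obtain x e where x: "x \<in> interior (region T)" and e: "e > 0" "ball x e \<subseteq> interior (region T)"
      using ne open_interior by (metis ex_in_conv open_contains_ball)
    have "g = h"
    proof (rule ccontr)
      assume "g \<noteq> h"
      then have n: "norm (g - h) > 0"
        by simp
      define y where "y = x + (e / (2 * norm (g - h))) *\<^sub>R (g - h)"
      have "dist x y = e / 2"
        using n e(1) by (simp add: y_def dist_norm)
      then have "y \<in> ball x e"
        using e(1) by simp
      then have "(g - h) \<bullet> y = (g - h) \<bullet> x"
        using zero[of y] zero[OF x] e(2) by (simp add: subset_eq)
      then have "(e / (2 * norm (g - h))) * ((g - h) \<bullet> (g - h)) = 0"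
        unfolding y_def inner_add_right inner_scaleR_right by linarith
      then show False
        using n e(1) by simp
    qed
    then show ?thesis
      using zero[OF x] by simp
  qed
  note unique = this
  let ?P = "\<lambda>q. AE x in lebesgue_on (region T). v x = fst q + snd q \<bullet> x"
  have "(THE q. ?P q) = (a, g)"
  proof (rule the_equality[of ?P])
    show "?P (a, g)"
      using assms(2) by simp
    show "q = (a, g)" if "?P q" for q
      using unique[OF that] by (simp add: prod_eq_iff)
  qed
  then show ?thesis
    by (simp only: affine_rep_def case_prod_unfold)
qed

definition side_trace :: "triangle \<Rightarrow> (real^2 \<Rightarrow> real) \<Rightarrow> real^2 \<Rightarrow> real" where
  "side_trace T v x = fst (affine_rep T v) + snd (affine_rep T v) \<bullet> x"

definition nc_grad :: "triangle set \<Rightarrow> (real^2 \<Rightarrow> real) \<Rightarrow> real^2 \<Rightarrow> real^2" where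
  "nc_grad \<T> v x = (\<Sum>T\<in>\<T>. indicator (interior (region T)) x *\<^sub>R snd (affine_rep T v))"

text \<open>
  The sign of the jump on an interior side depends on the order of the two adjacent triangles,
  which is irrelevant for the vanishing of its integral.
\<close>

definition CR :: "(real^2) set \<Rightarrow> triangle set \<Rightarrow> (real^2 \<Rightarrow> real) set" where
  "CR \<Omega> \<T> = {v. L2 \<Omega> v \<and> (\<forall>T\<in>\<T>. affine_on_triangle T v) \<and>
     (\<forall>S\<in>sides \<T>.
        (\<forall>T\<^sub>1\<in>\<T>. \<forall>T\<^sub>2\<in>\<T>. S = region T\<^sub>1 \<inter> region T\<^sub>2 \<longrightarrow>
           side_integral S (\<lambda>x. side_trace T\<^sub>1 v x - side_trace T\<^sub>2 v x) = 0) \<and>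
        (\<forall>T\<in>\<T>. S \<in> sides_of T \<and> S \<subseteq> frontier \<Omega> \<longrightarrow> side_integral S (side_trace T v) = 0))}"

definition CR_solution ::
  "(real^2) set \<Rightarrow> triangle set \<Rightarrow> (real^2 \<Rightarrow> real) \<Rightarrow> (real^2 \<Rightarrow> real) \<Rightarrow> bool" where
  "CR_solution \<Omega> \<T> f u \<longleftrightarrow>
     u \<in> CR \<Omega> \<T> \<and>
     (\<forall>v\<in>CR \<Omega> \<T>. (LINT x|lebesgue_on \<Omega>. nc_grad \<T> u x \<bullet> nc_grad \<T> v x)
                  = (LINT x|lebesgue_on \<Omega>. f x * v x))"

definition mesh_size :: "triangle set \<Rightarrow> real^2 \<Rightarrow> real" where
  "mesh_size \<T> x = (\<Sum>T\<in>\<T>. indicator (interior (region T)) x * sqrt (measure lebesgue (region T)))"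

definition generalised_energy ::
  "(real^2) set \<Rightarrow> real \<Rightarrow> (real^2 \<Rightarrow> real) \<Rightarrow> (triangle set \<Rightarrow> real^2 \<Rightarrow> real) \<Rightarrow> triangle set \<Rightarrow> real" where
  "generalised_energy \<Omega> \<gamma> f u \<T> =
     - (LINT x|lebesgue_on \<Omega>. (1/2) * (norm (nc_grad \<T> (u \<T>) x))\<^sup>2 - f x * u \<T> x)
     + \<gamma> * (L2_norm \<Omega> (\<lambda>x. mesh_size \<T> x * f x))\<^sup>2"

section \<open>Interpolation\<close>

text \<open>
  On a side \<open>S\<close> of a coarser triangulation, the integral of a Crouzeix-Raviart function is the sum
  over the fine sides contained in \<open>S\<close>; since the jumps have vanishing integrals, it does not matter
  from which adjacent triangle the trace is taken.
\<close>

definition CR_side_integral :: "triangle set \<Rightarrow> (real^2 \<Rightarrow> real) \<Rightarrow> (real^2) set \<Rightarrow> real" where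
  "CR_side_integral \<T> v S =
     (\<Sum>S'\<in>{S' \<in> sides \<T>. S' \<subseteq> S}. side_integral S' (side_trace (SOME T. T \<in> \<T> \<and> S' \<in> sides_of T) v))"

definition C1_compact_support ::
  "(real^2) set \<Rightarrow> (real^2 \<Rightarrow> real) \<Rightarrow> (real^2 \<Rightarrow> real^2) \<Rightarrow> bool" where
  "C1_compact_support \<Omega> \<phi> g \<longleftrightarrow>
     (\<forall>x. GDERIV \<phi> x :> g x) \<and> continuous_on UNIV g \<and>
     (\<exists>K. compact K \<and> K \<subseteq> \<Omega> \<and> (\<forall>x. x \<notin> K \<longrightarrow> \<phi> x = 0))"

text \<open>
  \<open>H10_limit \<Omega> v G \<phi>\<close>: the function \<open>v\<close> lies in the closure \<open>H\<^sup>1\<^sub>0(\<Omega>)\<close> of the compactly supported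
  continuously differentiable functions, has weak gradient \<open>G\<close>, and \<open>\<phi>\<close> is an approximating
  sequence in the \<open>H\<^sup>1\<close> norm. Traces of \<open>v\<close> are the limits of the restrictions of \<open>\<phi>\<close>.
\<close>

definition H10_limit ::
  "(real^2) set \<Rightarrow> (real^2 \<Rightarrow> real) \<Rightarrow> (real^2 \<Rightarrow> real^2) \<Rightarrow> (nat \<Rightarrow> real^2 \<Rightarrow> real) \<Rightarrow> bool" where
  "H10_limit \<Omega> v G \<phi> \<longleftrightarrow> L2 \<Omega> v \<and> L2 \<Omega> G \<and>
     (\<exists>g. (\<forall>n. C1_compact_support \<Omega> (\<phi> n) (g n)) \<and>
          (\<lambda>n. L2_norm \<Omega> (\<lambda>x. \<phi> n x - v x)) \<longlonglongrightarrow> 0 \<and>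
          (\<lambda>n. L2_norm \<Omega> (\<lambda>x. g n x - G x)) \<longlonglongrightarrow> 0)"

text \<open>
  The functions to which the interpolation on \<open>\<T>\<close> applies: the linear combinations of functions in
  \<open>H\<^sup>1\<^sub>0(\<Omega>)\<close> and in Crouzeix-Raviart spaces on refinements of \<open>\<T>\<close>. In \<open>interpolable \<Omega> \<T>\<^sub>0 \<T> v G \<sigma>\<close>,
  \<open>G\<close> is the piecewise gradient of \<open>v\<close> and \<open>\<sigma> S\<close> the integral of \<open>v\<close> over the side \<open>S\<close> of \<open>\<T>\<close>.
\<close>

inductive interpolable ::
  "(real^2) set \<Rightarrow> triangle set \<Rightarrow> triangle set \<Rightarrow>
     (real^2 \<Rightarrow> real) \<Rightarrow> (real^2 \<Rightarrow> real^2) \<Rightarrow> ((real^2) set \<Rightarrow> real) \<Rightarrow> bool"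
  for \<Omega> \<T>\<^sub>0 \<T> where
  H10: "interpolable \<Omega> \<T>\<^sub>0 \<T> v G \<sigma>"
    if "H10_limit \<Omega> v G \<phi>" "\<And>S. S \<in> sides \<T> \<Longrightarrow> (\<lambda>n. side_integral S (\<phi> n)) \<longlonglongrightarrow> \<sigma> S"
| CR: "interpolable \<Omega> \<T>\<^sub>0 \<T> v (nc_grad \<T>' v) (CR_side_integral \<T>' v)"
    if "\<T>' \<in> refinements \<Omega> \<T>\<^sub>0" "coarser_eq \<T> \<T>'" "v \<in> CR \<Omega> \<T>'"
| lincomb: "interpolable \<Omega> \<T>\<^sub>0 \<T> (\<lambda>x. a * v x + b * w x) (\<lambda>x. a *\<^sub>R G x + b *\<^sub>R H x) (\<lambda>S. a * \<sigma> S + b * \<tau> S)"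
    if "interpolable \<Omega> \<T>\<^sub>0 \<T> v G \<sigma>" "interpolable \<Omega> \<T>\<^sub>0 \<T> w H \<tau>"

definition is_interpolant ::
  "(real^2) set \<Rightarrow> triangle set \<Rightarrow> ((real^2) set \<Rightarrow> real) \<Rightarrow> (real^2 \<Rightarrow> real) \<Rightarrow> bool" where
  "is_interpolant \<Omega> \<T> \<sigma> w \<longleftrightarrow> w \<in> CR \<Omega> \<T> \<and> (\<forall>S\<in>sides \<T>. CR_side_integral \<T> w S = \<sigma> S)"

definition interpolation_estimate :: "(real^2) set \<Rightarrow> triangle set \<Rightarrow> real \<Rightarrow> bool" where
  "interpolation_estimate \<Omega> \<T>\<^sub>0 \<Lambda> \<longleftrightarrow>
     (\<forall>\<T>\<in>refinements \<Omega> \<T>\<^sub>0. \<forall>v G \<sigma> w.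
        interpolable \<Omega> \<T>\<^sub>0 \<T> v G \<sigma> \<longrightarrow> is_interpolant \<Omega> \<T> \<sigma> w \<longrightarrow>
        (\<forall>T\<in>\<T>. L2_norm (region T) (\<lambda>x. inverse (mesh_size \<T> x) * (v x - w x))
               \<le> \<Lambda> * L2_norm (region T) (\<lambda>x. G x - nc_grad \<T> w x)))"

end

theory Submission
  imports Defs
begin

text \<open>
  Both sides of the estimate are compared with sums of the same local quantities. Let \<open>\<T>\<close> be coarser
  than \<open>\<T>'\<close>, with discrete solutions \<open>u\<close> and \<open>v\<close>, and let \<open>i\<close> be the interpolant of \<open>v\<close> on \<open>\<T>\<close>. Then
  the difference of the energies of \<open>\<T>\<close> and \<open>\<T>'\<close> is equivalent to the sum, over the triangles \<open>T\<close> of \<open>\<T>\<close>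
  that are refined in \<open>\<T>'\<close>, of the squared distance of the piecewise gradient of \<open>v\<close> from its mean on
  \<open>T\<close>, plus the area of \<open>T\<close> times the squared norm of the load on \<open>T\<close> (\<open>energy_difference_local\<close>).
  For a given load each summand (\<open>local_error\<close>) depends on \<open>\<T>'\<close> and \<open>T\<close> only. In a lower diamond the triangles of the meet
  that are refined in the join are the disjoint union of those of the members
  (\<open>lower_diamond_partition\<close>). So, with the join in the role of \<open>\<T>'\<close>, the sum for the meet is exactly
  the sum of the sums for the members, whatever their number, and the constants of the diamond estimate
  are those of a single pair.

  For the equivalence, interpolation preserves the mean of the gradient on every coarse triangle
  (\<open>area_grad_sum\<close>). Testing the discrete equations gives an identity for the energy difference
  (\<open>energy_identity\<close>): half the squared gradient norms of \<open>v - i\<close> and of \<open>i - u\<close>, minus the integral of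
  \<open>f (v - i)\<close>, plus the decrease of the weighted load. The integral is absorbed by the interpolation
  estimate and the load decrease, which is where \<open>\<gamma> > 2 \<Lambda>\<^sup>2\<close> enters (\<open>load_error\<close>, \<open>load_reduction\<close>); this
  proves the lower bound. The upper bound needs control of \<open>w = i - u\<close>. The spaces are not nested,
  so \<open>w\<close> is not a test function on \<open>\<T>'\<close>; it is replaced there by a function \<open>z\<close> whose interpolant is
  \<open>w\<close> and whose gradient is bounded by that of \<open>w\<close> (\<open>stable_right_inverse\<close>, \<open>interpolant_error\<close>).

  The function \<open>z\<close> interpolates a continuous companion of \<open>w\<close>: nodal values plus quadratic edge
  bubbles that restore the side means. The companion is Lipschitz on every coarse triangle, which makes
  its interpolation stable however fine \<open>\<T>'\<close> is. The Lipschitz constants are bounded by the gradients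
  of \<open>w\<close> around the vertices (\<open>node_value_close\<close>), because two triangles at a vertex are linked by
  a chain of common sides, or else the walk from either of them reaches the boundary
  (\<open>vertex_patch_connected\<close>), and because shape regularity bounds the number of triangles at a vertex
  (\<open>card_vertex_patch\<close>). The shape of triangles is controlled by an exact invariant of newest vertex
  bisection (\<open>leg2_children\<close>).
\<close>

section \<open>Coordinates on triangles\<close>

definition det2 :: "real^2 \<Rightarrow> real^2 \<Rightarrow> real" where
  "det2 u v = u$1 * v$2 - u$2 * v$1"

lemma content_convex_hull_3:
  "measure lebesgue (convex hull {p, a, b}) = \<bar>det2 (a - p) (b - p)\<bar> / 2" for p a b :: "real^2"
proof -
  have "measure lebesgue (convex hull {p, a, b}) = measure lborel (convex hull {p, a, b})"
    by (intro measure_completion) (simp add: compact_convex_hull borel_compact finite_imp_compact)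
  then show ?thesis
    by (simp add: content_triangle det2_def abs_minus_commute algebra_simps)
qed

lemma affine_independent_iff_det2:
  assumes "a \<noteq> b" "p \<noteq> a" "p \<noteq> b"
  shows "\<not> affine_dependent {p, a, b} \<longleftrightarrow> det2 (a - p) (b - p) \<noteq> 0"
proof -
  have "card {p, a, b} = Suc DIM(real^2)"
    using assms by simp
  then have "affine_dependent {p, a, b} \<longleftrightarrow> interior (convex hull {p, a, b}) = {}"
    by (simp add: interior_convex_hull_eq_empty)
  also have "\<dots> \<longleftrightarrow> negligible (convex hull {p, a, b})"
    by (simp add: negligible_convex_interior)
  also have "\<dots> \<longleftrightarrow> measure lebesgue (convex hull {p, a, b}) = 0"
    by (meson compact_convex_hull finite.emptyI finite.insertI finite_imp_compact
        lmeasurable_compact negligible_iff_measure0)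
  finally show ?thesis
    by (simp add: content_convex_hull_3)
qed

lemma proper_triangle_iff:
  "proper_triangle (Triangle p {a, b}) \<longleftrightarrow> det2 (a - p) (b - p) \<noteq> 0"
proof (cases "a \<noteq> b \<and> p \<noteq> a \<and> p \<noteq> b")
  case True
  then show ?thesis
    using affine_independent_iff_det2[of a b p]
    by (auto simp: proper_triangle_def vertices_def)
next
  case False
  then show ?thesis
    by (auto simp: proper_triangle_def vertices_def det2_def)
qed

lemma proper_triangleE:
  assumes "proper_triangle T"
  obtains p a b where "T = Triangle p {a, b}" "a \<noteq> b" "p \<noteq> a" "p \<noteq> b" "det2 (a - p) (b - p) \<noteq> 0"
proof -
  obtain p R where T: "T = Triangle p R"
    by (cases T)
  then obtain a b where R: "R = {a, b}"
    using assms by (auto simp: proper_triangle_def card_2_iff)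
  show thesis
    using that[of p a b] assms proper_triangle_iff[of p a b] unfolding T R
    by (cases "a = b") (auto simp: proper_triangle_def)
qed

lemma finite_vertices: "proper_triangle T \<Longrightarrow> finite (vertices T)"
  by (auto simp: vertices_def elim!: proper_triangleE)

lemma compact_region: "proper_triangle T \<Longrightarrow> compact (region T)"
  by (simp add: region_def compact_convex_hull finite_imp_compact finite_vertices)

lemma convex_region: "convex (region T)"
  by (simp add: region_def convex_convex_hull)

lemma vertices_subset_region: "vertices T \<subseteq> region T"
  by (simp add: region_def hull_subset)

lemma extreme_point_region: "proper_triangle T \<Longrightarrow> x extreme_point_of region T \<longleftrightarrow> x \<in> vertices T"
  by (simp add: region_def proper_triangle_def extreme_point_of_convex_hull_affine_independent)

definition area :: "triangle \<Rightarrow> real" where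
  "area T = measure lebesgue (region T)"

lemma area_eq_det2: "area (Triangle p {a, b}) = \<bar>det2 (a - p) (b - p)\<bar> / 2"
  by (simp add: area_def region_def vertices_def content_convex_hull_3)

lemma area_pos: "proper_triangle T \<Longrightarrow> area T > 0"
  by (auto simp: area_eq_det2 elim!: proper_triangleE)

lemma lmeasurable_region: "proper_triangle T \<Longrightarrow> region T \<in> lmeasurable"
  by (simp add: compact_region lmeasurable_compact)

lemma interior_region_nonempty: "proper_triangle T \<Longrightarrow> interior (region T) \<noteq> {}"
  using area_pos[of T] lmeasurable_region[of T] negligible_convex_interior[OF convex_region]
  by (metis area_def measure_eq_0_null_sets negligible_iff_null_sets less_irrefl)

lemma closure_interior_region: "proper_triangle T \<Longrightarrow> closure (interior (region T)) = region T"
  by (metis closure_closed compact_imp_closed compact_region convex_closure_interior convex_region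
      interior_region_nonempty)

lemma negligible_frontier_region: "negligible (frontier (region T))"
  by (rule negligible_convex_frontier[OF convex_region])

text \<open>
  Barycentric coordinates as quotients of signed areas (Cramer's rule).
\<close>

definition bary :: "real^2 \<Rightarrow> real^2 \<Rightarrow> real^2 \<Rightarrow> real^2 \<Rightarrow> real" where
  "bary u v w x = det2 (v - x) (w - x) / det2 (v - u) (w - u)"

lemma bary_affine: "\<exists>c g. \<forall>x. bary u v w x = c + g \<bullet> x"
proof -
  let ?D = "det2 (v - u) (w - u)"
  have "bary u v w x = (v$1 * w$2 - v$2 * w$1) / ?D + vector [(v$2 - w$2) / ?D, (w$1 - v$1) / ?D] \<bullet> x" for x
    by (simp add: bary_def inner_vec_def sum_2 det2_def[of "_ - x"] add_divide_distrib[symmetric] algebra_simps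
        flip: add_divide_distrib diff_divide_distrib)
  then show ?thesis
    by blast
qed

lemma continuous_bary: "continuous_on S (bary u v w)"
proof -
  obtain c g where "bary u v w = (\<lambda>x. c + g \<bullet> x)"
    using bary_affine by blast
  then show ?thesis
    by (auto intro!: continuous_intros)
qed

lemma det2_rotate: "det2 (w - v) (u - v) = det2 (v - u) (w - u)"
  by (simp add: det2_def algebra_simps)

lemma det2_swap: "det2 v u = - det2 u v"
  by (simp add: det2_def)

lemma bary_commute: "bary u v w x = bary u w v x"
  by (simp add: bary_def det2_def algebra_simps) (smt (verit) minus_divide_divide)

lemma bary_simps:
  assumes "det2 (v - u) (w - u) \<noteq> 0"
  shows "bary u v w u = 1" "bary u v w v = 0" "bary u v w w = 0"
  using assms by (auto simp: bary_def det2_def)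

lemma bary_sum_aux: "det2 (v - x) (w - x) + det2 (w - x) (u - x) + det2 (u - x) (v - x) = det2 (v - u) (w - u)"
  by (simp add: det2_def algebra_simps)

lemma bary_sum:
  assumes "det2 (v - u) (w - u) \<noteq> 0"
  shows "bary u v w x + bary v w u x + bary w u v x = 1"
  using assms det2_rotate[of w v u] det2_rotate[of u w v] bary_sum_aux[of v x w u]
  by (simp add: bary_def flip: add_divide_distrib)

lemma bary_expand:
  assumes "det2 (v - u) (w - u) \<noteq> 0"
  shows "bary u v w x *\<^sub>R u + bary v w u x *\<^sub>R v + bary w u v x *\<^sub>R w = x"
proof -
  let ?D = "det2 (v - u) (w - u)"
  have D: "det2 (w - v) (u - v) = ?D" "det2 (u - w) (v - w) = ?D"
    by (simp_all add: det2_def algebra_simps)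
  have "det2 (v - x) (w - x) * u$i + det2 (w - x) (u - x) * v$i + det2 (u - x) (v - x) * w$i = ?D * x$i"
    if "i = 1 \<or> i = 2" for i
    using that by (auto simp: det2_def algebra_simps)
  then have "(det2 (v - x) (w - x) / ?D) * u$i + (det2 (w - x) (u - x) / ?D) * v$i
      + (det2 (u - x) (v - x) / ?D) * w$i = x$i" for i
    using assms exhaust_2[of i]
    by (auto simp: field_simps)
  then show ?thesis
    by (simp add: bary_def D vec_eq_iff)
qed

lemma convex_hull_3_bary:
  assumes "det2 (v - u) (w - u) \<noteq> 0"
  shows "x \<in> convex hull {u, v, w} \<longleftrightarrow> bary u v w x \<ge> 0 \<and> bary v w u x \<ge> 0 \<and> bary w u v x \<ge> 0"
proof
  assume "x \<in> convex hull {u, v, w}"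
  then obtain r s t where rst: "0 \<le> r" "0 \<le> s" "0 \<le> t" "r + s + t = 1"
    and x: "x = r *\<^sub>R u + s *\<^sub>R v + t *\<^sub>R w"
    by (auto simp: convex_hull_3)
  have r: "r = 1 - s - t"
    using rst by simp
  let ?D = "det2 (v - u) (w - u)"
  have D: "det2 (w - v) (u - v) = ?D" "det2 (u - w) (v - w) = ?D"
    by (simp_all add: det2_def algebra_simps)
  have "det2 (v - x) (w - x) = r * ?D" "det2 (w - x) (u - x) = s * ?D" "det2 (u - x) (v - x) = t * ?D"
    by (simp_all add: x r det2_def algebra_simps)
  then show "bary u v w x \<ge> 0 \<and> bary v w u x \<ge> 0 \<and> bary w u v x \<ge> 0"
    using assms rst by (simp add: bary_def D)
next
  assume "bary u v w x \<ge> 0 \<and> bary v w u x \<ge> 0 \<and> bary w u v x \<ge> 0"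
  then show "x \<in> convex hull {u, v, w}"
    using bary_sum[OF assms, of x] bary_expand[OF assms, of x] unfolding convex_hull_3 by force
qed

lemma obtain_third_vertex:
  assumes "proper_triangle T" "x \<in> vertices T" "y \<in> vertices T" "x \<noteq> y"
  obtains z where "vertices T = {x, y, z}" "z \<noteq> x" "z \<noteq> y" "det2 (y - x) (z - x) \<noteq> 0"
proof -
  obtain p a b where T: "T = Triangle p {a, b}" "a \<noteq> b" "p \<noteq> a" "p \<noteq> b" "det2 (a - p) (b - p) \<noteq> 0"
    using assms(1) by (rule proper_triangleE)
  have "card (vertices T) = 3"
    using T by (simp add: vertices_def)
  then have "card (vertices T - {x, y}) = 1"
    using assms finite_vertices[OF assms(1)] by (simp add: card_Diff_subset)
  then obtain z where z: "vertices T - {x, y} = {z}"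
    by (metis card_1_singletonE)
  then have v: "vertices T = {x, y, z}" "z \<noteq> x" "z \<noteq> y"
    using assms by blast+
  moreover have "\<not> affine_dependent {x, y, z}"
    using assms(1) v by (simp add: proper_triangle_def)
  ultimately show thesis
    using that assms(4) affine_independent_iff_det2[of y z x] by metis
qed

lemma region_bary:
  assumes "proper_triangle T" "vertices T = {u, v, w}" "det2 (v - u) (w - u) \<noteq> 0"
  shows "x \<in> region T \<longleftrightarrow> bary u v w x \<ge> 0 \<and> bary v w u x \<ge> 0 \<and> bary w u v x \<ge> 0"
  using convex_hull_3_bary[OF assms(3)] by (simp add: region_def assms(2))

lemma interior_region_bary:
  assumes "proper_triangle T" "vertices T = {u, v, w}" "det2 (v - u) (w - u) \<noteq> 0"
    and "bary u v w x > 0" "bary v w u x > 0" "bary w u v x > 0"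
  shows "x \<in> interior (region T)"
proof -
  let ?U = "{x. bary u v w x > 0} \<inter> {x. bary v w u x > 0} \<inter> {x. bary w u v x > 0}"
  have "open ?U"
    by (intro open_Int open_Collect_less continuous_bary continuous_on_const)
  moreover have "?U \<subseteq> region T"
    using region_bary[OF assms(1-3)] by force
  ultimately show ?thesis
    using assms(4-6) by (intro interiorI[of ?U]) auto
qed

lemma closed_segment_bary:
  assumes "det2 (v - u) (w - u) \<noteq> 0" "x \<in> convex hull {u, v, w}" "bary w u v x = 0"
  shows "x \<in> closed_segment u v"
proof -
  have "bary u v w x *\<^sub>R u + bary v w u x *\<^sub>R v = x" "bary u v w x + bary v w u x = 1"
    using bary_sum[OF assms(1), of x] bary_expand[OF assms(1), of x] assms(3) by auto
  moreover have "bary v w u x \<ge> 0" "bary u v w x \<ge> 0"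
    using assms(1,2) convex_hull_3_bary by auto
  ultimately show ?thesis
    unfolding closed_segment_def by (intro CollectI exI[of _ "bary v w u x"]) (auto simp: eq_diff_eq[symmetric])
qed

text \<open>
  If all barycentric coordinates are positive, then they are so in a neighbourhood; otherwise one of them
  vanishes, which places the point on the opposite side.
\<close>

lemma region_cases:
  assumes "proper_triangle T" "x \<in> region T" "x \<notin> interior (region T)"
  obtains a b where "a \<in> vertices T" "b \<in> vertices T" "a \<noteq> b" "x \<in> closed_segment a b"
proof -
  obtain p a b where T: "T = Triangle p {a, b}" "a \<noteq> b" "p \<noteq> a" "p \<noteq> b" "det2 (a - p) (b - p) \<noteq> 0"
    using assms(1) by (rule proper_triangleE)
  have v: "vertices T = {p, a, b}"
    by (simp add: T vertices_def)
  have D: "det2 (b - a) (p - a) \<noteq> 0" "det2 (p - b) (a - b) \<noteq> 0"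
    using T(5) by (simp_all add: det2_def algebra_simps)
  have "\<not> (bary p a b x > 0 \<and> bary a b p x > 0 \<and> bary b p a x > 0)"
    using interior_region_bary[OF assms(1) v T(5)] assms(3) by blast
  then consider "bary p a b x = 0" | "bary a b p x = 0" | "bary b p a x = 0"
    using region_bary[OF assms(1) v T(5), of x] assms(2) by force
  moreover have h: "x \<in> convex hull {a, b, p}" "x \<in> convex hull {b, p, a}" "x \<in> convex hull {p, a, b}"
    using assms(2) v by (simp_all add: region_def insert_commute)
  ultimately show thesis
  proof cases
    case 1
    then show thesis
      using closed_segment_bary[OF D(1) h(1)] that[of a b] T v by auto
  next
    case 2
    then show thesis
      using closed_segment_bary[OF D(2) h(2)] that[of b p] T v by auto
  next
    case 3
    then show thesis
      using closed_segment_bary[OF T(5) h(3)] that[of p a] T v by auto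
  qed
qed

lemma interiors_meet:
  assumes "proper_triangle T" "proper_triangle T'" "x \<in> interior (region T)" "x \<in> region T'"
  shows "interior (region T) \<inter> interior (region T') \<noteq> {}"
  using assms closure_interior_region[OF assms(2)]
  by (metis IntI closure_iff_nhds_not_empty emptyE interior_subset open_interior subset_refl
      open_Int_closure_eq_empty)

section \<open>Newest vertex bisection\<close>

lemma children_Triangle:
  assumes "a \<noteq> b"
  shows "children (Triangle p {a, b}) = {Triangle (midpoint a b) {p, a}, Triangle (midpoint a b) {p, b}}"
  using assms by (simp add: children_def midpoint_def)

lemma det2_children:
  "det2 (p - midpoint a b) (a - midpoint a b) = det2 (a - p) (b - p) / 2"
  "det2 (p - midpoint a b) (b - midpoint a b) = - det2 (a - p) (b - p) / 2"
  by (simp_all add: det2_def midpoint_def field_simps)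

lemma proper_children: "proper_triangle T \<Longrightarrow> c \<in> children T \<Longrightarrow> proper_triangle c"
  by (auto simp: children_Triangle proper_triangle_iff det2_children elim!: proper_triangleE)

lemma area_children: "proper_triangle T \<Longrightarrow> c \<in> children T \<Longrightarrow> area c = area T / 2"
  by (auto simp: children_Triangle area_eq_det2 det2_children elim!: proper_triangleE)

text \<open>
  The sum of the squared lengths of the two sides at the newest vertex is a measure of the squared
  diameter that bisection halves exactly, by the parallelogram law. The quotient
  \<open>leg2 T / area T\<close> is therefore the same for all descendants of a triangle; this is the shape
  regularity of newest vertex bisection.
\<close>

definition leg2 :: "triangle \<Rightarrow> real" where
  "leg2 T = (\<Sum>a\<in>ref_ends T. (dist (newest_vertex T) a)\<^sup>2)"

lemma leg2_Triangle: "a \<noteq> b \<Longrightarrow> leg2 (Triangle p {a, b}) = (dist p a)\<^sup>2 + (dist p b)\<^sup>2"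
  by (simp add: leg2_def)

text \<open>
  The parallelogram law for \<open>p - m\<close> and \<open>a - m\<close>, where \<open>m\<close> is the midpoint of \<open>a\<close> and \<open>b\<close>.
\<close>

lemma dist_midpoint_parallelogram:
  fixes p a b :: "'a::real_inner"
  shows "(dist (midpoint a b) p)\<^sup>2 + (dist (midpoint a b) a)\<^sup>2 = ((dist p a)\<^sup>2 + (dist p b)\<^sup>2) / 2"
  unfolding dist_norm power2_norm_eq_inner midpoint_def
  by (simp add: inner_simps inner_commute field_simps)

lemma leg2_children:
  assumes "proper_triangle T" "c \<in> children T"
  shows "leg2 c = leg2 T / 2"
proof -
  obtain p a b where T: "T = Triangle p {a, b}" "a \<noteq> b" "p \<noteq> a" "p \<noteq> b"
    using assms(1) by (rule proper_triangleE)
  show ?thesis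
    using assms(2) T dist_midpoint_parallelogram[of a b p] dist_midpoint_parallelogram[of b a p]
    by (auto simp: children_Triangle leg2_Triangle midpoint_sym[of b a])
qed

lemma dist_vertices_le:
  assumes "proper_triangle T" "x \<in> vertices T" "y \<in> vertices T"
  shows "(dist x y)\<^sup>2 \<le> 2 * leg2 T"
proof -
  obtain p a b where T: "T = Triangle p {a, b}" "a \<noteq> b"
    using assms(1) by (rule proper_triangleE)
  have "dist a b \<le> dist p a + dist p b"
    by (metis dist_commute dist_triangle)
  then have "(dist a b)\<^sup>2 \<le> (dist p a + dist p b)\<^sup>2"
    by (simp add: power_mono)
  also have "\<dots> \<le> 2 * leg2 T"
    using sum_squares_bound[of "dist p a" "dist p b"] by (simp add: T leg2_Triangle power2_sum)
  finally show ?thesis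
    using assms(2,3) T by (auto simp: vertices_def leg2_Triangle dist_commute)
qed

lemma region_children:
  assumes "proper_triangle T"
  shows "(\<Union>c\<in>children T. region c) = region T"
proof -
  obtain p a b where T: "T = Triangle p {a, b}" "a \<noteq> b" "p \<noteq> a" "p \<noteq> b" "det2 (a - p) (b - p) \<noteq> 0"
    using assms by (rule proper_triangleE)
  let ?m = "midpoint a b"
  have D: "det2 (a - b) (p - b) \<noteq> 0"
    using T(5) by (simp add: det2_def algebra_simps)
  have "region T = convex hull (insert p (closed_segment a b))"
    by (simp add: T region_def vertices_def segment_convex_hull) (rule hull_insert)
  moreover have cone: "convex hull (insert p (closed_segment x y)) = (\<Union>z\<in>closed_segment x y. closed_segment p z)" for x y
    by (simp add: convex_hull_insert_segments hull_same convex_closed_segment)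
  ultimately have "region T = (\<Union>z\<in>closed_segment a b. closed_segment p z)"
    by metis
  also have "closed_segment a b = closed_segment a ?m \<union> closed_segment ?m b"
    by (rule Un_closed_segment[symmetric]) simp
  also have "(\<Union>z\<in>\<dots>. closed_segment p z)
      = convex hull (insert p (closed_segment a ?m)) \<union> convex hull (insert p (closed_segment ?m b))"
    by (simp only: UN_Un cone)
  also have "\<dots> = convex hull {p, a, ?m} \<union> convex hull {p, ?m, b}"
    by (simp only: segment_convex_hull hull_insert[of convex p, symmetric])
  also have "\<dots> = (\<Union>c\<in>children T. region c)"
    by (simp add: T children_Triangle region_def vertices_def insert_commute)
  finally show ?thesis ..
qed

lemma region_child_subset: "proper_triangle T \<Longrightarrow> c \<in> children T \<Longrightarrow> region c \<subseteq> region T"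
  using region_children by blast

lemma vertices_child: "proper_triangle T \<Longrightarrow> vertices T \<subseteq> (\<Union>c\<in>children T. vertices c)"
  by (auto simp: children_Triangle vertices_def elim!: proper_triangleE)

text \<open>
  The line through the newest vertex and the midpoint of the refinement edge separates the children:
  the functional \<open>g\<close> is constant on it, and the end points of the refinement edge lie symmetrically to it.
\<close>

lemma interiors_children:
  assumes "proper_triangle T" "c \<in> children T" "c' \<in> children T" "c \<noteq> c'"
  shows "interior (region c) \<inter> interior (region c') = {}"
proof -
  obtain p a b where T: "T = Triangle p {a, b}" "a \<noteq> b" "p \<noteq> a" "p \<noteq> b" "det2 (a - p) (b - p) \<noteq> 0"
    using assms(1) by (rule proper_triangleE)
  let ?m = "midpoint a b"
  define g :: "real^2" where "g = vector [- (p - ?m)$2, (p - ?m)$1]"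
  have g: "g \<bullet> x = det2 (p - ?m) x" for x
    by (simp add: g_def inner_vec_def sum_2 det2_def) (simp add: algebra_simps)
  define k where "k = g \<bullet> ?m"
  have pk: "g \<bullet> p = k"
    unfolding k_def g by (simp add: det2_def algebra_simps)
  have ab: "g \<bullet> a - k = - (g \<bullet> b - k)"
    unfolding k_def g by (simp add: det2_def midpoint_def field_simps)
  have ne: "g \<noteq> 0"
  proof
    assume "g = 0"
    then have "det2 (p - ?m) (a - ?m) = 0"
      by (metis g inner_zero_left)
    then show False
      using T(5) by (simp add: det2_children)
  qed
  have sub: "region (Triangle ?m {p, q}) \<subseteq> H" if "convex H" "?m \<in> H" "p \<in> H" "q \<in> H" for q H
    unfolding region_def using that by (intro hull_minimal) (auto simp: vertices_def)
  have disj: "interior (region (Triangle ?m {p, a})) \<inter> interior (region (Triangle ?m {p, b})) = {}"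
  proof (cases "g \<bullet> a \<ge> k")
    case True
    have "region (Triangle ?m {p, a}) \<subseteq> {x. g \<bullet> x \<ge> k}"
      using True by (intro sub convex_halfspace_ge) (auto simp: pk k_def)
    moreover have "region (Triangle ?m {p, b}) \<subseteq> {x. g \<bullet> x \<le> k}"
      using True ab by (intro sub convex_halfspace_le) (auto simp: pk k_def)
    ultimately have "interior (region (Triangle ?m {p, a})) \<subseteq> {x. g \<bullet> x > k}"
      "interior (region (Triangle ?m {p, b})) \<subseteq> {x. g \<bullet> x < k}"
      by (metis interior_mono interior_halfspace_ge[OF ne] interior_halfspace_le[OF ne])+
    then show ?thesis
      by fastforce
  next
    case False
    have "region (Triangle ?m {p, a}) \<subseteq> {x. g \<bullet> x \<le> k}"
      using False by (intro sub convex_halfspace_le) (auto simp: pk k_def)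
    moreover have "region (Triangle ?m {p, b}) \<subseteq> {x. g \<bullet> x \<ge> k}"
      using False ab by (intro sub convex_halfspace_ge) (auto simp: pk k_def)
    ultimately have "interior (region (Triangle ?m {p, a})) \<subseteq> {x. g \<bullet> x < k}"
      "interior (region (Triangle ?m {p, b})) \<subseteq> {x. g \<bullet> x > k}"
      by (metis interior_mono interior_halfspace_ge[OF ne] interior_halfspace_le[OF ne])+
    then show ?thesis
      by fastforce
  qed
  show ?thesis
    using assms(2-4) disj by (auto simp: T children_Triangle)
qed

lemma children_distinct:
  assumes "proper_triangle T"
  shows "card (children T) = 2" "T \<notin> children T"
proof -
  obtain p a b where T: "T = Triangle p {a, b}" "a \<noteq> b" "p \<noteq> a" "p \<noteq> b"
    using assms by (rule proper_triangleE)
  then show "card (children T) = 2"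
    by (auto simp: children_Triangle doubleton_eq_iff card_insert_if)
  show "T \<notin> children T"
    using area_children[OF assms, of T] area_pos[OF assms] by auto
qed

section \<open>Descendants, tilings and refinements\<close>

definition desc :: "triangle \<Rightarrow> triangle \<Rightarrow> bool" where
  "desc = (\<lambda>T K. K \<in> children T)\<^sup>*\<^sup>*"

lemma desc_refl [simp]: "desc T T"
  by (simp add: desc_def)

lemma desc_trans: "desc T K \<Longrightarrow> desc K L \<Longrightarrow> desc T L"
  by (simp add: desc_def)

lemma desc_child: "K \<in> children T \<Longrightarrow> desc T K"
  by (simp add: desc_def r_into_rtranclp)

lemma desc_cases:
  assumes "desc T K"
  obtains "K = T" | c where "c \<in> children T" "desc c K"
  using assms unfolding desc_def by (metis converse_rtranclpE)

lemma desc_proper: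
  assumes "desc T K" "proper_triangle T"
  shows "proper_triangle K"
  using assms unfolding desc_def by (induction rule: rtranclp_induct) (auto simp: proper_children)

lemma desc_region_area:
  assumes "desc T K" "proper_triangle T"
  shows "region K \<subseteq> region T \<and> area K \<le> area T \<and> leg2 K * area T = leg2 T * area K"
  using assms(1) unfolding desc_def
proof (induction rule: rtranclp_induct)
  case (step K L)
  have "proper_triangle K"
    using step.hyps(1) assms(2) desc_proper by (simp add: desc_def)
  then have L: "region L \<subseteq> region K" "area L = area K / 2" "leg2 L = leg2 K / 2" "area K > 0"
    using step.hyps(2) by (simp_all add: region_child_subset area_children leg2_children area_pos)
  have "leg2 L * area T = leg2 T * area L"
    using step.IH by (simp add: L(2,3))
  then show ?case
    using step.IH L(1,2,4) by (intro conjI) (blast, linarith, blast)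
qed simp

lemma desc_subset: "desc T K \<Longrightarrow> proper_triangle T \<Longrightarrow> region K \<subseteq> region T"
  using desc_region_area by blast

lemma desc_area_half:
  assumes "desc T K" "proper_triangle T" "K \<noteq> T"
  shows "area K \<le> area T / 2"
  using assms(1)
proof (cases rule: desc_cases)
  case (2 c)
  then show ?thesis
    using desc_region_area[of c K] proper_children area_children assms(2) by metis
qed (use assms in auto)

lemma desc_antisym:
  assumes "desc T K" "desc K T" "proper_triangle T"
  shows "K = T"
  using desc_area_half[OF assms(1,3)] desc_region_area[OF assms(2) desc_proper[OF assms(1,3)]]
    area_pos[OF assms(3)] by force

text \<open>
  Siblings have disjoint interiors, so the paths from the root of the binary tree to two overlapping
  triangles do not separate before one of them ends.
\<close>

lemma desc_nested:
  assumes "desc T K" "desc T L" "proper_triangle T" "interior (region K) \<inter> interior (region L) \<noteq> {}"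
  shows "desc K L \<or> desc L K"
  using assms unfolding desc_def
proof (induction arbitrary: L rule: converse_rtranclp_induct)
  case base
  then show ?case
    by simp
next
  case (step T c)
  have "desc T L"
    using step.prems(1) by (simp add: desc_def)
  then show ?case
  proof (cases rule: desc_cases)
    case 1
    then show ?thesis
      using step.hyps by (meson converse_rtranclp_into_rtranclp)
  next
    case (2 d)
    have p: "proper_triangle c" "proper_triangle d"
      using step.prems(2) step.hyps(1) 2(1) proper_children by blast+
    have "interior (region K) \<subseteq> interior (region c)" "interior (region L) \<subseteq> interior (region d)"
      using step.hyps(2) 2(2) p by (auto simp: desc_def[symmetric] intro!: interior_mono dest: desc_subset)
    then have "interior (region c) \<inter> interior (region d) \<noteq> {}"
      using step.prems(3) by blast
    then have "c = d"
      using interiors_children[OF step.prems(2) step.hyps(1) 2(1)] by blast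
    then show ?thesis
      using step.IH[of L] 2(2) p step.prems(3) by (simp add: desc_def)
  qed
qed

definition tiling :: "triangle set \<Rightarrow> bool" where
  "tiling P \<longleftrightarrow> finite P \<and> (\<forall>T\<in>P. proper_triangle T) \<and>
     (\<forall>T\<in>P. \<forall>T'\<in>P. T \<noteq> T' \<longrightarrow> interior (region T) \<inter> interior (region T') = {})"

abbreviation cover :: "triangle set \<Rightarrow> (real^2) set" where
  "cover P \<equiv> (\<Union>T\<in>P. region T)"

lemma tilingD:
  assumes "tiling P"
  shows "finite P" "T \<in> P \<Longrightarrow> proper_triangle T"
    "T \<in> P \<Longrightarrow> T' \<in> P \<Longrightarrow> interior (region T) \<inter> interior (region T') \<noteq> {} \<Longrightarrow> T = T'"
  using assms by (auto simp: tiling_def)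

lemma tiling_subset: "tiling P \<Longrightarrow> Q \<subseteq> P \<Longrightarrow> tiling Q"
  unfolding tiling_def by (meson finite_subset subsetD)

lemma tiling_singleton: "proper_triangle T \<Longrightarrow> tiling {T}"
  by (simp add: tiling_def)

lemma tiling_desc_eq:
  assumes "tiling P" "T \<in> P" "T' \<in> P" "desc T K" "desc T' L" "interior (region K) \<inter> interior (region L) \<noteq> {}"
  shows "T = T'"
proof -
  have "interior (region K) \<subseteq> interior (region T)" "interior (region L) \<subseteq> interior (region T')"
    using assms tilingD(2)[OF assms(1)] by (auto intro!: interior_mono dest: desc_subset)
  then show ?thesis
    using tilingD(3)[OF assms(1-3)] assms(6) by blast
qed

lemma tiling_desc_nested:
  assumes "tiling P" "T \<in> P" "T' \<in> P" "desc T K" "desc T' L" "interior (region K) \<inter> interior (region L) \<noteq> {}"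
  shows "desc K L \<or> desc L K"
  using tiling_desc_eq[OF assms] desc_nested[of T K L] assms tilingD(2) by blast

lemma tiling_bisect:
  assumes "tiling P" "T \<in> P"
  shows "tiling (P - {T} \<union> children T)" "cover (P - {T} \<union> children T) = cover P"
    "children T \<inter> P = {}"
proof -
  have T: "proper_triangle T"
    using assms tilingD(2) by blast
  have fin: "finite (children T)"
    using children_distinct(1)[OF T] by (metis card.infinite zero_neq_numeral)
  have sub: "interior (region c) \<subseteq> interior (region T)" if "c \<in> children T" for c
    using that T by (simp add: interior_mono region_child_subset)
  have disj: "interior (region c) \<inter> interior (region K) = {}" if "c \<in> children T" "K \<in> P" "K \<noteq> T" for c K
    using that sub tilingD(3)[OF assms(1) that(2) assms(2)] by blast
  show "tiling (P - {T} \<union> children T)"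
    unfolding tiling_def
  proof (intro conjI ballI impI)
    show "finite (P - {T} \<union> children T)"
      using fin tilingD(1)[OF assms(1)] by simp
    show "proper_triangle K" if "K \<in> P - {T} \<union> children T" for K
      using that tilingD(2)[OF assms(1)] proper_children[OF T] by blast
    fix K L assume KL: "K \<in> P - {T} \<union> children T" "L \<in> P - {T} \<union> children T" "K \<noteq> L"
    then consider "K \<in> children T" "L \<in> children T" | "K \<in> children T" "L \<in> P" "L \<noteq> T"
      | "L \<in> children T" "K \<in> P" "K \<noteq> T" | "K \<in> P" "L \<in> P"
      by blast
    then show "interior (region K) \<inter> interior (region L) = {}"
    proof cases
      case 3
      then show ?thesis
        using disj[of L K] by blast
    next
      case 4
      then show ?thesis
        using tilingD(3)[OF assms(1)] KL(3) by blast
    qed (use KL(3) disj interiors_children[OF T] in blast)+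
  qed
  show "cover (P - {T} \<union> children T) = cover P"
    using region_children[OF T] assms(2) by blast
  show "children T \<inter> P = {}"
    using disj T proper_children interior_region_nonempty children_distinct(2)[OF T] by fastforce
qed

lemma coarser_eq_refl [simp]: "coarser_eq P P"
  by (simp add: coarser_eq_def)

lemma coarser_eq_trans: "coarser_eq P Q \<Longrightarrow> coarser_eq Q R \<Longrightarrow> coarser_eq P R"
  by (simp add: coarser_eq_def)

lemma coarser_eqD:
  assumes "coarser_eq P Q" "tiling P"
  shows "tiling Q \<and> cover Q = cover P \<and> (\<forall>K\<in>Q. \<exists>T\<in>P. desc T K) \<and> (\<Union>T\<in>P. vertices T) \<subseteq> (\<Union>K\<in>Q. vertices K)"
  using assms(1) unfolding coarser_eq_def
proof (induction rule: rtranclp_induct)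
  case base
  then show ?case
    using assms(2) desc_refl by blast
next
  case (step Q R)
  from step.hyps(2) obtain T where T: "T \<in> Q" "R = Q - {T} \<union> children T"
    by (auto simp: nvb_step_def)
  have p: "proper_triangle T"
    using step.IH T(1) tilingD(2)[of Q T] by simp
  have "\<exists>S\<in>P. desc S K" if K: "K \<in> R" for K
  proof (cases "K \<in> Q")
    case False
    then have "desc T K"
      using K T(2) by (simp add: desc_child)
    moreover obtain S where "S \<in> P" "desc S T"
      using step.IH T(1) by blast
    ultimately show ?thesis
      using desc_trans by blast
  qed (use step.IH in blast)
  moreover have "(\<Union>T\<in>Q. vertices T) \<subseteq> (\<Union>K\<in>R. vertices K)"
    using vertices_child[OF p] unfolding T(2) by blast
  ultimately show ?case
    using tiling_bisect[of Q T] step.IH T by (metis (no_types, lifting) subset_trans)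
qed

text \<open>
  For a refinement \<open>Q\<close> these are the leaves of the subtree of \<open>T\<close>.
\<close>

definition below :: "triangle set \<Rightarrow> triangle \<Rightarrow> triangle set" where
  "below Q T = {K \<in> Q. desc T K}"

text \<open>
  For tilings this is the refinement relation (\<open>coarser_eq_iff_tree_refines\<close>), stated without reference
  to an order of the bisections; in this form it can be checked for overlays.
\<close>

definition tree_refines :: "triangle set \<Rightarrow> triangle set \<Rightarrow> bool" where
  "tree_refines P Q \<longleftrightarrow> tiling P \<and> tiling Q \<and> cover Q = cover P \<and> (\<forall>K\<in>Q. \<exists>T\<in>P. desc T K)"

text \<open>
  A leaf that meets the interior of \<open>T\<close> cannot descend from another triangle of the tiling; as a closed
  set the union of the leaves of \<open>T\<close> then contains all of \<open>T\<close>.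
\<close>

lemma cover_below:
  assumes "tree_refines P Q" "T \<in> P"
  shows "cover (below Q T) = region T"
proof
  have P: "tiling P" "tiling Q" "cover Q = cover P" "\<forall>K\<in>Q. \<exists>T\<in>P. desc T K"
    using assms by (auto simp: tree_refines_def)
  have T: "proper_triangle T"
    using P assms tilingD(2) by blast
  show "cover (below Q T) \<subseteq> region T"
    using desc_subset[OF _ T] by (auto simp: below_def)
  have "interior (region T) \<subseteq> cover (below Q T)"
  proof
    fix x assume x: "x \<in> interior (region T)"
    then have "x \<in> cover Q"
      using assms(2) interior_subset by (fastforce simp: P(3))
    then obtain K where K: "K \<in> Q" "x \<in> region K"
      by blast
    then obtain T' where T': "T' \<in> P" "desc T' K"
      using P(4) by blast
    have "proper_triangle T'"
      using P(1) T'(1) tilingD(2) by blast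
    moreover then have "x \<in> region T'"
      using K T' desc_subset by blast
    ultimately have "T = T'"
      using tilingD(3)[OF P(1) assms(2) T'(1)] interiors_meet[OF T _ x] by blast
    then show "x \<in> cover (below Q T)"
      using K T' by (auto simp: below_def)
  qed
  moreover have "closed (cover (below Q T))"
    using tilingD[OF P(2)] by (intro closed_UN) (auto simp: below_def compact_imp_closed compact_region)
  ultimately show "region T \<subseteq> cover (below Q T)"
    using closure_minimal closure_interior_region[OF T] by metis
qed

lemma below_nonempty:
  assumes "tree_refines P Q" "T \<in> P"
  shows "below Q T \<noteq> {}"
  using cover_below[OF assms] assms vertices_subset_region[of T] by (auto simp: vertices_def)

lemma below_disjoint:
  assumes "tree_refines P Q" "T \<in> P" "T' \<in> P" "T \<noteq> T'"
  shows "below Q T \<inter> below Q T' = {}"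
proof -
  have "T = T'" if "K \<in> below Q T" "K \<in> below Q T'" for K
    using that assms tiling_desc_eq[of P T T' K K] interior_region_nonempty tilingD(2)[of Q]
    by (auto simp: tree_refines_def below_def)
  then show ?thesis
    using assms(4) by blast
qed

lemma Union_below: "tree_refines P Q \<Longrightarrow> (\<Union>T\<in>P. below Q T) = Q"
  by (auto simp: tree_refines_def below_def)

lemma sum_below:
  assumes "tree_refines P Q"
  shows "(\<Sum>K\<in>Q. h K) = (\<Sum>T\<in>P. \<Sum>K\<in>below Q T. h K)"
proof -
  have "finite P" "finite Q"
    using assms tilingD(1,2) by (auto simp: tree_refines_def)
  then have "(\<Sum>K\<in>(\<Union>T\<in>P. below Q T). h K) = (\<Sum>T\<in>P. \<Sum>K\<in>below Q T. h K)"
    using below_disjoint[OF assms] by (intro sum.UNION_disjoint) (auto simp: below_def)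
  then show ?thesis
    by (simp add: Union_below[OF assms])
qed

lemma below_leaf:
  assumes "tree_refines P Q" "T \<in> P" "T \<in> Q"
  shows "below Q T = {T}"
proof -
  have Q: "tiling Q"
    using assms by (simp add: tree_refines_def)
  have "K = T" if "K \<in> Q" "desc T K" for K
  proof -
    have "interior (region K) \<subseteq> interior (region T)"
      using that assms(3) tilingD(2)[OF Q] by (intro interior_mono desc_subset)
    then show ?thesis
      using tilingD(3)[OF Q that(1) assms(3)] interior_region_nonempty[of K] that(1) tilingD(2)[OF Q] by blast
  qed
  then show ?thesis
    using assms(3) by (auto simp: below_def)
qed

lemma tree_refines_card_le:
  assumes "tree_refines P Q"
  shows "card P \<le> card Q"
proof -
  have fin: "finite P" "finite Q"
    using assms tilingD(1,2) by (auto simp: tree_refines_def)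
  have "card P = (\<Sum>T\<in>P. 1)"
    by simp
  also have "\<dots> \<le> (\<Sum>T\<in>P. \<Sum>K\<in>below Q T. 1)"
    using below_nonempty[OF assms] fin by (intro sum_mono) (simp add: Suc_leI card_gt_0_iff below_def)
  also have "\<dots> = card Q"
    by (subst sum_below[OF assms, symmetric]) simp
  finally show ?thesis .
qed

text \<open>
  A tiling all of whose triangles descend from another tiling of the same set arises from it by
  bisections: bisecting a triangle that is not a leaf preserves the situation, and the number of
  triangles is bounded by that of the finer tiling.
\<close>

lemma tree_refines_imp_coarser_eq:
  assumes "tree_refines P Q"
  shows "coarser_eq P Q"
  using assms
proof (induction "card Q - card P" arbitrary: P rule: less_induct)
  case less
  have P: "tiling P" "tiling Q" "cover Q = cover P" "\<forall>K\<in>Q. \<exists>T\<in>P. desc T K"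
    using less.prems by (auto simp: tree_refines_def)
  show ?case
  proof (cases "P \<subseteq> Q")
    case True
    have "below Q T = {T}" if "T \<in> P" for T
      using below_leaf[OF less.prems that] True that by blast
    then have "Q = P"
      using Union_below[OF less.prems] by auto
    then show ?thesis
      by simp
  next
    case False
    then obtain T where T: "T \<in> P" "T \<notin> Q"
      by blast
    let ?P = "P - {T} \<union> children T"
    have p: "proper_triangle T"
      using T P tilingD(2) by blast
    have "\<exists>S\<in>?P. desc S K" if K: "K \<in> Q" for K
    proof -
      obtain S where S: "S \<in> P" "desc S K"
        using P(4) K by blast
      show ?thesis
        using S(2) by (cases rule: desc_cases) (use S T K in \<open>cases "S = T"; blast intro: desc_refl\<close>)+
    qed
    then have ref: "tree_refines ?P Q"
      using P tiling_bisect[OF P(1) T(1)] by (simp add: tree_refines_def)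
    have fin: "finite P" "finite (children T)"
      using tilingD(1) P(1) tilingD(1)[of ?P] ref by (auto simp: tree_refines_def)
    have "card ?P = card (P - {T}) + card (children T)"
      using fin tiling_bisect(3)[OF P(1) T(1)] by (intro card_Un_disjoint) auto
    then have "card ?P = Suc (card P)"
      using card.remove[OF fin(1) T(1)] by (simp add: children_distinct(1)[OF p])
    then have "coarser_eq ?P Q"
      using tree_refines_card_le[OF ref] by (intro less.hyps ref) linarith
    moreover have "nvb_step P ?P"
      using T by (auto simp: nvb_step_def)
    ultimately show ?thesis
      by (simp add: coarser_eq_def converse_rtranclp_into_rtranclp)
  qed
qed

lemma coarser_eq_iff_tree_refines:
  assumes "tiling P"
  shows "coarser_eq P Q \<longleftrightarrow> tree_refines P Q"
proof
  assume "coarser_eq P Q"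
  then show "tree_refines P Q"
    using coarser_eqD[of P Q, OF _ assms] assms unfolding tree_refines_def by fast
qed (rule tree_refines_imp_coarser_eq)

lemma coarser_eq_below:
  assumes "tree_refines P Q" "T \<in> P"
  shows "coarser_eq {T} (below Q T)"
proof (rule tree_refines_imp_coarser_eq)
  have "proper_triangle T"
    using assms tilingD(1,2) by (auto simp: tree_refines_def)
  then show "tree_refines {T} (below Q T)"
    using assms cover_below[OF assms] tiling_subset[of Q "below Q T"]
    by (auto simp: tree_refines_def tiling_singleton below_def)
qed

text \<open>
  Induction from the finest tiling backwards. Unlike the induction rule of the transitive closure it
  keeps the information that the intermediate tilings are coarser than \<open>Q\<close>, so that their vertices are
  vertices of \<open>Q\<close>.
\<close>

lemma coarser_eq_induct [consumes 2, case_names base bisect]: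
  assumes "coarser_eq P Q" "tiling P"
    and "R Q"
    and "\<And>P T. tiling P \<Longrightarrow> T \<in> P \<Longrightarrow> coarser_eq (P - {T} \<union> children T) Q \<Longrightarrow>
      R (P - {T} \<union> children T) \<Longrightarrow> R P"
  shows "R P"
  using assms(1,2) unfolding coarser_eq_def
proof (induction rule: converse_rtranclp_induct)
  case (step P P')
  then obtain T where T: "T \<in> P" "P' = P - {T} \<union> children T"
    by (auto simp: nvb_step_def)
  then show ?case
    using assms(4)[OF step.prems T(1)] step tiling_bisect(1)[OF step.prems T(1)] by (simp add: coarser_eq_def)
qed (rule assms(3))

section \<open>Conforming triangulations\<close>

lemma conformingD:
  assumes "conforming_triangulation \<Omega> \<T>"
  shows "finite \<T>" "T \<in> \<T> \<Longrightarrow> proper_triangle T" "inj_on region \<T>" "cover \<T> = closure \<Omega>"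
    "T \<in> \<T> \<Longrightarrow> T' \<in> \<T> \<Longrightarrow> (region T \<inter> region T') face_of region T"
    "T \<in> \<T> \<Longrightarrow> T' \<in> \<T> \<Longrightarrow> (region T \<inter> region T') face_of region T'"
proof -
  have tri: "triangulation (region ` \<T>)"
    using assms by (simp add: conforming_triangulation_def)
  show face: "T \<in> \<T> \<Longrightarrow> T' \<in> \<T> \<Longrightarrow> (region T \<inter> region T') face_of region T" for T T'
    using tri by (simp add: triangulation_def)
  show "T \<in> \<T> \<Longrightarrow> T' \<in> \<T> \<Longrightarrow> (region T \<inter> region T') face_of region T'" for T T'
    using face[of T' T] by (simp add: Int_commute)
qed (use assms in \<open>auto simp: conforming_triangulation_def\<close>)

lemma conforming_interiors_meet:
  assumes "conforming_triangulation \<Omega> \<T>" "T \<in> \<T>" "T' \<in> \<T>" "x \<in> interior (region T)" "x \<in> region T'"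
  shows "T = T'"
proof -
  have p: "proper_triangle T" "proper_triangle T'"
    using assms conformingD(2) by blast+
  let ?F = "region T \<inter> region T'"
  have "interior (region T) \<inter> interior (region T') \<noteq> {}"
    using interiors_meet[OF p assms(4,5)] .
  then have "?F \<inter> interior (region T) \<noteq> {}" "?F \<inter> interior (region T') \<noteq> {}"
    using interior_subset by blast+
  then have "?F = region T" "?F = region T'"
    using face_of_disjoint_interior conformingD(5,6)[OF assms(1-3)] by blast+
  then show ?thesis
    using conformingD(3)[OF assms(1)] assms(2,3) by (auto dest: inj_onD)
qed

lemma conforming_tiling: "conforming_triangulation \<Omega> \<T> \<Longrightarrow> tiling \<T>"
  unfolding tiling_def
proof (intro conjI ballI impI)
  assume conf: "conforming_triangulation \<Omega> \<T>"
  show "finite \<T>" "\<And>T. T \<in> \<T> \<Longrightarrow> proper_triangle T"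
    using conformingD(1,2)[OF conf] by auto
  show "interior (region T) \<inter> interior (region T') = {}" if "T \<in> \<T>" "T' \<in> \<T>" "T \<noteq> T'" for T T'
    using conforming_interiors_meet[OF conf that(1,2)] that(3) interior_subset[of "region T'"] by blast
qed

text \<open>
  There are no hanging nodes: the vertices are the extreme points, and extremality passes to a common face
  and from there to the other triangle.
\<close>

lemma vertex_in_region:
  assumes "conforming_triangulation \<Omega> \<T>" "K \<in> \<T>" "T \<in> \<T>" "z \<in> vertices K" "z \<in> region T"
  shows "z \<in> vertices T"
proof -
  let ?F = "region K \<inter> region T"
  have "z extreme_point_of region K"
    using assms conformingD(2) extreme_point_region by blast
  then have "z extreme_point_of ?F"
    using extreme_point_of_face[OF conformingD(5)[OF assms(1-3)]] assms(4,5) vertices_subset_region by blast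
  then have "z extreme_point_of region T"
    using extreme_point_of_face[OF conformingD(6)[OF assms(1-3)]] by blast
  then show ?thesis
    using assms conformingD(2) extreme_point_region by blast
qed

lemma vertex_not_in_open_segment:
  assumes "conforming_triangulation \<Omega> \<T>" "K \<in> \<T>" "T \<in> \<T>" "z \<in> vertices K" "x \<in> region T" "y \<in> region T"
  shows "z \<notin> open_segment x y"
proof
  assume z: "z \<in> open_segment x y"
  then have "z \<in> region T"
    using assms(5,6) convex_region[of T] by (meson convex_contains_open_segment subsetD)
  then have "z extreme_point_of region T"
    using vertex_in_region[OF assms(1-4)] conformingD(2)[OF assms(1,3)] extreme_point_region by blast
  then show False
    using z assms(5,6) by (auto simp: extreme_point_of_def)
qed

lemma side_subset_region: "x \<in> vertices T \<Longrightarrow> y \<in> vertices T \<Longrightarrow> closed_segment x y \<subseteq> region T"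
  using vertices_subset_region[of T] convex_region[of T] by (intro closed_segment_subset) auto

lemma bary_affine_sum:
  assumes "r + s + t = 1"
  shows "bary u v w (r *\<^sub>R x + s *\<^sub>R y + t *\<^sub>R z) = r * bary u v w x + s * bary u v w y + t * bary u v w z"
proof -
  obtain c g where cg: "\<forall>x. bary u v w x = c + g \<bullet> x"
    using bary_affine by blast
  have "c = r * c + s * c + t * c"
    using assms by (metis distrib_right mult_1)
  then show ?thesis
    by (simp add: cg inner_simps algebra_simps)
qed

text \<open>
  If the intersection contained a point off the common side, then the barycentre of that point and the end
  points of the side would be interior to \<open>T\<close>.
\<close>

lemma shared_side:
  assumes conf: "conforming_triangulation \<Omega> \<T>" and T: "T \<in> \<T>" "T' \<in> \<T>" "T \<noteq> T'" "x \<noteq> y"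
    and xy: "x \<in> vertices T" "y \<in> vertices T" "x \<in> vertices T'" "y \<in> vertices T'"
  shows "region T \<inter> region T' = closed_segment x y"
proof
  show "closed_segment x y \<subseteq> region T \<inter> region T'"
    using side_subset_region xy by simp
  show "region T \<inter> region T' \<subseteq> closed_segment x y"
  proof
    fix w assume w: "w \<in> region T \<inter> region T'"
    have p: "proper_triangle T"
      using conf T conformingD(2) by blast
    obtain z where z: "vertices T = {x, y, z}" "det2 (y - x) (z - x) \<noteq> 0"
      using obtain_third_vertex[OF p xy(1,2) T(4)] by blast
    show "w \<in> closed_segment x y"
    proof (rule ccontr)
      assume "w \<notin> closed_segment x y"
      then have pos: "bary z x y w > 0"
        using closed_segment_bary[OF z(2), of w] w region_bary[OF p z, of w] z(1)
        by (auto simp: region_def less_le)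
      have D: "det2 (z - y) (x - y) \<noteq> 0" "det2 (x - z) (y - z) \<noteq> 0"
        using z(2) by (simp_all add: det2_def algebra_simps)
      (* The barycentre of w and the end points has three positive coordinates. *)
      define c where "c = (1/3) *\<^sub>R w + (1/3) *\<^sub>R x + (1/3) *\<^sub>R y"
      have "bary u v v' c = (1/3) * bary u v v' w + (1/3) * bary u v v' x + (1/3) * bary u v v' y" for u v v'
        unfolding c_def by (rule bary_affine_sum) simp
      then have "bary x y z c > 0" "bary y z x c > 0" "bary z x y c > 0"
        using pos region_bary[OF p z, of w] w bary_simps[OF z(2)] bary_simps[OF D(1)] bary_simps[OF D(2)]
        by auto
      then have c: "c \<in> interior (region T)"
        using interior_region_bary[OF p z] by blast
      have "c \<in> convex hull {w, x, y}"
        unfolding convex_hull_3 c_def by force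
      also have "\<dots> \<subseteq> region T'"
        using w xy vertices_subset_region convex_region by (intro hull_minimal) auto
      finally show False
        using conforming_interiors_meet[OF conf T(1,2) c] T(3) by blast
    qed
  qed
qed

text \<open>
  A face that meets the relative interior of a side contains its end points.
\<close>

lemma open_side_vertices:
  assumes conf: "conforming_triangulation \<Omega> \<T>" and T: "T \<in> \<T>" "K \<in> \<T>"
    and xy: "x \<in> vertices T" "y \<in> vertices T" and w: "w \<in> open_segment x y" "w \<in> region K"
  shows "x \<in> vertices K \<and> y \<in> vertices K"
proof -
  have r: "x \<in> region T" "y \<in> region T"
    using xy vertices_subset_region by blast+
  then have "w \<in> region T"
    using w(1) convex_region[of T] by (meson convex_contains_open_segment subsetD)
  then have "x \<in> region K \<and> y \<in> region K"
    using face_ofD[OF conformingD(5)[OF conf T] w(1) r] w(2) by blast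
  then show ?thesis
    using vertex_in_region[OF conf T] xy by blast
qed

lemma ball_avoiding:
  fixes y :: "'a::metric_space"
  assumes "finite \<F>" "\<And>F. F \<in> \<F> \<Longrightarrow> closed F" "\<And>F. F \<in> \<F> \<Longrightarrow> y \<notin> F"
  obtains e where "e > 0" "ball y e \<inter> \<Union>\<F> = {}"
proof -
  have "open (- \<Union>\<F>)" "y \<in> - \<Union>\<F>"
    using assms by (auto intro: closed_Union)
  then obtain e where "e > 0" "ball y e \<subseteq> - \<Union>\<F>"
    using openE by blast
  then show thesis
    using that by blast
qed

lemma local_cover:
  assumes "conforming_triangulation \<Omega> \<T>"
  obtains e where "e > 0" "ball y e \<inter> closure \<Omega> \<subseteq> cover {K \<in> \<T>. y \<in> region K}"
proof -
  obtain e where e: "e > 0" "ball y e \<inter> \<Union>(region ` {K \<in> \<T>. y \<notin> region K}) = {}"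
    using conformingD(1,2)[OF assms] by (rule_tac ball_avoiding[of "region ` {K \<in> \<T>. y \<notin> region K}" y])
      (auto simp: compact_imp_closed compact_region)
  have "closure \<Omega> = cover \<T>"
    using conformingD(4)[OF assms] by simp
  then have "ball y e \<inter> closure \<Omega> \<subseteq> cover {K \<in> \<T>. y \<in> region K}"
    using e(2) by blast
  then show thesis
    using that e(1) by blast
qed

text \<open>
  Near a relatively interior point of a side only the sign of the third barycentric coordinate matters;
  the other two are positive.
\<close>

lemma local_half_plane:
  assumes p: "proper_triangle T" and xy: "x \<in> vertices T" "y \<in> vertices T" "x \<noteq> y"
  shows "\<exists>s. \<forall>w\<in>open_segment x y. \<exists>e>0. \<forall>v\<in>ball w e. v \<in> region T \<longleftrightarrow> s * det2 (x - v) (y - v) \<ge> 0"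
proof -
  obtain z where z: "vertices T = {x, y, z}" "det2 (y - x) (z - x) \<noteq> 0"
    using obtain_third_vertex[OF p xy] by blast
  have D: "det2 (z - y) (x - y) \<noteq> 0" "det2 (x - z) (y - z) \<noteq> 0"
    using z(2) by (simp_all add: det2_def algebra_simps)
  define s where "s = inverse (det2 (x - z) (y - z))"
  have s: "bary z x y v = s * det2 (x - v) (y - v)" for v
    by (simp add: bary_def s_def divide_inverse mult.commute)
  have "\<exists>e>0. \<forall>v\<in>ball w e. v \<in> region T \<longleftrightarrow> s * det2 (x - v) (y - v) \<ge> 0" if w: "w \<in> open_segment x y" for w
  proof -
    obtain u where u: "0 < u" "u < 1" "w = (1 - u) *\<^sub>R x + u *\<^sub>R y"
      using w by (auto simp: in_segment)
    have "bary a b c w = (1 - u) * bary a b c x + u * bary a b c y" for a b c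
      using bary_affine_sum[of "1 - u" u 0 a b c x y x] u(3) by simp
    then have "bary x y z w > 0" "bary y z x w > 0"
      using u bary_simps[OF z(2)] bary_simps[OF D(1)] by auto
    moreover have "open ({v. bary x y z v > 0} \<inter> {v. bary y z x v > 0})"
      by (intro open_Int open_Collect_less continuous_bary continuous_on_const)
    ultimately obtain e where "e > 0" "ball w e \<subseteq> {v. bary x y z v > 0} \<inter> {v. bary y z x v > 0}"
      using openE by (metis (no_types, lifting) IntI mem_Collect_eq)
    then show ?thesis
      using region_bary[OF p z] s by (intro exI[of _ e]) force
  qed
  then show ?thesis
    by blast
qed

text \<open>
  Around each relatively interior point of a side the triangulation looks like the same union of half
  planes bounded by the line of the side, a set that is invariant under translations along the side.
  Hence all these points are interior to the domain or none is.
\<close>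

lemma side_boundary_cases:
  assumes dom: "polygonal_domain \<Omega>" and conf: "conforming_triangulation \<Omega> \<T>"
    and T: "T \<in> \<T>" and xy: "x \<in> vertices T" "y \<in> vertices T" "x \<noteq> y"
  shows "closed_segment x y \<subseteq> frontier \<Omega> \<or> open_segment x y \<subseteq> \<Omega>"
proof -
  have \<Omega>: "open \<Omega>" "interior (closure \<Omega>) = \<Omega>"
    using dom by (auto simp: polygonal_domain_def)
  define P where "P = {K \<in> \<T>. x \<in> vertices K \<and> y \<in> vertices K}"
  have finP: "finite P"
    using conformingD(1)[OF conf] by (simp add: P_def)
  have "\<exists>s. \<forall>w\<in>open_segment x y. \<exists>e>0. \<forall>v\<in>ball w e. v \<in> region K \<longleftrightarrow> s * det2 (x - v) (y - v) \<ge> 0"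
    if "K \<in> P" for K
    using that xy(3) by (intro local_half_plane conformingD(2)[OF conf]) (auto simp: P_def)
  then obtain s where s: "\<forall>K\<in>P. \<forall>w\<in>open_segment x y. \<exists>e>0. \<forall>v\<in>ball w e.
      v \<in> region K \<longleftrightarrow> s K * det2 (x - v) (y - v) \<ge> 0"
    by metis
  define H where "H = {v. \<exists>K\<in>P. s K * det2 (x - v) (y - v) \<ge> 0}"
  have local: "\<exists>e>0. ball w e \<inter> closure \<Omega> = ball w e \<inter> H" if w: "w \<in> open_segment x y" for w
  proof -
    have "{K \<in> \<T>. w \<in> region K} \<subseteq> P"
      using open_side_vertices[OF conf T _ xy(1,2) w] by (auto simp: P_def)
    moreover obtain e where e: "e > 0" "ball w e \<inter> closure \<Omega> \<subseteq> cover {K \<in> \<T>. w \<in> region K}"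
      using local_cover[OF conf] by blast
    moreover have "cover P \<subseteq> closure \<Omega>"
      using conformingD(4)[OF conf] by (auto simp: P_def)
    ultimately have cov: "ball w e \<inter> closure \<Omega> = ball w e \<inter> cover P"
      by blast
    obtain d where d: "\<forall>K\<in>P. d K > 0 \<and> (\<forall>v\<in>ball w (d K). v \<in> region K \<longleftrightarrow> s K * det2 (x - v) (y - v) \<ge> 0)"
      using bchoice[of P "\<lambda>K e. e > 0 \<and> (\<forall>v\<in>ball w e. v \<in> region K \<longleftrightarrow> s K * det2 (x - v) (y - v) \<ge> 0)"] s w
      by blast
    define e' where "e' = Min (insert e (d ` P))"
    have e': "e' > 0" "e' \<le> e" "\<And>K. K \<in> P \<Longrightarrow> e' \<le> d K"
      using finP d e(1) by (auto simp: e'_def)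
    have "v \<in> cover P \<longleftrightarrow> v \<in> H" if v: "v \<in> ball w e'" for v
    proof -
      have "v \<in> region K \<longleftrightarrow> s K * det2 (x - v) (y - v) \<ge> 0" if "K \<in> P" for K
        using d that v e'(3)[OF that] by auto
      then show ?thesis
        by (auto simp: H_def)
    qed
    then have "ball w e' \<inter> cover P = ball w e' \<inter> H"
      by blast
    moreover have "ball w e' \<subseteq> ball w e"
      using e'(2) by auto
    ultimately have "ball w e' \<inter> closure \<Omega> = ball w e' \<inter> H"
      using cov by blast
    then show ?thesis
      using e'(1) by blast
  qed
  have inH: "w \<in> \<Omega> \<longleftrightarrow> w \<in> interior H" if w: "w \<in> open_segment x y" for w
  proof -
    obtain e where e: "e > 0" "ball w e \<inter> closure \<Omega> = ball w e \<inter> H"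
      using local[OF w] by blast
    have "w \<in> interior (closure \<Omega>) \<longleftrightarrow> w \<in> interior (ball w e \<inter> closure \<Omega>)"
      using e(1) by (simp add: interior_open)
    also have "\<dots> \<longleftrightarrow> w \<in> interior H"
      using e by (simp add: interior_open)
    finally show ?thesis
      using \<Omega>(2) by simp
  qed
  have det: "det2 (x - (v + t *\<^sub>R (y - x))) (y - (v + t *\<^sub>R (y - x))) = det2 (x - v) (y - v)" for v t
    by (simp add: det2_def algebra_simps)
  have transl: "w' \<in> interior H" if w: "w \<in> open_segment x y" "w' \<in> open_segment x y" "w \<in> interior H" for w w'
  proof -
    obtain u u' where u: "w = (1 - u) *\<^sub>R x + u *\<^sub>R y" "w' = (1 - u') *\<^sub>R x + u' *\<^sub>R y"
      using w by (auto simp: in_segment)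
    have w': "w' = (u' - u) *\<^sub>R (y - x) + w"
      unfolding u by (simp add: algebra_simps)
    have "(+) ((u' - u) *\<^sub>R (y - x)) ` H \<subseteq> H"
      using det[of _ "u' - u"] by (auto simp: H_def add.commute)
    then have "interior ((+) ((u' - u) *\<^sub>R (y - x)) ` H) \<subseteq> interior H"
      by (rule interior_mono)
    then show ?thesis
      using w(3) w' by (auto simp: interior_translation)
  qed
  show ?thesis
  proof (cases "open_segment x y \<inter> \<Omega> = {}")
    case True
    have "open_segment x y \<subseteq> closure \<Omega>"
      using side_subset_region[OF xy(1,2)] conformingD(4)[OF conf] T segment_open_subset_closed by blast
    then have "open_segment x y \<subseteq> frontier \<Omega>"
      using True \<Omega>(1) by (auto simp: frontier_def interior_open)
    then have "closure (open_segment x y) \<subseteq> frontier \<Omega>"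
      by (rule closure_minimal) simp
    then show ?thesis
      using xy(3) by simp
  next
    case False
    then show ?thesis
      using inH transl by blast
  qed
qed

section \<open>The triangles around a vertex\<close>

definition adjacent :: "triangle set \<Rightarrow> real^2 \<Rightarrow> (triangle \<times> triangle) set" where
  "adjacent \<T> z = {(T, T'). T \<in> \<T> \<and> T' \<in> \<T> \<and>
     (\<exists>y. y \<noteq> z \<and> {y, z} \<subseteq> vertices T \<and> {y, z} \<subseteq> vertices T')}"

text \<open>
  If the triangles visited from \<open>T\<close> when walking around \<open>z\<close> across common sides have no side at \<open>z\<close> on
  the boundary, then their union is relatively open and closed in a small punctured disc around \<open>z\<close>,
  which is connected. Hence they fill the disc.
\<close>

lemma vertex_patch_connected:
  assumes dom: "polygonal_domain \<Omega>" and conf: "conforming_triangulation \<Omega> \<T>"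
    and T: "T \<in> \<T>" and z: "z \<in> vertices T"
    and no_boundary: "\<And>K y. (T, K) \<in> (adjacent \<T> z)\<^sup>* \<Longrightarrow> y \<in> vertices K \<Longrightarrow> y \<noteq> z \<Longrightarrow>
      \<not> closed_segment z y \<subseteq> frontier \<Omega>"
  shows "z \<notin> frontier \<Omega> \<and> (\<forall>K\<in>\<T>. z \<in> vertices K \<longrightarrow> (T, K) \<in> (adjacent \<T> z)\<^sup>*)"
proof -
  have \<Omega>: "open \<Omega>" "interior (closure \<Omega>) = \<Omega>"
    using dom by (auto simp: polygonal_domain_def)
  define C where "C = {K. (T, K) \<in> (adjacent \<T> z)\<^sup>*}"
  have C: "K \<in> \<T>" "z \<in> vertices K" if "K \<in> C" for K
    using that T z unfolding C_def by (auto simp: adjacent_def elim: rtranclE)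
  have p: "proper_triangle K" if "K \<in> \<T>" for K
    using that conformingD(2)[OF conf] by blast
  have finC: "finite C"
    using C conformingD(1)[OF conf] by (meson finite_subset subsetI)
  define \<F> where "\<F> = {closed_segment a b | a b K. K \<in> \<T> \<and> a \<in> vertices K - {z} \<and> b \<in> vertices K - {z}}"
  have "finite (\<Union>K\<in>\<T>. (\<lambda>(a, b). closed_segment a b) ` (vertices K \<times> vertices K))"
    using conformingD(1)[OF conf] finite_vertices[OF p] by auto
  moreover have "\<F> \<subseteq> (\<Union>K\<in>\<T>. (\<lambda>(a, b). closed_segment a b) ` (vertices K \<times> vertices K))"
    by (auto simp: \<F>_def)
  ultimately have fin\<F>: "finite \<F>"
    by (rule finite_subset[rotated])
  have "z \<notin> closed_segment a b" if ab: "K \<in> \<T>" "a \<in> vertices K - {z}" "b \<in> vertices K - {z}" for a b K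
  proof -
    have "z \<notin> open_segment a b"
      using vertex_not_in_open_segment[OF conf T ab(1) z] ab vertices_subset_region by blast
    then show ?thesis
      using ab by (auto simp: open_segment_def)
  qed
  then obtain e where e: "e > 0" "ball z e \<inter> \<Union>\<F> = {}"
    using fin\<F> by (rule_tac ball_avoiding[of \<F> z]) (auto simp: \<F>_def)
  let ?B = "ball z e - {z}"
  (* The radius e keeps the sides opposite to z away, so a boundary point of a visited triangle lies on a side at z. *)
  have open_cover: "y \<in> interior (cover C)" if y: "y \<in> ?B" "y \<in> cover C" for y
  proof -
    obtain K where K: "K \<in> C" "y \<in> region K"
      using y(2) by blast
    show ?thesis
    proof (cases "y \<in> interior (region K)")
      case True
      then show ?thesis
        using K(1) interior_mono[of "region K" "cover C"] by blast
    next
      case False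
      then obtain a b where ab: "a \<in> vertices K" "b \<in> vertices K" "a \<noteq> b" "y \<in> closed_segment a b"
        using region_cases[OF p[OF C(1)[OF K(1)]] K(2)] by blast
      have avoid: "y \<notin> closed_segment a' b'" if "a' \<in> vertices K - {z}" "b' \<in> vertices K - {z}" for a' b'
        using e(2) y(1) that C(1)[OF K(1)] unfolding \<F>_def by blast
      have "a = z \<or> b = z"
        using avoid[of a b] ab by blast
      then obtain b' where b': "b' \<in> vertices K" "b' \<noteq> z" "y \<in> closed_segment z b'"
        using ab closed_segment_commute by blast
      have "y \<noteq> b'"
        using avoid[of b' b'] b' by auto
      then have yo: "y \<in> open_segment z b'"
        using b' y(1) by (auto simp: open_segment_def)
      have "y \<in> \<Omega>"
        using side_boundary_cases[OF dom conf C(1)[OF K(1)] C(2)[OF K(1)] b'(1)] b'(2) yo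
          no_boundary[of K b'] K(1) b'(1) by (auto simp: C_def)
      then obtain d where d: "d > 0" "ball y d \<subseteq> \<Omega>"
        using \<Omega>(1) openE by blast
      obtain d' where d': "d' > 0" "ball y d' \<inter> closure \<Omega> \<subseteq> cover {L \<in> \<T>. y \<in> region L}"
        using local_cover[OF conf] by blast
      have "L \<in> C" if L: "L \<in> \<T>" "y \<in> region L" for L
      proof -
        have "z \<in> vertices L \<and> b' \<in> vertices L"
          using open_side_vertices[OF conf C(1)[OF K(1)] L(1) C(2)[OF K(1)] b'(1) yo L(2)] .
        then have "(K, L) \<in> adjacent \<T> z"
          using C[OF K(1)] L(1) b' by (auto simp: adjacent_def)
        then show ?thesis
          using K(1) unfolding C_def by (auto intro: rtrancl_into_rtrancl)
      qed
      then have "cover {L \<in> \<T>. y \<in> region L} \<subseteq> cover C"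
        by blast
      then have "ball y d' \<inter> closure \<Omega> \<subseteq> cover C"
        by (rule subset_trans[OF d'(2)])
      moreover have "ball y (min d d') \<subseteq> ball y d' \<inter> closure \<Omega>"
        using subset_trans[OF d(2) closure_subset] by auto
      ultimately have "ball y (min d d') \<subseteq> cover C"
        by (rule subset_trans[rotated])
      then show ?thesis
        using d(1) d'(1) by (intro interiorI[of "ball y (min d d')"]) auto
    qed
  qed
  have meetB: "\<exists>y\<in>?B. y \<in> interior (region K)" if K: "K \<in> \<T>" "z \<in> vertices K" for K
  proof -
    have "z \<in> closure (interior (region K))"
      using closure_interior_region[OF p[OF K(1)]] K(2) vertices_subset_region by blast
    then obtain y where y: "y \<in> interior (region K)" "dist y z < e"
      using e(1) by (auto simp: closure_approachable)
    have "z \<notin> interior (region K)"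
      using K extreme_point_region[OF p[OF K(1)]] extreme_point_not_in_interior by blast
    then have "y \<noteq> z"
      using y(1) by blast
    then show ?thesis
      using y by (intro bexI[of _ y]) (auto simp: dist_commute)
  qed
  have "closed (cover C)"
    using finC C(1) p by (intro closed_UN) (auto simp: compact_imp_closed compact_region)
  moreover have "connected ?B"
    using e(1) by (intro connected_punctured_convex) (simp_all add: aff_dim_open)
  moreover have "?B \<inter> interior (cover C) \<noteq> {}"
  proof -
    have "T \<in> C"
      by (simp add: C_def)
    then show ?thesis
      using meetB[OF T z] interior_mono[of "region T" "cover C"] by blast
  qed
  moreover have "?B \<subseteq> interior (cover C) \<union> - cover C"
    using open_cover by blast
  moreover have "interior (cover C) \<inter> - cover C \<inter> ?B = {}"
    using interior_subset by blast
  ultimately have "- cover C \<inter> ?B = {}"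
    using connectedD[of ?B "interior (cover C)" "- cover C"] by blast
  then have B: "?B \<subseteq> cover C"
    by blast
  have "z \<in> cover C"
    using z vertices_subset_region by (force simp: C_def)
  then have "ball z e \<subseteq> cover C"
    using B by blast
  also have "\<dots> \<subseteq> closure \<Omega>"
    using C(1) conformingD(4)[OF conf] by blast
  finally have "z \<in> interior (closure \<Omega>)"
    using e(1) by (intro interiorI[of "ball z e"]) auto
  then have "z \<notin> frontier \<Omega>"
    using \<Omega> by (simp add: frontier_def interior_open)
  moreover have "K \<in> C" if K: "K \<in> \<T>" "z \<in> vertices K" for K
  proof -
    obtain y where y: "y \<in> ?B" "y \<in> interior (region K)"
      using meetB[OF K] by blast
    then obtain L where "L \<in> C" "y \<in> region L"
      using B by blast
    then show ?thesis
      using conforming_interiors_meet[OF conf K(1) C(1) y(2)] by metis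
  qed
  ultimately show ?thesis
    by (simp add: C_def)
qed

section \<open>The meet of refinements\<close>

text \<open>
  The overlay that is the coarsest at every point; it turns out to be the meet.
\<close>

definition overlay_meet :: "triangle set set \<Rightarrow> triangle set" where
  "overlay_meet A = {T \<in> \<Union>A. \<forall>K\<in>\<Union>A. desc K T \<longrightarrow> K = T}"

lemma refinementsD:
  assumes "conforming_triangulation \<Omega> \<T>\<^sub>0" "\<T> \<in> refinements \<Omega> \<T>\<^sub>0"
  shows "conforming_triangulation \<Omega> \<T>" "tree_refines \<T>\<^sub>0 \<T>" "coarser_eq \<T>\<^sub>0 \<T>" "tiling \<T>"
  using assms coarser_eq_iff_tree_refines[OF conforming_tiling[OF assms(1)]]
  by (auto simp: refinements_def conforming_tiling)

context
  fixes \<Omega> \<T>\<^sub>0 A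
  assumes conf0: "conforming_triangulation \<Omega> \<T>\<^sub>0"
    and A: "finite A" "A \<noteq> {}" "A \<subseteq> refinements \<Omega> \<T>\<^sub>0"
begin

lemma overlay_root:
  assumes "K \<in> \<Union>A"
  obtains T where "T \<in> \<T>\<^sub>0" "desc T K"
  using assms A(3) refinementsD(2)[OF conf0] unfolding tree_refines_def by blast

lemma overlay_proper: "K \<in> \<Union>A \<Longrightarrow> proper_triangle K"
  using A(3) refinementsD(4)[OF conf0] tilingD(2) by blast

lemma overlay_nested:
  assumes "K \<in> \<Union>A" "L \<in> \<Union>A" "interior (region K) \<inter> interior (region L) \<noteq> {}"
  shows "desc K L \<or> desc L K"
proof -
  obtain T T' where "T \<in> \<T>\<^sub>0" "desc T K" "T' \<in> \<T>\<^sub>0" "desc T' L"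
    using assms overlay_root by metis
  then show ?thesis
    using tiling_desc_nested[OF conforming_tiling[OF conf0]] assms(3) by blast
qed

lemma overlay_meet_above:
  assumes "K \<in> \<Union>A"
  obtains T where "T \<in> overlay_meet A" "desc T K"
proof -
  let ?S = "{T \<in> \<Union>A. desc T K}"
  have "finite (\<Union>A)"
    using A(1,3) refinementsD(4)[OF conf0] tilingD(1) by blast
  then have "finite ?S"
    by (rule finite_subset[rotated]) blast
  moreover have "?S \<noteq> {}"
    using assms desc_refl by blast
  ultimately have "Max (area ` ?S) \<in> area ` ?S" "\<And>T'. T' \<in> ?S \<Longrightarrow> area T' \<le> Max (area ` ?S)"
    by (simp_all only: Max_in Max_ge finite_imageI image_is_empty imageI not_False_eq_True)
  then obtain T where T: "T \<in> ?S" "\<And>T'. T' \<in> ?S \<Longrightarrow> area T' \<le> area T"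
    by (metis (no_types, lifting) imageE)
  have "L = T" if L: "L \<in> \<Union>A" "desc L T" for L
  proof (rule ccontr)
    assume "L \<noteq> T"
    then have "area T \<le> area L / 2"
      using desc_area_half[OF L(2) overlay_proper[OF L(1)]] by blast
    moreover have "area L \<le> area T"
      using T L desc_trans by blast
    ultimately show False
      using area_pos[OF overlay_proper[OF L(1)]] by linarith
  qed
  then show thesis
    using that T(1) by (auto simp: overlay_meet_def)
qed

lemma tree_refines_overlay_meet:
  "tree_refines \<T>\<^sub>0 (overlay_meet A)" "\<T> \<in> A \<Longrightarrow> tree_refines (overlay_meet A) \<T>"
proof -
  have fin: "finite (\<Union>A)"
    using A(1,3) refinementsD(4)[OF conf0] tilingD(1) by blast
  have sub: "overlay_meet A \<subseteq> \<Union>A"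
    by (auto simp: overlay_meet_def)
  have til: "tiling (overlay_meet A)"
    unfolding tiling_def
  proof (intro conjI ballI impI)
    show "finite (overlay_meet A)"
      using fin sub finite_subset by blast
    show "proper_triangle T" if "T \<in> overlay_meet A" for T
      using that sub overlay_proper by blast
    show "interior (region T) \<inter> interior (region T') = {}"
      if "T \<in> overlay_meet A" "T' \<in> overlay_meet A" "T \<noteq> T'" for T T'
      using that overlay_nested[of T T'] unfolding overlay_meet_def by blast
  qed
  have cov: "cover \<T> = closure \<Omega>" if "\<T> \<in> A" for \<T>
    using that A(3) refinementsD(1)[OF conf0] conformingD(4) by blast
  have "cover (overlay_meet A) = closure \<Omega>"
  proof
    show "cover (overlay_meet A) \<subseteq> closure \<Omega>"
      using sub cov by blast
    show "closure \<Omega> \<subseteq> cover (overlay_meet A)"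
    proof
      fix x assume "x \<in> closure \<Omega>"
      then obtain K where K: "K \<in> \<Union>A" "x \<in> region K"
        using cov A(2) by blast
      then obtain T where T: "T \<in> overlay_meet A" "desc T K"
        using overlay_meet_above by blast
      then have "x \<in> region T"
        using desc_subset[OF T(2)] tilingD(2)[OF til T(1)] K(2) by blast
      then show "x \<in> cover (overlay_meet A)"
        using T(1) by blast
    qed
  qed
  then show "tree_refines \<T>\<^sub>0 (overlay_meet A)" "\<T> \<in> A \<Longrightarrow> tree_refines (overlay_meet A) \<T>"
    using til cov[of \<T>] sub overlay_root overlay_meet_above A(3) refinementsD(4)[OF conf0, of \<T>]
      conforming_tiling[OF conf0] conformingD(4)[OF conf0] unfolding tree_refines_def
    by (metis subsetD, metis UnionI subsetD)
qed

text \<open>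
  The overlay inherits conformity from its members: the part of a triangle \<open>T\<close> that lies in another
  triangle \<open>T'\<close> is the union of the faces of \<open>T\<close> in which \<open>T\<close> meets the smaller triangles inside \<open>T'\<close>
  from its own triangulation, and a convex union of faces is a face.
\<close>

lemma overlay_meet_refinement: "overlay_meet A \<in> refinements \<Omega> \<T>\<^sub>0"
proof -
  let ?M = "overlay_meet A"
  have til: "tiling ?M" "cover ?M = closure \<Omega>"
    using tree_refines_overlay_meet(1) conformingD(4)[OF conf0] by (auto simp: tree_refines_def)
  have face: "(region T \<inter> region T') face_of region T" if T: "T \<in> ?M" "T' \<in> ?M" for T T'
  proof -
    obtain \<T> where \<T>: "\<T> \<in> A" "T \<in> \<T>"
      using T(1) by (auto simp: overlay_meet_def)
    have conf: "conforming_triangulation \<Omega> \<T>"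
      using \<T>(1) A(3) refinementsD(1)[OF conf0] by blast
    have cov: "region T' = cover (below \<T> T')"
      using cover_below[OF tree_refines_overlay_meet(2)[OF \<T>(1)] T(2)] by simp
    show ?thesis
      unfolding face_of_def
    proof (intro conjI ballI impI)
      show "convex (region T \<inter> region T')"
        by (simp add: convex_Int convex_region)
      fix a b x
      assume ab: "a \<in> region T" "b \<in> region T" and x: "x \<in> region T \<inter> region T'" "x \<in> open_segment a b"
      then obtain K where K: "K \<in> below \<T> T'" "x \<in> region K"
        using cov by blast
      then have "a \<in> region T \<inter> region K \<and> b \<in> region T \<inter> region K"
        using face_ofD[OF conformingD(5)[OF conf \<T>(2)] x(2) ab] x(1) by (auto simp: below_def)
      then show "a \<in> region T \<inter> region T'" "b \<in> region T \<inter> region T'"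
        using K(1) cov by auto
    qed simp
  qed
  have "triangulation (region ` ?M)"
    unfolding triangulation_def
  proof (intro conjI ballI allI impI)
    show "finite (region ` ?M)"
      using til(1) tilingD(1) by blast
    fix R assume "R \<in> region ` ?M"
    then obtain T where T: "T \<in> ?M" "R = region T"
      by blast
    have "card (vertices T) = 3"
      using tilingD(2)[OF til(1) T(1)] by (auto simp: vertices_def elim!: proper_triangleE)
    moreover have "\<not> affine_dependent (vertices T)"
      using tilingD(2)[OF til(1) T(1)] by (simp add: proper_triangle_def)
    ultimately show "\<exists>n. n simplex R"
      unfolding T(2) region_def by (intro exI[of _ 2] simplex_convex_hull) simp
  next
    fix R R' assume "R \<in> region ` ?M \<and> R' \<in> region ` ?M"
    then show "(R \<inter> R') face_of R"
      using face by blast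
  qed
  moreover have "inj_on region ?M"
  proof (rule inj_onI)
    fix T T' assume "T \<in> ?M" "T' \<in> ?M" "region T = region T'"
    then show "T = T'"
      using tilingD(3)[OF til(1)] interior_region_nonempty tilingD(2)[OF til(1)] by (metis Int_absorb)
  qed
  ultimately have "conforming_triangulation \<Omega> ?M"
    using til tilingD(1,2) by (auto simp: conforming_triangulation_def)
  then show ?thesis
    using tree_refines_imp_coarser_eq[OF tree_refines_overlay_meet(1)] by (simp add: refinements_def)
qed

text \<open>
  The meet lies between the overlay and each member; a triangle of the meet that descends from a triangle
  \<open>T\<close> of the overlay therefore also contains \<open>T\<close>.
\<close>

lemma meet_subset:
  assumes "is_meet (refinements \<Omega> \<T>\<^sub>0) A \<M>"
  shows "\<M> \<subseteq> \<Union>A"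
proof
  fix K assume K: "K \<in> \<M>"
  have \<M>: "\<M> \<in> refinements \<Omega> \<T>\<^sub>0" "tiling \<M>"
    using assms refinementsD(4)[OF conf0] by (auto simp: is_meet_def)
  have "coarser_eq (overlay_meet A) \<M>"
    using assms overlay_meet_refinement tree_refines_overlay_meet(2) tree_refines_imp_coarser_eq
    by (simp add: is_meet_def)
  then have "tree_refines (overlay_meet A) \<M>"
    using coarser_eq_iff_tree_refines[of "overlay_meet A"] tree_refines_overlay_meet(1)
    by (simp add: tree_refines_def)
  then obtain T where T: "T \<in> overlay_meet A" "desc T K"
    using K by (auto simp: tree_refines_def)
  then obtain \<T> where \<T>: "\<T> \<in> A" "T \<in> \<T>"
    by (auto simp: overlay_meet_def)
  have "tree_refines \<M> \<T>"
    using assms \<T>(1) coarser_eq_iff_tree_refines[OF \<M>(2)] by (simp add: is_meet_def)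
  then obtain L where L: "L \<in> \<M>" "desc L T"
    using \<T>(2) by (auto simp: tree_refines_def)
  have "L = K"
    using tiling_desc_eq[OF \<M>(2) L(1) K desc_trans[OF L(2) T(2)] desc_refl] interior_region_nonempty
      tilingD(2)[OF \<M>(2) K] by simp
  then have "K = T"
    using desc_antisym[OF L(2)] T(2) tilingD(2)[OF \<M>(2) L(1)] by blast
  then show "K \<in> \<Union>A"
    using \<T> by blast
qed

end

text \<open>
  Every triangle of the meet belongs to a member. Disjointness of the refined regions makes the member
  unique if the triangle is refined in the join. Conversely, let \<open>T\<close> be a refined triangle of a member.
  The triangle of the meet above \<open>T\<close> is refined as well, hence belongs to the same member and is \<open>T\<close>.
\<close>

lemma lower_diamond_partition:
  assumes conf0: "conforming_triangulation \<Omega> \<T>\<^sub>0" and m: "m \<ge> 1"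
    and dia: "lower_diamond (refinements \<Omega> \<T>\<^sub>0) m \<M> \<J> \<T>s"
  shows "\<M> - \<J> = (\<Union>j\<in>{1..m}. \<T>s j - \<J>)" "disjoint_family_on (\<lambda>j. \<T>s j - \<J>) {1..m}"
proof -
  let ?A = "\<T>s ` {1..m}"
  have A: "finite ?A" "?A \<noteq> {}" "?A \<subseteq> refinements \<Omega> \<T>\<^sub>0"
    using dia m by (auto simp: lower_diamond_def)
  have meet: "is_meet (refinements \<Omega> \<T>\<^sub>0) ?A \<M>" and join: "is_join (refinements \<Omega> \<T>\<^sub>0) ?A \<J>"
    and disj: "disjoint_family_on (\<lambda>j. subdomain (\<T>s j - \<J>)) {1..m}"
    using dia by (auto simp: lower_diamond_def)
  have til: "tiling \<M>" "tiling (\<T>s j)" if "j \<in> {1..m}" for j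
    using meet A(3) that by (auto simp: is_meet_def intro!: refinementsD(4)[OF conf0])
  have ref: "tree_refines \<M> (\<T>s j)" "tree_refines (\<T>s j) \<J>" if "j \<in> {1..m}" for j
    using meet join that til[OF that] by (auto simp: is_meet_def is_join_def simp flip: coarser_eq_iff_tree_refines)
  have eq: "i = j" if ij: "i \<in> {1..m}" "j \<in> {1..m}" "T \<in> \<T>s i - \<J>" "K \<in> \<T>s j - \<J>"
    "interior (region T) \<inter> interior (region K) \<noteq> {}" for i j T K
  proof -
    have "interior (region T) \<subseteq> subdomain (\<T>s i - \<J>)" "interior (region K) \<subseteq> subdomain (\<T>s j - \<J>)"
      using ij unfolding subdomain_def by (auto intro!: interior_mono)
    then show ?thesis
      using ij disj unfolding disjoint_family_on_def by blast
  qed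
  show "disjoint_family_on (\<lambda>j. \<T>s j - \<J>) {1..m}"
    unfolding disjoint_family_on_def
  proof (intro ballI impI)
    fix i j assume ij: "i \<in> {1..m}" "j \<in> {1..m}" "i \<noteq> j"
    have "T \<notin> \<T>s j - \<J>" if "T \<in> \<T>s i - \<J>" for T
      using eq[OF ij(1,2) that] ij(3) interior_region_nonempty tilingD(2)[OF til(2)[OF ij(1)]] that
      by (metis DiffD1 Int_absorb)
    then show "(\<T>s i - \<J>) \<inter> (\<T>s j - \<J>) = {}"
      by blast
  qed
  show "\<M> - \<J> = (\<Union>j\<in>{1..m}. \<T>s j - \<J>)"
  proof
    show "\<M> - \<J> \<subseteq> (\<Union>j\<in>{1..m}. \<T>s j - \<J>)"
      using meet_subset[OF conf0 A meet] by blast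
    show "(\<Union>j\<in>{1..m}. \<T>s j - \<J>) \<subseteq> \<M> - \<J>"
    proof
      fix T assume "T \<in> (\<Union>j\<in>{1..m}. \<T>s j - \<J>)"
      then obtain j where j: "j \<in> {1..m}" "T \<in> \<T>s j" "T \<notin> \<J>"
        by blast
      then obtain K where K: "K \<in> \<M>" "desc K T"
        using ref(1)[OF j(1)] by (auto simp: tree_refines_def)
      have pK: "proper_triangle K"
        using til(1)[OF j(1)] K(1) tilingD(2) by blast
      obtain i where i: "i \<in> {1..m}" "K \<in> \<T>s i"
        using meet_subset[OF conf0 A meet] K(1) by blast
      have sub: "interior (region T) \<subseteq> interior (region K)"
        using desc_subset[OF K(2) pK] by (rule interior_mono)
      have neT: "interior (region T) \<noteq> {}"
        using tilingD(2)[OF til(2)[OF j(1)] j(2)] interior_region_nonempty by blast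
      have "K \<notin> \<J>"
      proof
        assume "K \<in> \<J>"
        then obtain L where L: "L \<in> \<T>s j" "desc L K"
          using ref(2)[OF j(1)] by (auto simp: tree_refines_def)
        have "L = T"
          using tiling_desc_eq[OF til(2)[OF j(1)] L(1) j(2) L(2) desc_refl] sub neT by blast
        then have "K = T"
          using desc_antisym[OF K(2) _ pK] L(2) by blast
        then show False
          using \<open>K \<in> \<J>\<close> j(3) by blast
      qed
      then have "i = j"
        using eq[OF i(1) j(1), of K T] i(2) j sub neT by blast
      then have "K = T"
        using tilingD(3)[OF til(2)[OF j(1)]] i(2) j(2) sub neT by blast
      then show "T \<in> \<M> - \<J>"
        using K(1) j(3) by blast
    qed
  qed
qed

section \<open>Crouzeix-Raviart functions\<close>

abbreviation grad_on :: "triangle \<Rightarrow> (real^2 \<Rightarrow> real) \<Rightarrow> real^2" where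
  "grad_on T v \<equiv> snd (affine_rep T v)"

lemma mean_affine_segment:
  "integral {0..1} (\<lambda>t. c + g \<bullet> linepath x y t) = c + g \<bullet> midpoint x y"
proof -
  have "((\<lambda>t. (c + g \<bullet> x) + (g \<bullet> (y - x)) * t) has_integral (c + g \<bullet> x) * (1 - 0) + (g \<bullet> (y - x)) * ((1\<^sup>2 - 0\<^sup>2) / 2)) {0..1}"
    by (intro has_integral_add has_integral_mult_right ident_has_integral)
      (use has_integral_const_real[of "c + g \<bullet> x" 0 1] in auto)
  then have "((\<lambda>t. c + g \<bullet> linepath x y t) has_integral c + g \<bullet> midpoint x y) {0..1}"
    by (simp add: linepath_def midpoint_def inner_simps algebra_simps)
  then show ?thesis
    by (rule integral_unique)
qed

lemma side_integral_affine:
  "side_integral (closed_segment x y) (\<lambda>z. c + g \<bullet> z) = dist x y * (c + g \<bullet> midpoint x y)"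
  by (simp add: side_integral_closed_segment mean_affine_segment)

lemma side_integral_trace:
  "side_integral (closed_segment x y) (side_trace T v) = dist x y * side_trace T v (midpoint x y)"
  using side_integral_affine[of x y "fst (affine_rep T v)" "grad_on T v"]
  by (simp add: side_trace_def[abs_def])

lemma side_integral_jump:
  "side_integral (closed_segment x y) (\<lambda>z. side_trace T v z - side_trace T' v z) =
     dist x y * (side_trace T v (midpoint x y) - side_trace T' v (midpoint x y))"
  using side_integral_affine[of x y "fst (affine_rep T v) - fst (affine_rep T' v)" "grad_on T v - grad_on T' v"]
  by (simp add: side_trace_def[abs_def] inner_diff_left algebra_simps)

lemma affine_rep_AE:
  assumes "proper_triangle T" "affine_on_triangle T v"
  shows "AE x in lebesgue_on (region T). v x = side_trace T v x"
proof -
  obtain c g where "AE x in lebesgue_on (region T). v x = c + g \<bullet> x"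
    using assms(2) by (auto simp: affine_on_triangle_def)
  then show ?thesis
    using affine_rep_eq[OF assms(1)] by (simp add: side_trace_def)
qed

lemma sidesE:
  assumes "S \<in> sides \<T>"
  obtains K x y where "K \<in> \<T>" "x \<in> vertices K" "y \<in> vertices K" "x \<noteq> y" "S = closed_segment x y"
  using assms unfolding sides_def sides_of_def by blast

lemma proper_triangle_distinct:
  "proper_triangle (Triangle p {a, b}) \<Longrightarrow> a \<noteq> b \<and> p \<noteq> a \<and> p \<noteq> b"
  by (auto simp: proper_triangle_def)

text \<open>
  For piecewise affine functions the vanishing of the jump integrals means that the traces from the
  two adjacent triangles agree at the midpoint of a common side.
\<close>

lemma CR_iff:
  assumes conf: "conforming_triangulation \<Omega> \<T>"
  shows "v \<in> CR \<Omega> \<T> \<longleftrightarrow> L2 \<Omega> v \<and> (\<forall>T\<in>\<T>. affine_on_triangle T v) \<and>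
    (\<forall>T\<in>\<T>. \<forall>T'\<in>\<T>. \<forall>x y. x \<noteq> y \<and> {x, y} \<subseteq> vertices T \<inter> vertices T' \<longrightarrow>
       side_trace T v (midpoint x y) = side_trace T' v (midpoint x y)) \<and>
    (\<forall>T\<in>\<T>. \<forall>x y. x \<noteq> y \<and> {x, y} \<subseteq> vertices T \<and> closed_segment x y \<subseteq> frontier \<Omega> \<longrightarrow>
       side_trace T v (midpoint x y) = 0)" (is "_ \<longleftrightarrow> _ \<and> _ \<and> ?jump \<and> ?boundary")
proof (intro iffI conjI)
  assume v: "v \<in> CR \<Omega> \<T>"
  show "L2 \<Omega> v" "\<forall>T\<in>\<T>. affine_on_triangle T v"
    using v by (auto simp: CR_def)
  have side: "closed_segment x y \<in> sides_of T" "closed_segment x y \<in> sides \<T>"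
    if "T \<in> \<T>" "x \<noteq> y" "{x, y} \<subseteq> vertices T" for T x y
    using that by (auto simp: sides_of_def sides_def)
  show ?jump
  proof (intro ballI allI impI, elim conjE)
    fix T T' x y assume h: "T \<in> \<T>" "T' \<in> \<T>" "x \<noteq> y" "{x, y} \<subseteq> vertices T \<inter> vertices T'"
    show "side_trace T v (midpoint x y) = side_trace T' v (midpoint x y)"
    proof (cases "T = T'")
      case False
      then have "closed_segment x y = region T \<inter> region T'"
        using shared_side[OF conf h(1,2) False h(3)] h(4) by simp
      then have "side_integral (closed_segment x y) (\<lambda>z. side_trace T v z - side_trace T' v z) = 0"
        using v h side(2)[of T x y] unfolding CR_def by blast
      then show ?thesis
        using h(3) by (simp add: side_integral_jump)
    qed simp
  qed
  show ?boundary
  proof (intro ballI allI impI, elim conjE)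
    fix T x y assume h: "T \<in> \<T>" "x \<noteq> y" "{x, y} \<subseteq> vertices T" "closed_segment x y \<subseteq> frontier \<Omega>"
    then have "side_integral (closed_segment x y) (side_trace T v) = 0"
      using v side[of T x y] unfolding CR_def by blast
    then show "side_trace T v (midpoint x y) = 0"
      using h(2) by (simp add: side_integral_trace)
  qed
next
  assume r: "L2 \<Omega> v \<and> (\<forall>T\<in>\<T>. affine_on_triangle T v) \<and> ?jump \<and> ?boundary"
  have "side_integral S (\<lambda>x. side_trace T v x - side_trace T' v x) = 0"
    if S: "S \<in> sides \<T>" and T: "T \<in> \<T>" "T' \<in> \<T>" "S = region T \<inter> region T'" for S T T'
  proof -
    obtain K x y where K: "K \<in> \<T>" "x \<in> vertices K" "y \<in> vertices K" "x \<noteq> y" "S = closed_segment x y"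
      using S by (rule sidesE)
    have "x \<in> region T \<inter> region T'" "y \<in> region T \<inter> region T'"
      using K(5) T(3) by auto
    then have "{x, y} \<subseteq> vertices T \<inter> vertices T'"
      using vertex_in_region[OF conf K(1)] T K by blast
    then have "side_trace T v (midpoint x y) = side_trace T' v (midpoint x y)"
      using r T(1,2) K(4) by blast
    then show ?thesis
      unfolding K(5) by (simp add: side_integral_jump)
  qed
  moreover have "side_integral S (side_trace T v) = 0"
    if T: "T \<in> \<T>" "S \<in> sides_of T" "S \<subseteq> frontier \<Omega>" for S T
  proof -
    obtain x y where xy: "x \<in> vertices T" "y \<in> vertices T" "x \<noteq> y" "S = closed_segment x y"
      using T(2) by (auto simp: sides_of_def)
    then have "side_trace T v (midpoint x y) = 0"
      using r T(1,3) by blast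
    then show ?thesis
      unfolding xy(4) by (simp add: side_integral_trace)
  qed
  ultimately show "v \<in> CR \<Omega> \<T>"
    using r unfolding CR_def by blast
qed

lemma CR_I:
  assumes "conforming_triangulation \<Omega> \<T>" "L2 \<Omega> v" "\<And>T. T \<in> \<T> \<Longrightarrow> affine_on_triangle T v"
    and "\<And>T T' x y. T \<in> \<T> \<Longrightarrow> T' \<in> \<T> \<Longrightarrow> x \<noteq> y \<Longrightarrow> {x, y} \<subseteq> vertices T \<inter> vertices T' \<Longrightarrow>
      side_trace T v (midpoint x y) = side_trace T' v (midpoint x y)"
    and "\<And>T x y. T \<in> \<T> \<Longrightarrow> x \<noteq> y \<Longrightarrow> {x, y} \<subseteq> vertices T \<Longrightarrow> closed_segment x y \<subseteq> frontier \<Omega> \<Longrightarrow>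
      side_trace T v (midpoint x y) = 0"
  shows "v \<in> CR \<Omega> \<T>"
  unfolding CR_iff[OF assms(1)]
proof (intro conjI ballI allI impI; (elim conjE)?)
qed (rule assms(2-5); assumption)+

lemma L2_add:
  fixes u v :: "real^2 \<Rightarrow> real"
  assumes "L2 \<Omega> u" "L2 \<Omega> v"
  shows "L2 \<Omega> (\<lambda>x. u x + v x)"
proof -
  have m [measurable]: "u \<in> borel_measurable (lebesgue_on \<Omega>)" "v \<in> borel_measurable (lebesgue_on \<Omega>)"
    and i: "integrable (lebesgue_on \<Omega>) (\<lambda>x. (u x)\<^sup>2)" "integrable (lebesgue_on \<Omega>) (\<lambda>x. (v x)\<^sup>2)"
    using assms by (auto simp: L2_def)
  have "integrable (lebesgue_on \<Omega>) (\<lambda>x. (u x + v x)\<^sup>2)"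
  proof (rule Bochner_Integration.integrable_bound)
    show "integrable (lebesgue_on \<Omega>) (\<lambda>x. 2 * (u x)\<^sup>2 + 2 * (v x)\<^sup>2)"
      using i by simp
    have "(u x + v x)\<^sup>2 \<le> 2 * (u x)\<^sup>2 + 2 * (v x)\<^sup>2" for x
      using sum_squares_bound[of "u x" "v x"] by (simp add: power2_sum)
    then show "AE x in lebesgue_on \<Omega>. norm ((u x + v x)\<^sup>2) \<le> norm (2 * (u x)\<^sup>2 + 2 * (v x)\<^sup>2)"
      by simp
  qed measurable
  then show ?thesis
    using m by (simp add: L2_def)
qed

lemma L2_uminus: "L2 \<Omega> u \<Longrightarrow> L2 \<Omega> (\<lambda>x. - u x)" for u :: "real^2 \<Rightarrow> real"
  by (simp add: L2_def)

lemma CR_diff: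
  assumes conf: "conforming_triangulation \<Omega> \<T>" and uv: "u \<in> CR \<Omega> \<T>" "v \<in> CR \<Omega> \<T>"
  shows "(\<lambda>x. u x - v x) \<in> CR \<Omega> \<T>"
    "T \<in> \<T> \<Longrightarrow> grad_on T (\<lambda>x. u x - v x) = grad_on T u - grad_on T v"
proof -
  have AE: "AE x in lebesgue_on (region T). u x - v x
      = (fst (affine_rep T u) - fst (affine_rep T v)) + (grad_on T u - grad_on T v) \<bullet> x" if "T \<in> \<T>" for T
  proof -
    have "AE x in lebesgue_on (region T). u x = side_trace T u x" "AE x in lebesgue_on (region T). v x = side_trace T v x"
      using that uv by (auto simp: CR_def intro!: affine_rep_AE conformingD(2)[OF conf])
    then show ?thesis
      by eventually_elim (simp add: side_trace_def inner_diff_left)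
  qed
  have rep: "affine_rep T (\<lambda>x. u x - v x)
      = (fst (affine_rep T u) - fst (affine_rep T v), grad_on T u - grad_on T v)" if "T \<in> \<T>" for T
    using affine_rep_eq[OF conformingD(2)[OF conf that] AE[OF that]] .
  then have tr: "side_trace T (\<lambda>x. u x - v x) z = side_trace T u z - side_trace T v z" if "T \<in> \<T>" for T z
    using that by (simp add: side_trace_def inner_diff_left)
  show "T \<in> \<T> \<Longrightarrow> grad_on T (\<lambda>x. u x - v x) = grad_on T u - grad_on T v"
    by (simp add: rep)
  have "L2 \<Omega> (\<lambda>x. u x - v x)"
    using L2_add[of \<Omega> u "\<lambda>x. - v x"] L2_uminus[of \<Omega> v] uv CR_iff[OF conf] by simp
  moreover have "affine_on_triangle T (\<lambda>x. u x - v x)" if "T \<in> \<T>" for T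
    using AE[OF that] unfolding affine_on_triangle_def by blast
  moreover have "side_trace T w (midpoint x y) = side_trace T' w (midpoint x y)"
    if "w \<in> {u, v}" "T \<in> \<T>" "T' \<in> \<T>" "x \<noteq> y" "{x, y} \<subseteq> vertices T \<inter> vertices T'" for w T T' x y
    using uv that unfolding CR_iff[OF conf] by blast
  then have "side_trace T (\<lambda>x. u x - v x) (midpoint x y) = side_trace T' (\<lambda>x. u x - v x) (midpoint x y)"
    if "T \<in> \<T>" "T' \<in> \<T>" "x \<noteq> y" "{x, y} \<subseteq> vertices T \<inter> vertices T'" for T T' x y
    using that by (simp only: tr insert_iff simp_thms)
  moreover have "side_trace T w (midpoint x y) = 0"
    if "w \<in> {u, v}" "T \<in> \<T>" "x \<noteq> y" "{x, y} \<subseteq> vertices T" "closed_segment x y \<subseteq> frontier \<Omega>" for w T x y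
    using uv that unfolding CR_iff[OF conf] by blast
  then have "side_trace T (\<lambda>x. u x - v x) (midpoint x y) = 0"
    if "T \<in> \<T>" "x \<noteq> y" "{x, y} \<subseteq> vertices T" "closed_segment x y \<subseteq> frontier \<Omega>" for T x y
    using that by (simp only: tr insert_iff simp_thms diff_self)
  ultimately show "(\<lambda>x. u x - v x) \<in> CR \<Omega> \<T>"
    by (intro CR_I[OF conf])
qed

lemma affine_from_midpoints:
  assumes T: "proper_triangle T" and sym: "\<And>x y. s x y = s y x"
  shows "\<exists>c g. \<forall>x\<in>vertices T. \<forall>y\<in>vertices T. x \<noteq> y \<longrightarrow> c + g \<bullet> midpoint x y = s x y"
proof -
  obtain p a b where T: "T = Triangle p {a, b}" "a \<noteq> b" "p \<noteq> a" "p \<noteq> b" "det2 (a - p) (b - p) \<noteq> 0"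
    using T by (rule proper_triangleE)
  have D: "det2 (b - a) (p - a) \<noteq> 0" "det2 (p - b) (a - b) \<noteq> 0"
    using T(5) by (simp_all add: det2_def algebra_simps)
  obtain c1 g1 c2 g2 c3 g3 where cg: "\<forall>x. bary p a b x = c1 + g1 \<bullet> x" "\<forall>x. bary a b p x = c2 + g2 \<bullet> x"
    "\<forall>x. bary b p a x = c3 + g3 \<bullet> x"
    using bary_affine by metis
  (* The vertex values of the affine function with the given values at the midpoints. *)
  define fp fa fb where "fp = s p a + s p b - s a b" and "fa = s p a + s a b - s p b" and "fb = s p b + s a b - s p a"
  define c g where "c = fp * c1 + fa * c2 + fb * c3" and "g = fp *\<^sub>R g1 + fa *\<^sub>R g2 + fb *\<^sub>R g3"
  have cgx: "c + g \<bullet> x = fp * bary p a b x + fa * bary a b p x + fb * bary b p a x" for x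
    by (simp add: cg c_def g_def inner_simps algebra_simps)
  have "c + g \<bullet> p = fp" "c + g \<bullet> a = fa" "c + g \<bullet> b = fb"
    using bary_simps[OF T(5)] bary_simps[OF D(1)] bary_simps[OF D(2)] by (simp_all add: cgx)
  then have "c + g \<bullet> midpoint p a = s p a" "c + g \<bullet> midpoint a b = s a b" "c + g \<bullet> midpoint p b = s p b"
    unfolding fp_def fa_def fb_def midpoint_def inner_simps by (simp_all add: field_simps)
  then have "c + g \<bullet> midpoint x y = s x y" if "x \<in> vertices T" "y \<in> vertices T" "x \<noteq> y" for x y
    using that sym[of a p] sym[of b a] sym[of b p] midpoint_sym[of a p] midpoint_sym[of b a] midpoint_sym[of b p]
    by (auto simp: T(1) vertices_def)
  then show ?thesis
    by blast
qed

text \<open>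
  The midpoints of the sides of a triangle are affinely independent, so the values can be prescribed
  triangle by triangle. The function is set to zero on the sides, which form a null set.
\<close>

lemma CR_exists:
  assumes dom: "polygonal_domain \<Omega>" and conf: "conforming_triangulation \<Omega> \<T>"
    and sym: "\<And>x y. s x y = s y x"
    and zero: "\<And>T x y. T \<in> \<T> \<Longrightarrow> {x, y} \<subseteq> vertices T \<Longrightarrow> x \<noteq> y \<Longrightarrow> closed_segment x y \<subseteq> frontier \<Omega> \<Longrightarrow> s x y = 0"
  obtains v where "v \<in> CR \<Omega> \<T>"
    "\<And>T x y. T \<in> \<T> \<Longrightarrow> x \<in> vertices T \<Longrightarrow> y \<in> vertices T \<Longrightarrow> x \<noteq> y \<Longrightarrow> side_trace T v (midpoint x y) = s x y"
proof -
  have p: "proper_triangle T" if "T \<in> \<T>" for T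
    using conformingD(2)[OF conf that] .
  have "\<forall>T\<in>\<T>. \<exists>c g. \<forall>x\<in>vertices T. \<forall>y\<in>vertices T. x \<noteq> y \<longrightarrow> c + g \<bullet> midpoint x y = s x y"
    using affine_from_midpoints[OF p, where s = s] sym by blast
  from bchoice[OF this] obtain c where
    "\<forall>T\<in>\<T>. \<exists>g. \<forall>x\<in>vertices T. \<forall>y\<in>vertices T. x \<noteq> y \<longrightarrow> c T + g \<bullet> midpoint x y = s x y"
    by blast
  from bchoice[OF this] obtain g where cg: "\<forall>T\<in>\<T>. \<forall>x\<in>vertices T. \<forall>y\<in>vertices T. x \<noteq> y \<longrightarrow>
      c T + g T \<bullet> midpoint x y = s x y"
    by blast
  define h where "h T x = indicator (interior (region T)) x * (c T + g T \<bullet> x)" for T and x :: "real^2"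
  define v where "v x = (\<Sum>T\<in>\<T>. h T x)" for x
  have v: "v x = c T + g T \<bullet> x" if "T \<in> \<T>" "x \<in> interior (region T)" for T x
  proof -
    have "h K x = 0" if "K \<in> \<T> - {T}" for K
      using conforming_interiors_meet[OF conf _ _ \<open>x \<in> interior (region T)\<close>, of K] that \<open>T \<in> \<T>\<close> interior_subset
      by (auto simp: h_def indicator_def)
    then have "v x = h T x"
      unfolding v_def using that conformingD(1)[OF conf] by (subst sum.remove[of _ T]) auto
    then show ?thesis
      using that by (simp add: h_def)
  qed
  have AE: "AE x in lebesgue_on (region T). v x = c T + g T \<bullet> x" if "T \<in> \<T>" for T
  proof -
    have "AE x in lebesgue. x \<notin> frontier (region T)"
      using negligible_frontier_region by (intro AE_not_in) (simp add: negligible_iff_null_sets)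
    then have "AE x in lebesgue. x \<in> region T \<longrightarrow> v x = c T + g T \<bullet> x"
    proof (rule AE_mp, intro AE_I2 impI)
      fix x assume "x \<notin> frontier (region T)" "x \<in> region T"
      then have "x \<in> interior (region T)"
        using closure_subset by (auto simp: frontier_def)
      then show "v x = c T + g T \<bullet> x"
        using v that by blast
    qed
    then show ?thesis
      using lmeasurable_region[OF p[OF that]] by (simp add: AE_restrict_space_iff)
  qed
  have rep: "side_trace T v z = c T + g T \<bullet> z" if "T \<in> \<T>" for T z
    using affine_rep_eq[OF p[OF that] AE[OF that]] by (simp add: side_trace_def)
  have \<Omega>: "open \<Omega>" "bounded \<Omega>"
    using dom by (auto simp: polygonal_domain_def)
  have "L2 \<Omega> (h T)" if T: "T \<in> \<T>" for T
  proof -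
    have meas: "h T \<in> borel_measurable (lebesgue_on \<Omega>)"
      unfolding h_def by (intro measurable_restrict_space1 borel_measurable_if_lebesgue_on
        measurable_completion) (auto intro!: borel_measurable_times borel_measurable_indicator
        borel_measurable_continuous_onI continuous_intros)
    have "bounded ((\<lambda>x. c T + g T \<bullet> x) ` region T)"
      by (intro compact_imp_bounded compact_continuous_image compact_region p T continuous_intros)
    then obtain B where B: "\<And>x. x \<in> region T \<Longrightarrow> \<bar>c T + g T \<bullet> x\<bar> \<le> B"
      by (auto simp: bounded_iff)
    have hB: "(h T x)\<^sup>2 \<le> B\<^sup>2" for x
    proof (cases "x \<in> interior (region T)")
      case True
      then show ?thesis
        using B[of x] interior_subset[of "region T"] power_mono[of "\<bar>c T + g T \<bullet> x\<bar>" B 2] by (auto simp: h_def)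
    qed (simp add: h_def)
    have "\<Omega> \<in> lmeasurable"
      using \<Omega> by (simp add: lmeasurable_open)
    then have "finite_measure (lebesgue_on \<Omega>)"
      by (rule finite_measure_lebesgue_on)
    then have "integrable (lebesgue_on \<Omega>) (\<lambda>x. (h T x)\<^sup>2)"
      using hB meas by (intro finite_measure.integrable_const_bound[of _ _ "B\<^sup>2"]) auto
    then show ?thesis
      using meas by (simp add: L2_def)
  qed
  note L2_h = this
  have "L2 \<Omega> (\<lambda>x. \<Sum>T\<in>F. h T x)" if "finite F" "F \<subseteq> \<T>" for F
    using that
  proof (induction F rule: finite_induct)
    case empty
    then show ?case
      by (simp add: L2_def)
  qed (simp add: L2_add L2_h)
  then have "L2 \<Omega> v"
    using conformingD(1)[OF conf] by (simp add: v_def[abs_def])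
  moreover have "affine_on_triangle T v" if "T \<in> \<T>" for T
    using AE[OF that] unfolding affine_on_triangle_def by blast
  moreover have tr: "side_trace T v (midpoint x y) = s x y"
    if "T \<in> \<T>" "x \<in> vertices T" "y \<in> vertices T" "x \<noteq> y" for T x y
    using that by (simp add: rep cg)
  ultimately have "v \<in> CR \<Omega> \<T>"
    using zero by (intro CR_I[OF conf]) auto
  then show thesis
    using that tr by blast
qed

section \<open>Side means\<close>

definition side_mean :: "triangle set \<Rightarrow> (real^2 \<Rightarrow> real) \<Rightarrow> real^2 \<Rightarrow> real^2 \<Rightarrow> real" where
  "side_mean \<T> v x y = CR_side_integral \<T> v (closed_segment x y) / dist x y"

lemma side_mean_commute: "side_mean \<T> v x y = side_mean \<T> v y x"
  by (simp add: side_mean_def closed_segment_commute dist_commute)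

lemma finite_sides: "conforming_triangulation \<Omega> \<T> \<Longrightarrow> finite (sides \<T>)"
proof -
  assume conf: "conforming_triangulation \<Omega> \<T>"
  have "sides \<T> \<subseteq> (\<Union>T\<in>\<T>. (\<lambda>(a, b). closed_segment a b) ` (vertices T \<times> vertices T))"
    by (auto simp: sides_def sides_of_def)
  moreover have "finite (\<Union>T\<in>\<T>. (\<lambda>(a, b). closed_segment a b) ` (vertices T \<times> vertices T))"
    using conformingD(1,2)[OF conf] finite_vertices by auto
  ultimately show ?thesis
    by (rule finite_subset)
qed

lemma vertices_of_side:
  assumes "closed_segment x y \<in> sides_of K"
  shows "x \<in> vertices K \<and> y \<in> vertices K"
  using assms by (auto simp: sides_of_def closed_segment_eq doubleton_eq_iff)

lemma side_mean_side:
  assumes conf: "conforming_triangulation \<Omega> \<T>" and v: "v \<in> CR \<Omega> \<T>"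
    and T: "T \<in> \<T>" "x \<in> vertices T" "y \<in> vertices T" "x \<noteq> y"
  shows "side_mean \<T> v x y = side_trace T v (midpoint x y)"
proof -
  let ?S = "closed_segment x y"
  have S: "?S \<in> sides_of T"
    using T by (auto simp: sides_of_def)
  have "S' = ?S" if S': "S' \<in> sides \<T>" "S' \<subseteq> ?S" for S'
  proof -
    obtain K a b where K: "K \<in> \<T>" "a \<in> vertices K" "b \<in> vertices K" "a \<noteq> b" "S' = closed_segment a b"
      using S'(1) by (rule sidesE)
    have "a \<in> ?S" "b \<in> ?S"
      using K(5) S'(2) by auto
    moreover have "a \<notin> open_segment x y" "b \<notin> open_segment x y"
      using vertex_not_in_open_segment[OF conf K(1) T(1)] K T vertices_subset_region by blast+
    ultimately show ?thesis
      using K(4,5) by (auto simp: open_segment_def closed_segment_commute)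
  qed
  then have "{S' \<in> sides \<T>. S' \<subseteq> ?S} = {?S}"
    using S T(1) by (auto simp: sides_def)
  moreover define K where "K = (SOME K. K \<in> \<T> \<and> ?S \<in> sides_of K)"
  moreover have K: "K \<in> \<T> \<and> ?S \<in> sides_of K"
    unfolding K_def by (rule someI[of _ T]) (use S T in blast)
  moreover have "side_trace K v (midpoint x y) = side_trace T v (midpoint x y)"
    using v T K vertices_of_side[of x y K] unfolding CR_iff[OF conf] by blast
  ultimately have "CR_side_integral \<T> v ?S = dist x y * side_trace T v (midpoint x y)"
    by (simp add: CR_side_integral_def side_integral_trace)
  then show ?thesis
    using T(4) by (simp add: side_mean_def)
qed

lemma segment_midpoint_cases:
  fixes a b x y :: "'a::euclidean_space"
  assumes "closed_segment x y \<subseteq> closed_segment a b" "midpoint a b \<notin> open_segment x y"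
  shows "closed_segment x y \<subseteq> closed_segment a (midpoint a b) \<or> closed_segment x y \<subseteq> closed_segment (midpoint a b) b"
proof -
  let ?m = "midpoint a b"
  have un: "closed_segment a b = closed_segment a ?m \<union> closed_segment ?m b"
    by (rule Un_closed_segment[symmetric]) simp
  have mid: "?m \<in> closed_segment x y" if "x \<in> closed_segment a ?m" "y \<in> closed_segment ?m b" for x y
  proof -
    have "between (b, x) ?m"
      using that(1) between_trans_2[of a b ?m x] by (simp add: between_midpoint between_mem_segment closed_segment_commute)
    then show ?thesis
      using that(2) between_trans_2[of b x ?m y] by (simp add: between_mem_segment closed_segment_commute)
  qed
  have "x \<in> closed_segment a b" "y \<in> closed_segment a b"
    using assms(1) by auto
  then consider "x \<in> closed_segment a ?m" "y \<in> closed_segment a ?m" | "x \<in> closed_segment ?m b" "y \<in> closed_segment ?m b"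
    | "x \<in> closed_segment a ?m" "y \<in> closed_segment ?m b" | "y \<in> closed_segment a ?m" "x \<in> closed_segment ?m b"
    using un by blast
  then show ?thesis
  proof cases
    case 1
    then show ?thesis
      by (simp add: subset_closed_segment)
  next
    case 2
    then show ?thesis
      by (simp add: subset_closed_segment)
  next
    case 3
    then have "?m = x \<or> ?m = y"
      using mid assms(2) by (auto simp: open_segment_def)
    then show ?thesis
      using 3 by (auto simp: subset_closed_segment)
  next
    case 4
    then have "?m = x \<or> ?m = y"
      using mid[of y x] assms(2) by (auto simp: open_segment_def closed_segment_commute)
    then show ?thesis
      using 4 by (auto simp: subset_closed_segment)
  qed
qed

text \<open>
  No side reaches across a node, so every side inside the segment lies in one of its halves.
\<close>

lemma side_mean_split:
  assumes conf: "conforming_triangulation \<Omega> \<T>" and m: "midpoint a b \<in> (\<Union>T\<in>\<T>. vertices T)" and ab: "a \<noteq> b"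
  shows "side_mean \<T> v a b = (side_mean \<T> v a (midpoint a b) + side_mean \<T> v (midpoint a b) b) / 2"
proof -
  let ?m = "midpoint a b"
  let ?L = "\<lambda>S. {S' \<in> sides \<T>. S' \<subseteq> S}"
  have un: "closed_segment a b = closed_segment a ?m \<union> closed_segment ?m b"
    by (rule Un_closed_segment[symmetric]) simp
  have int: "closed_segment a ?m \<inter> closed_segment ?m b = {?m}"
    by (rule Int_closed_segment) simp
  have "\<not> (closed_segment x y \<subseteq> closed_segment a ?m \<and> closed_segment x y \<subseteq> closed_segment ?m b)" if "x \<noteq> y" for x y
  proof
    assume "closed_segment x y \<subseteq> closed_segment a ?m \<and> closed_segment x y \<subseteq> closed_segment ?m b"
    then have "{x, y} \<subseteq> closed_segment a ?m \<inter> closed_segment ?m b"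
      by auto
    then show False
      using int that by simp
  qed
  note not_both = this
  have disj: "?L (closed_segment a ?m) \<inter> ?L (closed_segment ?m b) = {}"
  proof (rule ccontr)
    assume "?L (closed_segment a ?m) \<inter> ?L (closed_segment ?m b) \<noteq> {}"
    then obtain S where S: "S \<in> sides \<T>" "S \<subseteq> closed_segment a ?m" "S \<subseteq> closed_segment ?m b"
      by blast
    then obtain x y where "x \<noteq> y" "S = closed_segment x y"
      by (blast elim: sidesE)
    then show False
      using not_both S(2,3) by blast
  qed
  have "S \<subseteq> closed_segment a ?m \<or> S \<subseteq> closed_segment ?m b" if S: "S \<in> ?L (closed_segment a b)" for S
  proof -
    obtain K x y where K: "K \<in> \<T>" "x \<in> vertices K" "y \<in> vertices K" "S = closed_segment x y"
      using S by (blast elim: sidesE)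
    have "?m \<notin> open_segment x y"
      using m vertex_not_in_open_segment[OF conf _ K(1)] K(2,3) vertices_subset_region by blast
    then show ?thesis
      using segment_midpoint_cases S K(4) by blast
  qed
  then have "?L (closed_segment a b) = ?L (closed_segment a ?m) \<union> ?L (closed_segment ?m b)"
    using un by blast
  then have "CR_side_integral \<T> v (closed_segment a b)
      = CR_side_integral \<T> v (closed_segment a ?m) + CR_side_integral \<T> v (closed_segment ?m b)"
    unfolding CR_side_integral_def using disj finite_sides[OF conf] by (simp add: sum.union_disjoint)
  moreover have "dist a ?m = dist a b / 2" "dist ?m b = dist a b / 2"
    by (simp_all add: dist_midpoint)
  ultimately show ?thesis
    using ab by (simp only: side_mean_def) (simp add: field_simps)
qed

lemma side_mean_boundary:
  assumes v: "v \<in> CR \<Omega> \<T>" and S: "closed_segment x y \<subseteq> frontier \<Omega>"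
  shows "side_mean \<T> v x y = 0"
proof -
  have "side_integral S' (side_trace (SOME T. T \<in> \<T> \<and> S' \<in> sides_of T) v) = 0"
    if S': "S' \<in> sides \<T>" "S' \<subseteq> closed_segment x y" for S'
  proof -
    have "(SOME T. T \<in> \<T> \<and> S' \<in> sides_of T) \<in> \<T> \<and> S' \<in> sides_of (SOME T. T \<in> \<T> \<and> S' \<in> sides_of T)"
      by (rule someI_ex) (use S'(1) in \<open>auto simp: sides_def\<close>)
    moreover have "S' \<subseteq> frontier \<Omega>"
      using S' S by blast
    ultimately show ?thesis
      using v S'(1) by (simp add: CR_def)
  qed
  then show ?thesis
    by (simp add: side_mean_def CR_side_integral_def)
qed

lemma midpoint_bisect:
  assumes "proper_triangle (Triangle p {a, b})"
  shows "midpoint a b \<in> (\<Union>c\<in>children (Triangle p {a, b}). vertices c)"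
proof -
  have "a \<noteq> b"
    using proper_triangle_distinct[OF assms] by blast
  then show ?thesis
    by (simp add: children_Triangle vertices_def)
qed

text \<open>
  Undoing a bisection creates at most one new side, the refinement edge, whose two halves are sides of the
  bisected tiling. The lemma transfers side means from a fine triangulation to a coarse one.
\<close>

lemma side_values_agree:
  assumes ref: "coarser_eq P Q" and P: "tiling P"
    and sym: "\<And>x y. \<mu> x y = \<mu> y x" "\<And>x y. \<nu> x y = \<nu> y x"
    and split: "\<And>a b. a \<noteq> b \<Longrightarrow> midpoint a b \<in> (\<Union>K\<in>Q. vertices K) \<Longrightarrow> closed_segment a b \<subseteq> cover Q \<Longrightarrow>
        \<mu> a b = (\<mu> a (midpoint a b) + \<mu> (midpoint a b) b) / 2"
      "\<And>a b. a \<noteq> b \<Longrightarrow> midpoint a b \<in> (\<Union>K\<in>Q. vertices K) \<Longrightarrow> closed_segment a b \<subseteq> cover Q \<Longrightarrow>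
        \<nu> a b = (\<nu> a (midpoint a b) + \<nu> (midpoint a b) b) / 2"
    and agree: "\<And>K x y. K \<in> Q \<Longrightarrow> x \<in> vertices K \<Longrightarrow> y \<in> vertices K \<Longrightarrow> x \<noteq> y \<Longrightarrow> \<mu> x y = (\<nu> x y :: real)"
    and T: "T \<in> P" "x \<in> vertices T" "y \<in> vertices T" "x \<noteq> y"
  shows "\<mu> x y = \<nu> x y"
proof -
  have "\<forall>T\<in>P. \<forall>x\<in>vertices T. \<forall>y\<in>vertices T. x \<noteq> y \<longrightarrow> \<mu> x y = \<nu> x y"
    using ref P
  proof (induction rule: coarser_eq_induct)
    case base
    then show ?case
      using agree by blast
  next
    case (bisect P N)
    let ?P = "P - {N} \<union> children N"
    have pN: "proper_triangle N"
      using bisect.hyps(1,2) tilingD(2) by blast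
    obtain p a b where N: "N = Triangle p {a, b}" "a \<noteq> b" "p \<noteq> a" "p \<noteq> b"
      using pN by (rule proper_triangleE)
    let ?m = "midpoint a b"
    have ch: "children N \<subseteq> ?P" "children N = {Triangle ?m {p, a}, Triangle ?m {p, b}}"
      using N by (auto simp: children_Triangle)
    have IH: "\<mu> x y = \<nu> x y" if "c \<in> children N" "x \<in> vertices c" "y \<in> vertices c" "x \<noteq> y" for c x y
      using bisect.IH that ch(1) by blast
    have "tiling ?P" "cover ?P = cover P"
      using tiling_bisect[OF bisect.hyps(1,2)] by auto
    then have Q: "cover Q = cover P" "(\<Union>T\<in>?P. vertices T) \<subseteq> (\<Union>K\<in>Q. vertices K)"
      using coarser_eqD[OF bisect.hyps(3)] by auto
    have "?m \<in> (\<Union>K\<in>Q. vertices K)"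
      using Q(2) ch midpoint_bisect[of p a b] pN unfolding N(1) by blast
    moreover have "closed_segment a b \<subseteq> cover Q"
      using side_subset_region[of a N b] bisect.hyps(2) by (auto simp: Q(1) N(1) vertices_def)
    moreover have "a \<noteq> ?m"
      using N(2) by (metis midpoint_eq_endpoint(1))
    then have "\<mu> a ?m = \<nu> a ?m"
      using N(2)
      by (intro IH[of "Triangle ?m {p, a}"]) (auto simp: N(1) children_Triangle vertices_def)
    moreover have "\<mu> ?m b = \<nu> ?m b"
      using N(2) by (intro IH[of "Triangle ?m {p, b}"]) (auto simp: N(1) children_Triangle vertices_def)
    ultimately have ab: "\<mu> a b = \<nu> a b"
      using split[of a b] N(2) by simp
    have pa: "\<mu> p a = \<nu> p a"
      using N by (intro IH[of "Triangle ?m {p, a}"]) (auto simp: children_Triangle vertices_def)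
    have pb: "\<mu> p b = \<nu> p b"
      using N by (intro IH[of "Triangle ?m {p, b}"]) (auto simp: children_Triangle vertices_def)
    have new: "\<mu> x y = \<nu> x y" if "x \<in> vertices N" "y \<in> vertices N" "x \<noteq> y" for x y
      using that ab pa pb sym by (auto simp: N(1) vertices_def)
    show ?case
    proof (intro ballI impI)
      fix T x y assume T: "T \<in> P" "x \<in> vertices T" "y \<in> vertices T" "x \<noteq> y"
      show "\<mu> x y = \<nu> x y"
      proof (cases "T = N")
        case True
        then show ?thesis
          using new T by blast
      next
        case False
        then have "T \<in> ?P"
          using T(1) by blast
        then show ?thesis
          using bisect.IH T by blast
      qed
    qed
  qed
  then show ?thesis
    using T by blast
qed

section \<open>Interpolation preserves mean gradients\<close>

text \<open>
  By the divergence theorem the integral of the gradient over a triangle is the sum of its side means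
  times the outward normals scaled by the side lengths. In \<open>flux s T\<close> the side means are
  prescribed by \<open>s\<close>; the normals are the sides rotated by a right angle, and the sign of the
  determinant makes them point outwards. The double sum makes the choice of an order on the end points
  of the refinement edge unnecessary.
\<close>

definition rot :: "real^2 \<Rightarrow> real^2" where
  "rot u = vector [u$2, - u$1]"

definition flux :: "(real^2 \<Rightarrow> real^2 \<Rightarrow> real) \<Rightarrow> triangle \<Rightarrow> real^2" where
  "flux s T = (\<Sum>a\<in>ref_ends T. \<Sum>b\<in>ref_ends T - {a}. let p = newest_vertex T in
     (sgn (det2 (a - p) (b - p)) / 2) *\<^sub>R
       (s p a *\<^sub>R rot (a - p) + s a b *\<^sub>R rot (b - a) + s b p *\<^sub>R rot (p - b)))"

lemma rot_simps: "rot (u - v) = - rot (v - u)" "rot (t *\<^sub>R u) = t *\<^sub>R rot u" "rot (u + v) = rot u + rot v"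
  by (auto simp: rot_def vec_eq_iff forall_2)

lemma flux_Triangle:
  assumes "a \<noteq> b" "\<And>x y. s x y = s y x"
  shows "flux s (Triangle p {a, b}) = sgn (det2 (a - p) (b - p)) *\<^sub>R
    (s p a *\<^sub>R rot (a - p) + s a b *\<^sub>R rot (b - a) + s b p *\<^sub>R rot (p - b))"
proof -
  define X where "X a b = s p a *\<^sub>R rot (a - p) + s a b *\<^sub>R rot (b - a) + s b p *\<^sub>R rot (p - b)" for a b
  have X: "X b a = - X a b"
    using rot_simps(1)[of b p] rot_simps(1)[of a b] rot_simps(1)[of p a]
    by (simp add: X_def assms(2)[of b a] assms(2)[of b p] assms(2)[of a p])
  have D: "det2 (b - p) (a - p) = - det2 (a - p) (b - p)"
    by (rule det2_swap)
  have "{a, b} - {a} = {b}" "{a, b} - {b} = {a}"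
    using assms(1) by auto
  then have "flux s (Triangle p {a, b}) =
      (sgn (det2 (a - p) (b - p)) / 2) *\<^sub>R X a b + (sgn (det2 (b - p) (a - p)) / 2) *\<^sub>R X b a"
    using assms(1) by (simp add: flux_def X_def)
  also have "\<dots> = sgn (det2 (a - p) (b - p)) *\<^sub>R X a b"
    by (simp add: X D sgn_minus flip: scaleR_add_left)
  finally show ?thesis
    by (simp add: X_def)
qed

text \<open>
  The contributions of the new side cancel, since it has opposite normals in the two children, and the two
  halves of the refinement edge have the same normal.
\<close>

lemma flux_children:
  assumes T: "proper_triangle (Triangle p {a, b})" and sym: "\<And>x y. s x y = s y x"
    and split: "s a b = (s a (midpoint a b) + s (midpoint a b) b) / 2"
  shows "(\<Sum>c\<in>children (Triangle p {a, b}). flux s c) = flux s (Triangle p {a, b})"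
proof -
  let ?m = "midpoint a b" and ?D = "det2 (a - p) (b - p)"
  have ne: "a \<noteq> b" "p \<noteq> a" "p \<noteq> b"
    using proper_triangle_distinct[OF T] by auto
  have sg: "sgn (det2 (p - ?m) (a - ?m)) = sgn ?D" "sgn (det2 (p - ?m) (b - ?m)) = - sgn ?D"
    by (simp_all add: det2_children sgn_minus sgn_divide)
  have r: "rot (?m - a) = (1/2) *\<^sub>R rot (b - a)" "rot (?m - b) = - (1/2) *\<^sub>R rot (b - a)"
    by (simp_all add: rot_def vec_eq_iff forall_2 midpoint_def field_simps)
  have "(\<Sum>c\<in>children (Triangle p {a, b}). flux s c) = flux s (Triangle ?m {p, a}) + flux s (Triangle ?m {p, b})"
    using ne by (simp add: children_Triangle doubleton_eq_iff)
  also have "\<dots> = sgn ?D *\<^sub>R (s p a *\<^sub>R rot (a - p) + ((s a ?m + s ?m b) / 2) *\<^sub>R rot (b - a) + s b p *\<^sub>R rot (p - b))"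
    using rot_simps(1)[of b p] sym[of p b] sym[of b ?m]
    by (simp add: flux_Triangle[OF _ sym] ne sg r add_divide_distrib scaleR_add_left flip: scaleR_minus_right scaleR_add_right)
  also have "\<dots> = flux s (Triangle p {a, b})"
    by (simp add: flux_Triangle[OF ne(1) sym] split)
  finally show ?thesis .
qed

lemma flux_affine_aux:
  fixes g p a b :: "real^2"
  shows "(g \<bullet> midpoint p a) *\<^sub>R rot (a - p) + (g \<bullet> midpoint a b) *\<^sub>R rot (b - a) + (g \<bullet> midpoint b p) *\<^sub>R rot (p - b)
    = (det2 (a - p) (b - p) / 2) *\<^sub>R g"
  by (simp add: rot_def vec_eq_iff forall_2 midpoint_def inner_vec_def sum_2 det2_def field_simps)

lemma flux_affine:
  assumes T: "proper_triangle T" and sym: "\<And>x y. s x y = s y x"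
    and s: "\<And>x y. x \<in> vertices T \<Longrightarrow> y \<in> vertices T \<Longrightarrow> x \<noteq> y \<Longrightarrow> s x y = c + g \<bullet> midpoint x y"
  shows "flux s T = area T *\<^sub>R g"
proof -
  obtain p a b where N: "T = Triangle p {a, b}" "a \<noteq> b" "p \<noteq> a" "p \<noteq> b"
    using T by (rule proper_triangleE)
  let ?D = "det2 (a - p) (b - p)"
  have v: "s p a = c + g \<bullet> midpoint p a" "s a b = c + g \<bullet> midpoint a b" "s b p = c + g \<bullet> midpoint b p"
    using s N by (auto simp: vertices_def)
  have "rot (a - p) + rot (b - a) + rot (p - b) = 0"
    by (simp add: rot_def vec_eq_iff forall_2)
  then have "c *\<^sub>R rot (a - p) + c *\<^sub>R rot (b - a) + c *\<^sub>R rot (p - b) = 0"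
    by (simp flip: scaleR_add_right)
  then have "s p a *\<^sub>R rot (a - p) + s a b *\<^sub>R rot (b - a) + s b p *\<^sub>R rot (p - b) = (?D / 2) *\<^sub>R g"
    using flux_affine_aux[of g p a b] unfolding v scaleR_add_left
    by (smt (verit, ccfv_threshold) add.assoc add.commute add.left_commute add_0)
  then show ?thesis
    by (simp add: N flux_Triangle[OF N(2) sym] area_eq_det2 abs_sgn)
qed

lemma flux_additive:
  assumes ref: "coarser_eq P Q" and P: "tiling P" and sym: "\<And>x y. s x y = s y x"
    and split: "\<And>a b. a \<noteq> b \<Longrightarrow> midpoint a b \<in> (\<Union>K\<in>Q. vertices K) \<Longrightarrow>
        s a b = (s a (midpoint a b) + s (midpoint a b) b) / 2"
  shows "(\<Sum>T\<in>P. flux s T) = (\<Sum>K\<in>Q. flux s K)"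
  using ref P
proof (induction rule: coarser_eq_induct)
  case (bisect P N)
  let ?P = "P - {N} \<union> children N"
  have pN: "proper_triangle N"
    using bisect.hyps(1,2) tilingD(2) by blast
  obtain p a b where N: "N = Triangle p {a, b}" "a \<noteq> b" "p \<noteq> a" "p \<noteq> b"
    using pN by (rule proper_triangleE)
  have til: "tiling ?P" "children N \<inter> P = {}"
    using tiling_bisect[OF bisect.hyps(1,2)] by auto
  then have "(\<Union>T\<in>?P. vertices T) \<subseteq> (\<Union>K\<in>Q. vertices K)"
    using coarser_eqD[OF bisect.hyps(3)] by auto
  then have "midpoint a b \<in> (\<Union>K\<in>Q. vertices K)"
    using midpoint_bisect[of p a b] pN unfolding N(1) by blast
  then have "(\<Sum>c\<in>children N. flux s c) = flux s N"
    using flux_children[of p a b s, OF _ sym] pN split[OF N(2)] unfolding N(1) by blast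
  moreover have "(\<Sum>T\<in>?P. flux s T) = (\<Sum>T\<in>P - {N}. flux s T) + (\<Sum>c\<in>children N. flux s c)"
    using tilingD(1)[OF til(1)] til(2) by (intro sum.union_disjoint) auto
  moreover have "(\<Sum>T\<in>P. flux s T) = flux s N + (\<Sum>T\<in>P - {N}. flux s T)"
    using bisect.hyps(2) tilingD(1)[OF bisect.hyps(1)] by (simp add: sum.remove)
  ultimately show ?case
    using bisect.IH by simp
qed simp

text \<open>
  The flux of the fine side means through the boundary of \<open>T\<close> is both the sum of the fluxes through the
  boundaries of the leaves and, as \<open>w\<close> has the same side means, the flux of \<open>w\<close>.
\<close>

lemma area_grad_sum:
  assumes conf: "conforming_triangulation \<Omega> \<T>" "conforming_triangulation \<Omega> \<T>'" and ref: "tree_refines \<T> \<T>'"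
    and v: "v \<in> CR \<Omega> \<T>'"
    and w: "\<And>x y. x \<in> vertices T \<Longrightarrow> y \<in> vertices T \<Longrightarrow> x \<noteq> y \<Longrightarrow> side_trace T w (midpoint x y) = side_mean \<T>' v x y"
    and T: "T \<in> \<T>"
  shows "area T *\<^sub>R grad_on T w = (\<Sum>K\<in>below \<T>' T. area K *\<^sub>R grad_on K v)"
proof -
  have pT: "proper_triangle T"
    using conformingD(2)[OF conf(1) T] .
  have sub: "below \<T>' T \<subseteq> \<T>'"
    by (auto simp: below_def)
  have "area T *\<^sub>R grad_on T w = flux (side_mean \<T>' v) T"
    using w by (intro flux_affine[symmetric, where c = "fst (affine_rep T w)"] pT side_mean_commute) (auto simp: side_trace_def)
  also have "\<dots> = (\<Sum>K\<in>below \<T>' T. flux (side_mean \<T>' v) K)"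
    using flux_additive[OF coarser_eq_below[OF ref T] tiling_singleton[OF pT] side_mean_commute]
      side_mean_split[OF conf(2)] sub by fastforce
  also have "\<dots> = (\<Sum>K\<in>below \<T>' T. area K *\<^sub>R grad_on K v)"
  proof (rule sum.cong[OF refl])
    fix K assume "K \<in> below \<T>' T"
    then have K: "K \<in> \<T>'"
      using sub by blast
    show "flux (side_mean \<T>' v) K = area K *\<^sub>R grad_on K v"
      using side_mean_side[OF conf(2) v K]
      by (intro flux_affine[where c = "fst (affine_rep K v)"] conformingD(2)[OF conf(2) K] side_mean_commute)
        (auto simp: side_trace_def)
  qed
  finally show ?thesis .
qed

definition interpolates :: "triangle set \<Rightarrow> triangle set \<Rightarrow> (real^2 \<Rightarrow> real) \<Rightarrow> (real^2 \<Rightarrow> real) \<Rightarrow> bool" where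
  "interpolates \<T> \<T>' v w \<longleftrightarrow> (\<forall>T\<in>\<T>. \<forall>x\<in>vertices T. \<forall>y\<in>vertices T. x \<noteq> y \<longrightarrow>
     side_trace T w (midpoint x y) = side_mean \<T>' v x y)"

lemma interpolant_exists:
  assumes dom: "polygonal_domain \<Omega>"
    and conf: "conforming_triangulation \<Omega> \<T>" "conforming_triangulation \<Omega> \<T>'"
    and v: "v \<in> CR \<Omega> \<T>'"
  shows "\<exists>w\<in>CR \<Omega> \<T>. interpolates \<T> \<T>' v w"
proof -
  obtain w where "w \<in> CR \<Omega> \<T>" "\<And>T x y. T \<in> \<T> \<Longrightarrow> x \<in> vertices T \<Longrightarrow> y \<in> vertices T \<Longrightarrow> x \<noteq> y \<Longrightarrow>
      side_trace T w (midpoint x y) = side_mean \<T>' v x y"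
    using CR_exists[OF dom conf(1), of "side_mean \<T>' v"] side_mean_commute side_mean_boundary[OF v] by metis
  then show ?thesis
    by (auto simp: interpolates_def)
qed

lemma interpolates_is_interpolant:
  assumes conf: "conforming_triangulation \<Omega> \<T>" and w: "w \<in> CR \<Omega> \<T>" and eq: "interpolates \<T> \<T>' v w"
  shows "is_interpolant \<Omega> \<T> (CR_side_integral \<T>' v) w"
  unfolding is_interpolant_def
proof (intro conjI ballI w)
  fix S assume "S \<in> sides \<T>"
  then obtain T x y where T: "T \<in> \<T>" "x \<in> vertices T" "y \<in> vertices T" "x \<noteq> y" "S = closed_segment x y"
    by (rule sidesE)
  have "side_mean \<T> w x y = side_mean \<T>' v x y"
    using side_mean_side[OF conf w T(1-4)] eq T(1-4) by (simp add: interpolates_def)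
  then show "CR_side_integral \<T> w S = CR_side_integral \<T>' v S"
    using T(4,5) by (simp add: side_mean_def)
qed

lemma CR_D:
  assumes "conforming_triangulation \<Omega> \<T>" "v \<in> CR \<Omega> \<T>" "T \<in> \<T>" "x \<in> vertices T" "y \<in> vertices T" "x \<noteq> y"
  shows "T' \<in> \<T> \<Longrightarrow> x \<in> vertices T' \<Longrightarrow> y \<in> vertices T' \<Longrightarrow> side_trace T v (midpoint x y) = side_trace T' v (midpoint x y)"
    "closed_segment x y \<subseteq> frontier \<Omega> \<Longrightarrow> side_trace T v (midpoint x y) = 0"
  using assms(2-6) unfolding CR_iff[OF assms(1)] by (simp_all only: insert_subset empty_subsetI Int_iff) metis+

section \<open>Shape regularity\<close>

definition shape :: "real \<Rightarrow> triangle set \<Rightarrow> bool" where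
  "shape \<sigma> P \<longleftrightarrow> (\<forall>T\<in>P. leg2 T \<le> \<sigma> * area T)"

text \<open>
  The quotient of \<open>leg2\<close> and \<open>area\<close> is inherited from the initial triangulation. Summing it over the
  initial triangles is a cheap way to bound its maximum.
\<close>

lemma shape_refinements:
  assumes "tiling P"
  obtains \<sigma> where "\<sigma> > 0" "\<And>Q. tree_refines P Q \<Longrightarrow> shape \<sigma> Q"
proof -
  define \<sigma> where "\<sigma> = (\<Sum>T\<in>P. leg2 T / area T) + 1"
  have nonneg: "0 \<le> leg2 T / area T" if "T \<in> P" for T
    using area_pos[OF tilingD(2)[OF assms that]] by (simp add: leg2_def sum_nonneg)
  have \<sigma>: "leg2 T / area T \<le> \<sigma>" if "T \<in> P" for T
    using member_le_sum[OF that, of "\<lambda>T. leg2 T / area T"] nonneg tilingD(1)[OF assms] by (force simp: \<sigma>_def)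
  have "shape \<sigma> Q" if Q: "tree_refines P Q" for Q
    unfolding shape_def
  proof
    fix K assume K: "K \<in> Q"
    then obtain T where T: "T \<in> P" "desc T K"
      using Q by (auto simp: tree_refines_def)
    have pT: "proper_triangle T"
      using tilingD(2)[OF assms T(1)] .
    have "leg2 K = (leg2 T / area T) * area K"
      using desc_region_area[OF T(2) pT] area_pos[OF pT] by (simp add: field_simps)
    also have "\<dots> \<le> \<sigma> * area K"
      using \<sigma>[OF T(1)] by (intro mult_right_mono) (simp_all add: area_def)
    finally show "leg2 K \<le> \<sigma> * area K" .
  qed
  moreover have "\<sigma> > 0"
    using sum_nonneg[of P "\<lambda>T. leg2 T / area T"] nonneg by (simp add: \<sigma>_def)
  ultimately show thesis
    using that by blast
qed

text \<open>Cramer's rule: a gradient is controlled by the increments along two sides.\<close>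

lemma gradient_bound:
  assumes T: "proper_triangle T" and sh: "leg2 T \<le> \<sigma> * area T"
    and M: "\<And>x y. x \<in> vertices T \<Longrightarrow> y \<in> vertices T \<Longrightarrow> \<bar>g \<bullet> (x - y)\<bar> \<le> M"
  shows "area T * (norm g)\<^sup>2 \<le> \<sigma> * M\<^sup>2 / 2"
proof -
  obtain p a b where N: "T = Triangle p {a, b}" "a \<noteq> b" "p \<noteq> a" "p \<noteq> b"
    using T by (rule proper_triangleE)
  define u v where "u = a - p" and "v = b - p"
  let ?D = "det2 u v"
  have gu: "\<bar>g \<bullet> u\<bar> \<le> M" "\<bar>g \<bullet> v\<bar> \<le> M"
    using M[of a p] M[of b p] by (auto simp: u_def v_def N vertices_def)
  have cramer: "?D\<^sup>2 * (norm g)\<^sup>2 = (norm ((g \<bullet> u) *\<^sub>R v - (g \<bullet> v) *\<^sub>R u))\<^sup>2"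
    unfolding power2_norm_eq_inner by (simp add: inner_vec_def sum_2 det2_def power2_eq_square algebra_simps)
  have "norm ((g \<bullet> u) *\<^sub>R v - (g \<bullet> v) *\<^sub>R u) \<le> M * (norm u + norm v)"
  proof -
    have "norm ((g \<bullet> u) *\<^sub>R v - (g \<bullet> v) *\<^sub>R u) \<le> \<bar>g \<bullet> u\<bar> * norm v + \<bar>g \<bullet> v\<bar> * norm u"
      using norm_triangle_ineq4[of "(g \<bullet> u) *\<^sub>R v" "(g \<bullet> v) *\<^sub>R u"] by simp
    also have "\<dots> \<le> M * norm v + M * norm u"
      using gu by (intro add_mono mult_right_mono) auto
    finally show ?thesis
      by (simp add: algebra_simps)
  qed
  then have "?D\<^sup>2 * (norm g)\<^sup>2 \<le> (M * (norm u + norm v))\<^sup>2"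
    unfolding cramer by (intro power_mono) auto
  also have "\<dots> \<le> M\<^sup>2 * (2 * leg2 T)"
    unfolding power_mult_distrib
    using sum_squares_bound[of "norm u" "norm v"]
    by (intro mult_left_mono) (auto simp: N leg2_Triangle u_def v_def dist_norm norm_minus_commute power2_sum)
  also have "\<dots> \<le> M\<^sup>2 * (2 * (\<sigma> * area T))"
    using sh by (intro mult_left_mono) auto
  finally have "(2 * area T) * ((2 * area T) * (norm g)\<^sup>2) \<le> (2 * area T) * (\<sigma> * M\<^sup>2)"
    by (simp add: N area_eq_det2 u_def v_def power2_eq_square algebra_simps)
  then show ?thesis
    using area_pos[OF T] by simp
qed

text \<open>
  A bound for the oscillation on \<open>T\<close> of an affine function with gradient \<open>g\<close>; its square is comparable
  to the squared norm of the gradient over \<open>T\<close>.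
\<close>

definition osc :: "real \<Rightarrow> triangle \<Rightarrow> real^2 \<Rightarrow> real" where
  "osc \<sigma> T g = sqrt (2 * \<sigma> * area T) * norm g"

lemma osc_power2:
  assumes "\<sigma> > 0"
  shows "(osc \<sigma> T g)\<^sup>2 = 2 * \<sigma> * (area T * (norm g)\<^sup>2)"
proof -
  have "2 * \<sigma> * area T \<ge> 0"
    using assms by (simp add: area_def)
  then show ?thesis
    by (simp add: osc_def power_mult_distrib)
qed

lemma osc_nonneg: "\<sigma> > 0 \<Longrightarrow> osc \<sigma> T g \<ge> 0"
  by (simp add: osc_def area_def)

lemma vertex_difference:
  assumes T: "proper_triangle T" and sh: "leg2 T \<le> \<sigma> * area T"
    and xy: "x \<in> vertices T" "y \<in> vertices T"
  shows "\<bar>g \<bullet> (x - y)\<bar> \<le> osc \<sigma> T g"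
proof -
  have "(dist x y)\<^sup>2 \<le> 2 * \<sigma> * area T"
    using dist_vertices_le[OF T xy] sh by simp
  then have "dist x y \<le> sqrt (2 * \<sigma> * area T)"
    by (rule real_le_rsqrt)
  then have "norm g * norm (x - y) \<le> norm g * sqrt (2 * \<sigma> * area T)"
    by (intro mult_left_mono) (auto simp: dist_norm)
  then show ?thesis
    using Cauchy_Schwarz_ineq2[of g "x - y"] by (simp add: osc_def mult.commute)
qed

lemma region_subset_cball:
  assumes T: "proper_triangle T" and sh: "leg2 T \<le> \<sigma> * area T" and z: "z \<in> vertices T"
  shows "region T \<subseteq> cball z (sqrt (2 * \<sigma> * area T))"
  unfolding region_def
proof (rule hull_minimal)
  show "vertices T \<subseteq> cball z (sqrt (2 * \<sigma> * area T))"
    using dist_vertices_le[OF T z] sh by (force intro: real_le_rsqrt)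
qed simp

text \<open>
  Shape regularity bounds the number of triangles at a vertex: shrunk towards the vertex to a common
  diameter, they fill disjoint parts of a disc that have areas comparable to that of the disc.
\<close>

lemma card_vertex_patch:
  assumes conf: "conforming_triangulation \<Omega> \<T>" and sh: "shape \<sigma> \<T>" and \<sigma>: "\<sigma> > 0"
  shows "real (card {T \<in> \<T>. z \<in> vertices T}) \<le> 2 * \<sigma> * measure lebesgue (cball (0::real^2) 1)"
proof -
  let ?P = "{T \<in> \<T>. z \<in> vertices T}"
  have fin: "finite ?P"
    using conformingD(1)[OF conf] by simp
  have pr: "proper_triangle T" if "T \<in> ?P" for T
    using that conformingD(2)[OF conf] by blast
  define r where "r T = sqrt (2 * \<sigma> * area T)" for T
  have r: "r T > 0" "(r T)\<^sup>2 = 2 * \<sigma> * area T" if "T \<in> ?P" for T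
    using area_pos[OF pr[OF that]] \<sigma> by (auto simp: r_def)
  (* A common diameter not larger than any r T; the 1 only covers the case that ?P is empty. *)
  define e where "e = Min (insert 1 (r ` ?P))"
  have e: "e > 0" "\<And>T. T \<in> ?P \<Longrightarrow> e \<le> r T"
    using fin r by (auto simp: e_def)
  define E where "E T = (\<lambda>x. (e / r T) *\<^sub>R x + (1 - e / r T) *\<^sub>R z) ` region T" for T
  have et: "0 < e / r T" "e / r T \<le> 1" if "T \<in> ?P" for T
    using e(1) e(2)[OF that] r(1)[OF that] by (auto simp: divide_simps)
  have sub: "E T \<subseteq> region T" if "T \<in> ?P" for T
  proof
    fix y assume "y \<in> E T"
    then obtain x where "x \<in> region T" "y = (e / r T) *\<^sub>R x + (1 - e / r T) *\<^sub>R z"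
      by (auto simp: E_def)
    moreover have "z \<in> region T"
      using that vertices_subset_region by blast
    ultimately show "y \<in> region T"
      using convexD[OF convex_region, of x T z "e / r T" "1 - e / r T"] et[OF that] by simp
  qed
  have ball: "E T \<subseteq> cball z e" if "T \<in> ?P" for T
  proof
    fix y assume "y \<in> E T"
    then obtain x where x: "x \<in> region T" "y = (e / r T) *\<^sub>R x + (1 - e / r T) *\<^sub>R z"
      by (auto simp: E_def)
    have "leg2 T \<le> \<sigma> * area T"
      using sh that by (auto simp: shape_def)
    then have "dist z x \<le> r T"
      using region_subset_cball[OF pr[OF that], of \<sigma> z] that x(1) by (auto simp: r_def)
    moreover have "z - y = (e / r T) *\<^sub>R (z - x)"
      unfolding x(2) by (simp add: algebra_simps)
    then have "dist z y = (e / r T) * dist z x"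
      using et(1)[OF that] by (simp only: dist_norm norm_scaleR abs_of_pos)
    moreover have "(e / r T) * dist z x \<le> (e / r T) * r T"
      using calculation(1) et(1)[OF that] by (intro mult_left_mono) auto
    ultimately have "dist z y \<le> (e / r T) * r T"
      by linarith
    then show "y \<in> cball z e"
      using r(1)[OF that] by simp
  qed
  have compactE: "compact (E T)" if "T \<in> ?P" for T
    unfolding E_def by (intro compact_continuous_image compact_region pr that continuous_intros)
  have meas: "measure lebesgue (E T) = e\<^sup>2 / (2 * \<sigma>)" if "T \<in> ?P" for T
  proof -
    have "measure lebesgue (E T) = (e / r T)\<^sup>2 * area T"
      using measure_lebesgue_affine[of "e / r T" "(1 - e / r T) *\<^sub>R z" "region T"] e(1) r(1)[OF that]
      by (simp add: E_def area_def)
    then show ?thesis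
      using r(2)[OF that] area_pos[OF pr[OF that]] \<sigma> by (simp add: power_divide)
  qed
  have "negligible (E T \<inter> E T')" if T: "T \<in> ?P" "T' \<in> ?P" "T \<noteq> T'" for T T'
  proof (rule negligible_subset)
    show "negligible (frontier (region T))"
      by (rule negligible_frontier_region)
    have "interior (region T) \<inter> region T' = {}"
      using conforming_interiors_meet[OF conf, of T T'] T by blast
    then show "E T \<inter> E T' \<subseteq> frontier (region T)"
      using sub[OF T(1)] sub[OF T(2)] closure_subset[of "region T"] by (auto simp: frontier_def)
  qed
  then have "measure lebesgue (\<Union>(E ` ?P)) = (\<Sum>T\<in>?P. measure lebesgue (E T))"
    using fin compactE by (intro measure_negligible_finite_Union_image) (auto simp: pairwise_def lmeasurable_compact)
  also have "\<dots> = card ?P * (e\<^sup>2 / (2 * \<sigma>))"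
    by (simp add: meas)
  finally have "card ?P * (e\<^sup>2 / (2 * \<sigma>)) = measure lebesgue (\<Union>(E ` ?P))"
    by simp
  also have "\<dots> \<le> measure lebesgue (cball z e)"
  proof (rule measure_mono_fmeasurable)
    show "\<Union>(E ` ?P) \<subseteq> cball z e"
      using ball by blast
    have "compact (\<Union>(E ` ?P))"
      using fin compactE by (intro compact_UN) auto
    then show "\<Union>(E ` ?P) \<in> sets lebesgue"
      by (intro fmeasurableD lmeasurable_compact)
  qed simp
  also have "cball z e = (\<lambda>x. e *\<^sub>R x + z) ` cball 0 1"
  proof -
    have "(\<lambda>x. e *\<^sub>R x) ` cball 0 1 = cball (0::real^2) e"
      using cball_scale[of e 0 1] e(1) by simp
    then have "cball z e = (+) z ` (\<lambda>x. e *\<^sub>R x) ` cball 0 1"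
      by simp
    also have "\<dots> = (\<lambda>x. e *\<^sub>R x + z) ` cball 0 1"
      unfolding image_image by (simp only: add.commute)
    finally show ?thesis .
  qed
  also have "measure lebesgue \<dots> = e\<^sup>2 * measure lebesgue (cball (0::real^2) 1)"
    using measure_lebesgue_affine[of e z "cball (0::real^2) 1"] by simp
  finally have "e\<^sup>2 * (card ?P / (2 * \<sigma>)) \<le> e\<^sup>2 * measure lebesgue (cball (0::real^2) 1)"
    by (simp add: algebra_simps)
  then have "card ?P / (2 * \<sigma>) \<le> measure lebesgue (cball (0::real^2) 1)"
    by (rule mult_left_le_imp_le) (use e(1) in simp)
  then show ?thesis
    using \<sigma> by (simp add: field_simps)
qed

section \<open>Values at the vertices\<close>

text \<open>
  The nodal values of the continuous companion. At interior vertices any triangle may supply the value,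
  because all of them are linked by common sides; on the boundary the companion has to vanish.
\<close>

definition node_value :: "(real^2) set \<Rightarrow> triangle set \<Rightarrow> (real^2 \<Rightarrow> real) \<Rightarrow> real^2 \<Rightarrow> real" where
  "node_value \<Omega> \<T> w z = (if z \<in> frontier \<Omega> then 0 else side_trace (SOME T. T \<in> \<T> \<and> z \<in> vertices T) w z)"

lemma vertex_jump:
  assumes conf: "conforming_triangulation \<Omega> \<T>" and sh: "shape \<sigma> \<T>" and w: "w \<in> CR \<Omega> \<T>"
    and T: "(T, T') \<in> adjacent \<T> z"
  shows "\<bar>side_trace T w z - side_trace T' w z\<bar> \<le> osc \<sigma> T (grad_on T w) + osc \<sigma> T' (grad_on T' w)"
proof -
  obtain y where y: "T \<in> \<T>" "T' \<in> \<T>" "y \<noteq> z" "{y, z} \<subseteq> vertices T" "{y, z} \<subseteq> vertices T'"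
    using T by (auto simp: adjacent_def)
  have half: "\<bar>side_trace K w z - side_trace K w (midpoint y z)\<bar> \<le> osc \<sigma> K (grad_on K w)"
    if "K \<in> \<T>" "{y, z} \<subseteq> vertices K" for K
  proof -
    have "side_trace K w z - side_trace K w (midpoint y z) = (grad_on K w \<bullet> (z - y)) / 2"
      by (simp add: side_trace_def midpoint_def inner_simps field_simps)
    moreover have "\<bar>grad_on K w \<bullet> (z - y)\<bar> \<le> osc \<sigma> K (grad_on K w)"
      using that sh by (intro vertex_difference conformingD(2)[OF conf]) (auto simp: shape_def)
    ultimately show ?thesis
      by simp
  qed
  have "side_trace T w (midpoint y z) = side_trace T' w (midpoint y z)"
    using y by (intro CR_D(1)[OF conf w]) auto
  then show ?thesis
    using half[OF y(1,4)] half[OF y(2,5)] by linarith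
qed

lemma vertex_boundary_value:
  assumes conf: "conforming_triangulation \<Omega> \<T>" and sh: "shape \<sigma> \<T>" and w: "w \<in> CR \<Omega> \<T>"
    and T: "T \<in> \<T>" "y \<in> vertices T" "z \<in> vertices T" "y \<noteq> z" "closed_segment z y \<subseteq> frontier \<Omega>"
  shows "\<bar>side_trace T w z\<bar> \<le> osc \<sigma> T (grad_on T w)"
proof -
  have "side_trace T w z - side_trace T w (midpoint z y) = (grad_on T w \<bullet> (z - y)) / 2"
    by (simp add: side_trace_def midpoint_def inner_simps field_simps)
  moreover have "\<bar>grad_on T w \<bullet> (z - y)\<bar> \<le> osc \<sigma> T (grad_on T w)"
    using T sh by (intro vertex_difference conformingD(2)[OF conf]) (auto simp: shape_def)
  moreover have "side_trace T w (midpoint z y) = 0"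
    using T by (intro CR_D(2)[OF conf w]) auto
  ultimately show ?thesis
    by simp
qed

text \<open>
  The value of \<open>w\<close> at a vertex, taken from one triangle, is compared with the nodal value by walking
  across sides around the vertex; each step costs the oscillation of \<open>w\<close> on two triangles of the
  patch, and the number of steps is bounded by the number of adjacent pairs.
\<close>

lemma node_value_close:
  assumes dom: "polygonal_domain \<Omega>" and conf: "conforming_triangulation \<Omega> \<T>"
    and sh: "shape \<sigma> \<T>" and \<sigma>: "\<sigma> > 0" and w: "w \<in> CR \<Omega> \<T>"
    and T: "T \<in> \<T>" "z \<in> vertices T" and n: "n = card {K \<in> \<T>. z \<in> vertices K}"
  shows "\<bar>node_value \<Omega> \<T> w z - side_trace T w z\<bar>
    \<le> (real (n * n) + 1) * (\<Sum>K\<in>{K \<in> \<T>. z \<in> vertices K}. osc \<sigma> K (grad_on K w))"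
proof -
  let ?P = "{K \<in> \<T>. z \<in> vertices K}"
  let ?R = "adjacent \<T> z"
  let ?D = "\<Sum>K\<in>?P. osc \<sigma> K (grad_on K w)"
  have fin: "finite ?P"
    using conformingD(1)[OF conf] by simp
  have sub: "?R \<subseteq> ?P \<times> ?P"
    by (auto simp: adjacent_def)
  have finR: "finite ?R"
    using fin sub by (meson finite_SigmaI finite_subset)
  have "card ?R \<le> card (?P \<times> ?P)"
    using fin sub by (intro card_mono) auto
  then have cardR: "card ?R \<le> n * n"
    by (simp add: n card_cartesian_product)
  have one: "osc \<sigma> K (grad_on K w) \<le> ?D" if "K \<in> ?P" for K
    using fin that osc_nonneg[OF \<sigma>] by (intro member_le_sum) auto
  have step: "\<bar>side_trace K w z - side_trace L w z\<bar> \<le> ?D" if KL: "(K, L) \<in> ?R" for K L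
  proof (cases "K = L")
    case True
    then show ?thesis
      using osc_nonneg[OF \<sigma>] by (simp add: sum_nonneg)
  next
    case False
    have "\<bar>side_trace K w z - side_trace L w z\<bar> \<le> (\<Sum>K'\<in>{K, L}. osc \<sigma> K' (grad_on K' w))"
      using vertex_jump[OF conf sh w KL] False by simp
    also have "\<dots> \<le> ?D"
      using fin sub KL osc_nonneg[OF \<sigma>] by (intro sum_mono2) auto
    finally show ?thesis .
  qed
  have steps: "(K, L) \<in> ?R ^^ k \<Longrightarrow> \<bar>side_trace K w z - side_trace L w z\<bar> \<le> real k * ?D" for K L k
  proof (induction k arbitrary: L)
    case (Suc k)
    then obtain M where "(K, M) \<in> ?R ^^ k" "(M, L) \<in> ?R"
      by auto
    then show ?case
      using Suc.IH[of M] step[of M L] by (simp add: algebra_simps)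
  qed simp
  have D0: "?D \<ge> 0"
    using osc_nonneg[OF \<sigma>] by (simp add: sum_nonneg)
  have walk: "\<bar>side_trace T w z - side_trace L w z\<bar> \<le> real (n * n) * ?D" if L: "(T, L) \<in> ?R\<^sup>*" for L
  proof -
    obtain k where k: "k \<le> card ?R" "(T, L) \<in> ?R ^^ k"
      using L by (auto simp: rtrancl_finite_eq_relpow[OF finR])
    have "real k * ?D \<le> real (n * n) * ?D"
      using le_trans[OF k(1) cardR] D0 by (intro mult_right_mono of_nat_mono)
    then show ?thesis
      using steps[OF k(2)] by linarith
  qed
  have goal: ?thesis if "\<bar>node_value \<Omega> \<T> w z - side_trace L w z\<bar> \<le> ?D" "(T, L) \<in> ?R\<^sup>*" for L
    using that(1) walk[OF that(2)] by (simp add: algebra_simps)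
  show ?thesis
  proof (cases "\<exists>L y. (T, L) \<in> ?R\<^sup>* \<and> y \<in> vertices L \<and> y \<noteq> z \<and> closed_segment z y \<subseteq> frontier \<Omega>")
    case True
    then obtain L y where L: "(T, L) \<in> ?R\<^sup>*" "y \<in> vertices L" "y \<noteq> z" "closed_segment z y \<subseteq> frontier \<Omega>"
      by blast
    have LP: "L \<in> ?P"
      using L(1) T by (auto simp: adjacent_def elim: rtranclE)
    have "z \<in> frontier \<Omega>"
      using L(4) by auto
    then have "\<bar>node_value \<Omega> \<T> w z - side_trace L w z\<bar> \<le> osc \<sigma> L (grad_on L w)"
      using vertex_boundary_value[OF conf sh w _ L(2) _ L(3,4)] LP by (simp add: node_value_def)
    then show ?thesis
      using goal[OF _ L(1)] one[OF LP] by linarith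
  next
    case False
    then have nb: "z \<notin> frontier \<Omega>" "\<And>K. K \<in> ?P \<Longrightarrow> (T, K) \<in> ?R\<^sup>*"
      using vertex_patch_connected[OF dom conf T] by blast+
    define L where "L = (SOME T. T \<in> \<T> \<and> z \<in> vertices T)"
    have "L \<in> \<T> \<and> z \<in> vertices L"
      unfolding L_def using T by (intro someI[of "\<lambda>T. T \<in> \<T> \<and> z \<in> vertices T" T]) auto
    then show ?thesis
      using goal[OF _ nb(2)[of L]] nb(1) D0 by (simp add: node_value_def L_def)
  qed
qed

section \<open>Barycentric coordinates of a triangle\<close>

text \<open>
  For each vertex the double sum has two equal terms, one for each order of the other two vertices.
\<close>

definition coord :: "triangle \<Rightarrow> real^2 \<Rightarrow> real^2 \<Rightarrow> real" where
  "coord T u x = (\<Sum>v\<in>vertices T - {u}. \<Sum>w\<in>vertices T - {u, v}. bary u v w x / 2)"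

lemma coord_eq_bary:
  assumes "vertices T = {u, v, w}" "u \<noteq> v" "v \<noteq> w" "u \<noteq> w"
  shows "coord T u x = bary u v w x"
proof -
  have "vertices T - {u} = {v, w}" "vertices T - {u, v} = {w}" "vertices T - {u, w} = {v}"
    using assms by auto
  then show ?thesis
    using assms bary_commute[of u w v x] by (simp add: coord_def)
qed

lemma proper_vertices:
  assumes "proper_triangle T"
  obtains u v w where "vertices T = {u, v, w}" "u \<noteq> v" "v \<noteq> w" "u \<noteq> w" "det2 (v - u) (w - u) \<noteq> 0"
    "\<And>x. coord T u x = bary u v w x" "\<And>x. coord T v x = bary v w u x" "\<And>x. coord T w x = bary w u v x"
proof -
  obtain p a b where N: "T = Triangle p {a, b}" "a \<noteq> b" "p \<noteq> a" "p \<noteq> b" "det2 (a - p) (b - p) \<noteq> 0"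
    using assms by (rule proper_triangleE)
  show thesis
    by (rule that[of p a b]) (use N in \<open>auto simp: vertices_def insert_commute intro!: coord_eq_bary\<close>)
qed

lemma coord_facts:
  assumes T: "proper_triangle T"
  shows "(\<Sum>z\<in>vertices T. coord T z x) = 1"
    "(\<Sum>z\<in>vertices T. coord T z x *\<^sub>R z) = x"
    "x \<in> region T \<longleftrightarrow> (\<forall>z\<in>vertices T. coord T z x \<ge> 0)"
    "y \<in> vertices T \<Longrightarrow> z \<in> vertices T \<Longrightarrow> coord T z y = (if y = z then 1 else 0)"
    "z \<in> vertices T \<Longrightarrow> \<exists>c g. \<forall>x. coord T z x = c + g \<bullet> x"
proof -
  obtain u v w where V: "vertices T = {u, v, w}" "u \<noteq> v" "v \<noteq> w" "u \<noteq> w" and D: "det2 (v - u) (w - u) \<noteq> 0"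
    and c: "\<And>x. coord T u x = bary u v w x" "\<And>x. coord T v x = bary v w u x" "\<And>x. coord T w x = bary w u v x"
    using T by (rule proper_vertices) (rule that)
  have D': "det2 (w - v) (u - v) \<noteq> 0" "det2 (u - w) (v - w) \<noteq> 0"
    using D by (simp_all add: det2_def algebra_simps)
  have sm: "(\<Sum>z\<in>vertices T. f z) = f u + f v + f w" for f :: "real^2 \<Rightarrow> 'a::comm_monoid_add"
    using V by (simp add: add.assoc)
  show "(\<Sum>z\<in>vertices T. coord T z x) = 1"
    using bary_sum[OF D, of x] by (simp add: sm c)
  show "(\<Sum>z\<in>vertices T. coord T z x *\<^sub>R z) = x"
    using bary_expand[OF D, of x] by (simp add: sm c)
  show "x \<in> region T \<longleftrightarrow> (\<forall>z\<in>vertices T. coord T z x \<ge> 0)"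
    using region_bary[OF T V(1) D, of x] by (simp add: V(1) c)
  show "y \<in> vertices T \<Longrightarrow> z \<in> vertices T \<Longrightarrow> coord T z y = (if y = z then 1 else 0)"
    using V bary_simps[OF D] bary_simps[OF D'(1)] bary_simps[OF D'(2)] by (auto simp: c)
  show "z \<in> vertices T \<Longrightarrow> \<exists>c g. \<forall>x. coord T z x = c + g \<bullet> x"
    using bary_affine by (auto simp: V(1) c)
qed

lemma affine_vertex_sum:
  assumes T: "proper_triangle T"
  shows "c + g \<bullet> x = (\<Sum>z\<in>vertices T. coord T z x * (c + g \<bullet> z))"
proof -
  have "g \<bullet> x = g \<bullet> (\<Sum>z\<in>vertices T. coord T z x *\<^sub>R z)"
    by (simp add: coord_facts(2)[OF T])
  also have "\<dots> = (\<Sum>z\<in>vertices T. coord T z x * (g \<bullet> z))"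
    by (simp add: inner_sum_right)
  finally have "g \<bullet> x = (\<Sum>z\<in>vertices T. coord T z x * (g \<bullet> z))" .
  moreover have "c = (\<Sum>z\<in>vertices T. coord T z x) * c"
    by (simp add: coord_facts(1)[OF T])
  ultimately show ?thesis
    by (simp add: distrib_left sum.distrib sum_distrib_right)
qed

lemma coord_le_1:
  assumes "proper_triangle T" "x \<in> region T" "z \<in> vertices T"
  shows "0 \<le> coord T z x" "coord T z x \<le> 1"
proof -
  have nn: "\<forall>z\<in>vertices T. coord T z x \<ge> 0"
    using coord_facts(3)[OF assms(1)] assms(2) by blast
  then show "0 \<le> coord T z x"
    using assms(3) by blast
  have "coord T z x \<le> (\<Sum>z\<in>vertices T. coord T z x)"
    using nn assms finite_vertices by (intro member_le_sum) auto
  then show "coord T z x \<le> 1"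
    by (simp add: coord_facts(1)[OF assms(1)])
qed

text \<open>
  If the coordinate of \<open>x\<close> at \<open>z\<close> is positive, then \<open>x\<close> is \<open>z\<close> or lies on an open segment from \<open>z\<close> to
  another point of \<open>T\<close>, so every face of \<open>T\<close> that contains \<open>x\<close> contains \<open>z\<close>.
\<close>

lemma coord_support:
  assumes conf: "conforming_triangulation \<Omega> \<T>" and T: "T \<in> \<T>" "T' \<in> \<T>"
    and x: "x \<in> region T" "x \<in> region T'" and z: "z \<in> vertices T" "coord T z x \<noteq> 0"
  shows "z \<in> vertices T'"
proof -
  have p: "proper_triangle T"
    using conformingD(2)[OF conf T(1)] .
  let ?t = "coord T z x"
  have t: "0 < ?t" "?t \<le> 1"
    using coord_le_1[OF p x(1) z(1)] z(2) by auto
  have "z \<in> region T'"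
  proof (cases "?t = 1 \<or> x = z")
    case True
    then consider "x = z" | "?t = 1"
      by blast
    then show ?thesis
    proof cases
      case 2
      have "(\<Sum>y\<in>vertices T - {z}. coord T y x) = 0"
        using coord_facts(1)[OF p, of x] 2 sum.remove[OF finite_vertices[OF p] z(1), of "\<lambda>y. coord T y x"] by simp
      then have "\<forall>y\<in>vertices T - {z}. coord T y x = 0"
        using coord_le_1(1)[OF p x(1)] finite_vertices[OF p] by (subst (asm) sum_nonneg_eq_0_iff) auto
      then have "(\<Sum>y\<in>vertices T. coord T y x *\<^sub>R y) = coord T z x *\<^sub>R z"
        using finite_vertices[OF p] z(1) by (subst sum.remove[of _ z]) auto
      then have "x = z"
        using coord_facts(2)[OF p, of x] 2 by simp
      then show ?thesis
        using x by simp
    qed (use x in simp)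
  next
    case False
    then have t1: "?t < 1"
      using t by simp
    (* The projection of x from z to the opposite side. *)
    define y where "y = (1 / (1 - ?t)) *\<^sub>R (x - ?t *\<^sub>R z)"
    have xy: "x = (1 - ?t) *\<^sub>R y + ?t *\<^sub>R z"
      using t1 by (simp add: y_def)
    have "coord T z' y \<ge> 0" if z': "z' \<in> vertices T" for z'
    proof -
      obtain c g where cg: "\<forall>x. coord T z' x = c + g \<bullet> x"
        using coord_facts(5)[OF p z'] by blast
      have "g \<bullet> x = (1 - ?t) * (g \<bullet> y) + ?t * (g \<bullet> z)"
        using arg_cong[OF xy, of "(\<bullet>) g"] by (simp add: inner_simps)
      then have "coord T z' x = (1 - ?t) * coord T z' y + ?t * coord T z' z"
        by (simp add: cg algebra_simps)
      moreover have "coord T z' x - ?t * coord T z' z \<ge> 0"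
        using coord_facts(4)[OF p z(1) z'] coord_le_1(1)[OF p x(1) z'] by (cases "z = z'") auto
      ultimately have "(1 - ?t) * coord T z' y \<ge> 0"
        by linarith
      then show ?thesis
        using t1 by (simp add: zero_le_mult_iff)
    qed
    then have yT: "y \<in> region T"
      using coord_facts(3)[OF p] by blast
    have "y \<noteq> z"
    proof
      assume "y = z"
      then have "x = z"
        using xy by (simp flip: scaleR_add_left)
      then show False
        using False by simp
    qed
    then have "x \<in> open_segment y z"
      using t(1) t1 xy by (auto simp: in_segment)
    then show ?thesis
      using face_ofD[OF conformingD(5)[OF conf T]] x yT z(1) vertices_subset_region by blast
  qed
  then show ?thesis
    using vertex_in_region[OF conf T z(1)] by blast
qed

lemma coord_agree:
  assumes conf: "conforming_triangulation \<Omega> \<T>" and T: "T \<in> \<T>" "T' \<in> \<T>"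
    and x: "x \<in> region T" "x \<in> region T'" and z: "z \<in> vertices T" "z \<in> vertices T'"
  shows "coord T z x = coord T' z x"
proof -
  have p: "proper_triangle T" "proper_triangle T'"
    using conformingD(2)[OF conf] T by auto
  obtain c g where cg: "\<forall>x. coord T' z x = c + g \<bullet> x"
    using coord_facts(5)[OF p(2) z(2)] by blast
  have "coord T' z x = (\<Sum>y\<in>vertices T. coord T y x * coord T' z y)"
    using affine_vertex_sum[OF p(1), of c g x] by (simp add: cg)
  also have "\<dots> = (\<Sum>y\<in>vertices T. if y = z then coord T z x else 0)"
  proof (rule sum.cong[OF refl])
    fix y assume y: "y \<in> vertices T"
    show "coord T y x * coord T' z y = (if y = z then coord T z x else 0)"
    proof (cases "coord T y x = 0")
      case False
      then have "y \<in> vertices T'"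
        using coord_support[OF conf T x y] by blast
      then show ?thesis
        using coord_facts(4)[OF p(2) _ z(2)] by simp
    qed auto
  qed
  also have "\<dots> = coord T z x"
    using finite_vertices[OF p(1)] z(1) by simp
  finally show ?thesis ..
qed

section \<open>The continuous companion\<close>

text \<open>
  The companion is continuous and piecewise quadratic; it takes the nodal values at the vertices, and
  the coefficients of the edge bubbles are chosen so that it has the same side means as \<open>w\<close>.
\<close>

definition bubble_value :: "(real^2) set \<Rightarrow> triangle set \<Rightarrow> (real^2 \<Rightarrow> real) \<Rightarrow> real^2 \<Rightarrow> real^2 \<Rightarrow> real" where
  "bubble_value \<Omega> \<T> w x y = (if x = y then 0
     else 3 * (side_mean \<T> w x y - (node_value \<Omega> \<T> w x + node_value \<Omega> \<T> w y) / 2))"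

definition companion_on :: "(real^2) set \<Rightarrow> triangle set \<Rightarrow> (real^2 \<Rightarrow> real) \<Rightarrow> triangle \<Rightarrow> real^2 \<Rightarrow> real" where
  "companion_on \<Omega> \<T> w T x = (\<Sum>z\<in>vertices T. coord T z x *
     (node_value \<Omega> \<T> w z + (\<Sum>y\<in>vertices T. coord T y x * bubble_value \<Omega> \<T> w z y)))"

definition companion :: "(real^2) set \<Rightarrow> triangle set \<Rightarrow> (real^2 \<Rightarrow> real) \<Rightarrow> real^2 \<Rightarrow> real" where
  "companion \<Omega> \<T> w x = companion_on \<Omega> \<T> w (SOME T. T \<in> \<T> \<and> x \<in> region T) x"

text \<open>
  This makes the companion well defined on the common part of two triangles.
\<close>

lemma sum_coord_agree:
  assumes conf: "conforming_triangulation \<Omega> \<T>" and T: "T \<in> \<T>" "T' \<in> \<T>"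
    and x: "x \<in> region T" "x \<in> region T'"
  shows "(\<Sum>z\<in>vertices T. coord T z x * h z) = (\<Sum>z\<in>vertices T'. coord T' z x * h z)"
proof -
  have fin: "finite (vertices T)" "finite (vertices T')"
    using T conformingD(2)[OF conf] finite_vertices by auto
  have "(\<Sum>z\<in>vertices T. coord T z x * h z) = (\<Sum>z\<in>vertices T \<inter> vertices T'. coord T z x * h z)"
    using coord_support[OF conf T x] fin by (intro sum.mono_neutral_right) auto
  also have "\<dots> = (\<Sum>z\<in>vertices T \<inter> vertices T'. coord T' z x * h z)"
    using coord_agree[OF conf T x] by (intro sum.cong) auto
  also have "\<dots> = (\<Sum>z\<in>vertices T'. coord T' z x * h z)"
    using coord_support[OF conf T(2,1) x(2,1)] fin by (intro sum.mono_neutral_left) auto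
  finally show ?thesis .
qed

lemma companion_eq:
  assumes conf: "conforming_triangulation \<Omega> \<T>" and T: "T \<in> \<T>" "x \<in> region T"
  shows "companion \<Omega> \<T> w x = companion_on \<Omega> \<T> w T x"
proof -
  define K where "K = (SOME T. T \<in> \<T> \<and> x \<in> region T)"
  have "K \<in> \<T> \<and> x \<in> region K"
    unfolding K_def by (rule someI[of _ T]) (rule conjI[OF T])
  then have agree: "(\<Sum>z\<in>vertices K. coord K z x * h z) = (\<Sum>z\<in>vertices T. coord T z x * h z)" for h
    using sum_coord_agree[OF conf _ T(1) _ T(2), of K h] by blast
  show ?thesis
    unfolding companion_def companion_on_def K_def[symmetric] agree ..
qed

lemma coord_linepath:
  assumes "proper_triangle T" "z \<in> vertices T"
  shows "coord T z (linepath x y t) = (1 - t) * coord T z x + t * coord T z y"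
proof -
  obtain c g where "\<forall>x. coord T z x = c + g \<bullet> x"
    using coord_facts(5)[OF assms] by blast
  then show ?thesis
    by (simp add: linepath_def inner_simps algebra_simps)
qed

lemma companion_linepath:
  assumes conf: "conforming_triangulation \<Omega> \<T>"
    and T: "T \<in> \<T>" "x \<in> vertices T" "y \<in> vertices T" "x \<noteq> y" and t: "t \<in> {0..1}"
  shows "companion \<Omega> \<T> w (linepath x y t) = (1 - t) * node_value \<Omega> \<T> w x + t * node_value \<Omega> \<T> w y
    + 2 * t * (1 - t) * bubble_value \<Omega> \<T> w x y"
proof -
  have p: "proper_triangle T"
    using conformingD(2)[OF conf T(1)] .
  obtain u where u: "vertices T = {x, y, u}" "u \<noteq> x" "u \<noteq> y"
    using obtain_third_vertex[OF p T(2-4)] by blast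
  let ?l = "linepath x y t"
  have c: "coord T x ?l = 1 - t" "coord T y ?l = t" "coord T u ?l = 0"
    using u T(4) by (simp_all add: coord_linepath[OF p] coord_facts(4)[OF p])
  have "?l \<in> region T"
    using side_subset_region[OF T(2,3)] linepath_in_path[OF t] by blast
  moreover have "bubble_value \<Omega> \<T> w y x = bubble_value \<Omega> \<T> w x y" "bubble_value \<Omega> \<T> w x x = 0" "bubble_value \<Omega> \<T> w y y = 0"
    by (simp_all add: bubble_value_def side_mean_commute[of _ _ y] add.commute)
  moreover have sm: "(\<Sum>z\<in>vertices T. h z) = h x + h y + h u" for h :: "real^2 \<Rightarrow> real"
    using u T(4) by (simp add: add.assoc)
  ultimately have "companion \<Omega> \<T> w ?l = (1 - t) * (node_value \<Omega> \<T> w x + t * bubble_value \<Omega> \<T> w x y)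
      + t * (node_value \<Omega> \<T> w y + (1 - t) * bubble_value \<Omega> \<T> w x y)"
    unfolding companion_eq[OF conf T(1) \<open>?l \<in> region T\<close>] companion_on_def sm c by simp
  then show ?thesis
    by (simp add: algebra_simps)
qed

lemma quadratic_has_integral:
  "((\<lambda>t. (1 - t) * p + t * q + 2 * t * (1 - t) * b) has_integral (p + q) / 2 + b / 3) {0..1::real}"
proof -
  have "((\<lambda>t. (1 - t) * p + t * q + 2 * t * (1 - t) * b) has_integral
    (p * 1 + (q - p + 2 * b) * 1\<^sup>2 / 2 - 2 * b * 1 ^ 3 / 3) - (p * 0 + (q - p + 2 * b) * 0\<^sup>2 / 2 - 2 * b * 0 ^ 3 / 3)) {0..1::real}"
    by (rule fundamental_theorem_of_calculus)
      (auto intro!: derivative_eq_intros simp: power2_eq_square field_simps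
        simp flip: has_real_derivative_iff_has_vector_derivative)
  then show ?thesis
    by (simp add: field_simps)
qed

definition segment_mean :: "(real^2 \<Rightarrow> real) \<Rightarrow> real^2 \<Rightarrow> real^2 \<Rightarrow> real" where
  "segment_mean f x y = side_integral (closed_segment x y) f / dist x y"

lemma segment_mean_commute: "segment_mean f x y = segment_mean f y x"
  by (simp add: segment_mean_def closed_segment_commute dist_commute)

lemma segment_mean_eq: "x \<noteq> y \<Longrightarrow> segment_mean f x y = integral {0..1} (\<lambda>t. f (linepath x y t))"
  by (simp add: segment_mean_def side_integral_closed_segment)

lemma segment_mean_companion:
  assumes conf: "conforming_triangulation \<Omega> \<T>" and w: "w \<in> CR \<Omega> \<T>"
    and T: "T \<in> \<T>" "x \<in> vertices T" "y \<in> vertices T" "x \<noteq> y"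
  shows "segment_mean (companion \<Omega> \<T> w) x y = side_trace T w (midpoint x y)"
proof -
  let ?p = "node_value \<Omega> \<T> w x" and ?q = "node_value \<Omega> \<T> w y" and ?b = "bubble_value \<Omega> \<T> w x y"
  have "((\<lambda>t. companion \<Omega> \<T> w (linepath x y t)) has_integral (?p + ?q) / 2 + ?b / 3) {0..1}"
    by (rule has_integral_eq[OF _ quadratic_has_integral]) (simp add: companion_linepath[OF conf T])
  then have "segment_mean (companion \<Omega> \<T> w) x y = (?p + ?q) / 2 + ?b / 3"
    using T(4) by (simp add: segment_mean_eq integral_unique)
  then show ?thesis
    using T(4) side_mean_side[OF conf w T] by (simp add: bubble_value_def field_simps)
qed

text \<open>
  On a boundary side the nodal values, the side mean and hence the bubble coefficient vanish.
\<close>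

lemma companion_frontier:
  assumes dom: "polygonal_domain \<Omega>" and conf: "conforming_triangulation \<Omega> \<T>" and w: "w \<in> CR \<Omega> \<T>"
    and x: "x \<in> frontier \<Omega>"
  shows "companion \<Omega> \<T> w x = 0"
proof -
  have \<Omega>: "open \<Omega>" "interior (closure \<Omega>) = \<Omega>"
    using dom by (auto simp: polygonal_domain_def)
  have notin: "x \<notin> \<Omega>"
    using x \<Omega>(1) by (simp add: frontier_def interior_open)
  obtain T where T: "T \<in> \<T>" "x \<in> region T"
    using x conformingD(4)[OF conf] by (auto simp: frontier_def)
  have p: "proper_triangle T"
    using conformingD(2)[OF conf T(1)] .
  have "region T \<subseteq> closure \<Omega>"
    using T(1) conformingD(4)[OF conf] by blast
  then have "interior (region T) \<subseteq> \<Omega>"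
    using interior_mono \<Omega>(2) by blast
  then have "x \<notin> interior (region T)"
    using notin by blast
  then obtain a b where ab: "a \<in> vertices T" "b \<in> vertices T" "a \<noteq> b" "x \<in> closed_segment a b"
    using region_cases[OF p T(2)] by blast
  then obtain t where t: "t \<in> {0..1}" "x = linepath a b t"
    by (auto simp: linepath_def closed_segment_def)
  have comp: "companion \<Omega> \<T> w x = (1 - t) * node_value \<Omega> \<T> w a + t * node_value \<Omega> \<T> w b
    + 2 * t * (1 - t) * bubble_value \<Omega> \<T> w a b"
    unfolding t(2) by (rule companion_linepath[OF conf T(1) ab(1-3) t(1)])
  have node: "node_value \<Omega> \<T> w z = 0" if "z \<in> frontier \<Omega>" for z
    using that by (simp add: node_value_def)
  show ?thesis
  proof (cases "x \<in> open_segment a b")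
    case True
    then have fr: "closed_segment a b \<subseteq> frontier \<Omega>"
      using side_boundary_cases[OF dom conf T(1) ab(1-3)] notin by blast
    then have "node_value \<Omega> \<T> w a = 0" "node_value \<Omega> \<T> w b = 0"
      by (auto intro!: node)
    moreover have "bubble_value \<Omega> \<T> w a b = 0"
      using calculation side_mean_boundary[OF w fr] by (simp add: bubble_value_def)
    ultimately show ?thesis
      by (simp add: comp)
  next
    case False
    then have "x = a \<or> x = b"
      using ab(4) by (auto simp: open_segment_def)
    then have "t = 0 \<and> x = a \<or> t = 1 \<and> x = b"
    proof
      assume "x = a"
      then have "t *\<^sub>R (b - a) = 0"
        using t(2) by (simp add: linepath_def algebra_simps)
      then show ?thesis
        using ab(3) \<open>x = a\<close> by simp
    next
      assume "x = b"
      moreover have "(1 - t) *\<^sub>R (b - a) = b - linepath a b t"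
        by (simp add: linepath_def algebra_simps)
      ultimately have "(1 - t) *\<^sub>R (b - a) = 0"
        using t(2) by simp
      then show ?thesis
        using ab(3) \<open>x = b\<close> by simp
    qed
    then show ?thesis
      using node[OF x] by (auto simp: comp)
  qed
qed

text \<open>
  On a triangle the companion differs from \<open>w\<close> by a polynomial in the barycentric coordinates whose
  coefficients are bounded by the differences between the nodal values and the vertex values of \<open>w\<close>.
  The factor 3025 is the square of the 55 in the Lipschitz constant.
\<close>

lemma companion_lipschitz:
  assumes conf: "conforming_triangulation \<Omega> \<T>" and sh: "shape \<sigma> \<T>" and \<sigma>: "\<sigma> > 0" and w: "w \<in> CR \<Omega> \<T>"
    and T: "T \<in> \<T>"
  obtains L where "L \<ge> 0"
    "\<And>x y. x \<in> region T \<Longrightarrow> y \<in> region T \<Longrightarrow> \<bar>companion \<Omega> \<T> w x - companion \<Omega> \<T> w y\<bar> \<le> L * dist x y"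
    "area T * L\<^sup>2 \<le> 2 * (area T * (norm (grad_on T w))\<^sup>2)
      + 3025 * \<sigma> * (\<Sum>z\<in>vertices T. \<bar>node_value \<Omega> \<T> w z - side_trace T w z\<bar>)\<^sup>2"
proof -
  have p: "proper_triangle T" and leg: "leg2 T \<le> \<sigma> * area T"
    using conformingD(2)[OF conf T] sh T by (auto simp: shape_def)
  have ar: "area T > 0"
    using area_pos[OF p] .
  have fin: "finite (vertices T)"
    using finite_vertices[OF p] .
  have card3: "card (vertices T) = 3"
    using p by (auto simp: vertices_def elim!: proper_triangleE)
  define l where "l = sqrt (\<sigma> / (2 * area T))"
  have l0: "l \<ge> 0"
    using \<sigma> ar by (simp add: l_def)
  have l2: "area T * l\<^sup>2 = \<sigma> / 2"
    using \<sigma> ar by (simp add: l_def)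
  have lip: "\<bar>coord T z x - coord T z y\<bar> \<le> l * dist x y" if z: "z \<in> vertices T" for z x y
  proof -
    obtain c g where cg: "\<forall>x. coord T z x = c + g \<bullet> x"
      using coord_facts(5)[OF p z] by blast
    have "\<bar>g \<bullet> (a - b)\<bar> \<le> 1" if "a \<in> vertices T" "b \<in> vertices T" for a b
    proof -
      have "g \<bullet> (a - b) = coord T z a - coord T z b"
        by (simp add: cg inner_diff_right)
      then show ?thesis
        using that z by (simp add: coord_facts(4)[OF p])
    qed
    then have "area T * (norm g)\<^sup>2 \<le> \<sigma> * 1\<^sup>2 / 2"
      by (rule gradient_bound[OF p leg])
    then have "(norm g)\<^sup>2 \<le> \<sigma> / (2 * area T)"
      using ar by (simp add: field_simps)
    then have "norm g \<le> l"
      unfolding l_def by (rule real_le_rsqrt)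
    then have "norm g * norm (x - y) \<le> l * norm (x - y)"
      by (simp add: mult_right_mono)
    moreover have "coord T z x - coord T z y = g \<bullet> (x - y)"
      by (simp add: cg inner_diff_right)
    ultimately show ?thesis
      using Cauchy_Schwarz_ineq2[of g "x - y"] by (simp add: dist_norm)
  qed
  let ?g = "grad_on T w" and ?B = "bubble_value \<Omega> \<T> w"
  define c where "c z = node_value \<Omega> \<T> w z - side_trace T w z" for z
  define S where "S = (\<Sum>z\<in>vertices T. \<bar>c z\<bar>)"
  have cS: "\<bar>c z\<bar> \<le> S" if "z \<in> vertices T" for z
    unfolding S_def using fin that by (intro member_le_sum) auto
  have S0: "S \<ge> 0"
    by (simp add: S_def sum_nonneg)
  have B: "\<bar>?B z y\<bar> \<le> 3 * S" if zy: "z \<in> vertices T" "y \<in> vertices T" for z y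
  proof (cases "z = y")
    case False
    have "side_mean \<T> w z y = (side_trace T w z + side_trace T w y) / 2"
      using side_mean_side[OF conf w T zy False] by (simp add: side_trace_def midpoint_def inner_simps field_simps)
    then have "?B z y = - (3/2) * (c z + c y)"
      using False by (simp add: bubble_value_def c_def field_simps)
    then have "\<bar>?B z y\<bar> = \<bar>- (3/2)\<bar> * \<bar>c z + c y\<bar>"
      by (simp only: abs_mult)
    moreover have "\<bar>- (3/2)::real\<bar> = 3/2"
      by simp
    ultimately have "\<bar>?B z y\<bar> = (3/2) * \<bar>c z + c y\<bar>"
      by metis
    moreover have "\<bar>c z + c y\<bar> \<le> S + S"
      by (rule order_trans[OF abs_triangle_ineq add_mono[OF cS[OF zy(1)] cS[OF zy(2)]]])
    then have "(3/2) * \<bar>c z + c y\<bar> \<le> (3/2) * (S + S)"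
      by (rule mult_left_mono) simp
    ultimately show ?thesis
      by simp
  qed (use S0 in \<open>simp add: bubble_value_def\<close>)
  (* 55 = 1 + 9 * 6: one linear term and nine products of coordinates, each with Lipschitz constant 6 S l. *)
  define L where "L = norm ?g + 55 * S * l"
  have psi: "companion \<Omega> \<T> w x = side_trace T w x + (\<Sum>z\<in>vertices T. coord T z x * c z)
      + (\<Sum>z\<in>vertices T. \<Sum>y\<in>vertices T. coord T z x * coord T y x * ?B z y)" if x: "x \<in> region T" for x
  proof -
    have "side_trace T w x = (\<Sum>z\<in>vertices T. coord T z x * side_trace T w z)"
      using affine_vertex_sum[OF p, of "fst (affine_rep T w)" ?g x] by (simp add: side_trace_def)
    then have "side_trace T w x + (\<Sum>z\<in>vertices T. coord T z x * c z) = (\<Sum>z\<in>vertices T. coord T z x * node_value \<Omega> \<T> w z)"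
      by (simp add: c_def right_diff_distrib sum_subtractf)
    then show ?thesis
      by (simp add: companion_eq[OF conf T x] companion_on_def distrib_left sum.distrib sum_distrib_left mult.assoc)
  qed
  have Lip: "\<bar>companion \<Omega> \<T> w x - companion \<Omega> \<T> w y\<bar> \<le> L * dist x y"
    if x: "x \<in> region T" and y: "y \<in> region T" for x y
  proof -
    let ?d = "dist x y"
    have t1: "\<bar>side_trace T w x - side_trace T w y\<bar> \<le> norm ?g * ?d"
    proof -
      have "side_trace T w x - side_trace T w y = ?g \<bullet> (x - y)"
        by (simp add: side_trace_def inner_diff_right)
      then show ?thesis
        using Cauchy_Schwarz_ineq2[of ?g "x - y"] by (simp add: dist_norm)
    qed
    have t2: "\<bar>(\<Sum>z\<in>vertices T. coord T z x * c z) - (\<Sum>z\<in>vertices T. coord T z y * c z)\<bar> \<le> S * l * ?d"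
    proof -
      have "\<bar>\<Sum>z\<in>vertices T. (coord T z x - coord T z y) * c z\<bar> \<le> (\<Sum>z\<in>vertices T. (l * ?d) * \<bar>c z\<bar>)"
        using lip by (intro order_trans[OF sum_abs] sum_mono) (auto simp: abs_mult intro: mult_right_mono)
      also have "\<dots> = S * l * ?d"
        by (simp add: S_def sum_distrib_left sum_distrib_right mult_ac)
      finally show ?thesis
        by (simp add: left_diff_distrib sum_subtractf)
    qed
    have prod: "\<bar>coord T z x * coord T u x * ?B z u - coord T z y * coord T u y * ?B z u\<bar> \<le> 6 * S * l * ?d"
      if zu: "z \<in> vertices T" "u \<in> vertices T" for z u
    proof -
      have "coord T z x * coord T u x - coord T z y * coord T u y
          = coord T z x * (coord T u x - coord T u y) + (coord T z x - coord T z y) * coord T u y"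
        by (simp add: algebra_simps)
      then have "\<bar>coord T z x * coord T u x - coord T z y * coord T u y\<bar>
          \<le> \<bar>coord T z x\<bar> * \<bar>coord T u x - coord T u y\<bar> + \<bar>coord T z x - coord T z y\<bar> * \<bar>coord T u y\<bar>"
        by (simp add: abs_mult[symmetric] abs_triangle_ineq)
      also have "\<dots> \<le> 1 * (l * ?d) + (l * ?d) * 1"
        using coord_le_1[OF p x zu(1)] coord_le_1[OF p y zu(2)] lip[OF zu(1)] lip[OF zu(2)] l0
        by (intro add_mono mult_mono) auto
      finally have "\<bar>coord T z x * coord T u x - coord T z y * coord T u y\<bar> * \<bar>?B z u\<bar> \<le> (2 * (l * ?d)) * (3 * S)"
        using B[OF zu] l0 by (intro mult_mono) auto
      also have "(2 * (l * ?d)) * (3 * S) = 6 * S * l * ?d"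
        by simp
      finally show ?thesis
        by (simp only: left_diff_distrib[symmetric] abs_mult[symmetric])
    qed
    have t3: "\<bar>(\<Sum>z\<in>vertices T. \<Sum>u\<in>vertices T. coord T z x * coord T u x * ?B z u)
        - (\<Sum>z\<in>vertices T. \<Sum>u\<in>vertices T. coord T z y * coord T u y * ?B z u)\<bar> \<le> 54 * S * l * ?d"
    proof -
      have "\<bar>\<Sum>z\<in>vertices T. \<Sum>u\<in>vertices T. (coord T z x * coord T u x * ?B z u - coord T z y * coord T u y * ?B z u)\<bar>
          \<le> (\<Sum>z\<in>vertices T. \<Sum>u\<in>vertices T. 6 * S * l * ?d)"
        by (intro order_trans[OF sum_abs] sum_mono prod)
      then show ?thesis
        by (simp add: card3 sum_subtractf)
    qed
    have "L * ?d = norm ?g * ?d + S * l * ?d + 54 * S * l * ?d"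
      by (simp add: L_def algebra_simps)
    then show ?thesis
      unfolding psi[OF x] psi[OF y] using t1 t2 t3 by linarith
  qed
  have "L\<^sup>2 \<le> 2 * (norm ?g)\<^sup>2 + 2 * (55 * S * l)\<^sup>2"
    unfolding L_def using sum_squares_bound[of "norm ?g" "55 * S * l"] by (simp add: power2_sum)
  then have "area T * L\<^sup>2 \<le> area T * (2 * (norm ?g)\<^sup>2 + 2 * (55 * S * l)\<^sup>2)"
    using ar by (intro mult_left_mono) auto
  also have "\<dots> = 2 * (area T * (norm ?g)\<^sup>2) + 6050 * S\<^sup>2 * (area T * l\<^sup>2)"
    by (simp add: power_mult_distrib algebra_simps)
  also have "\<dots> = 2 * (area T * (norm ?g)\<^sup>2) + 3025 * \<sigma> * S\<^sup>2"
    by (simp add: l2)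
  finally have "area T * L\<^sup>2 \<le> 2 * (area T * (norm ?g)\<^sup>2) + 3025 * \<sigma> * S\<^sup>2" .
  moreover have "L \<ge> 0"
    using S0 l0 by (simp add: L_def)
  ultimately show thesis
    using that[of L] Lip by (simp add: S_def c_def)
qed

section \<open>Means over segments\<close>

lemma segment_mean_split:
  assumes ab: "a \<noteq> b" and f: "continuous_on (closed_segment a b) f"
  shows "segment_mean f a b = (segment_mean f a (midpoint a b) + segment_mean f (midpoint a b) b) / 2"
proof -
  let ?m = "midpoint a b"
  let ?F = "\<lambda>t. f (linepath a b t)"
  have "continuous_on {0..1} ?F"
    by (intro continuous_on_compose2[OF f] continuous_intros continuous_on_linepath) (auto simp: linepath_in_path)
  then have int: "?F integrable_on {0..1}"
    by (rule integrable_continuous_real)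
  have "?F integrable_on {0..1/2}" "?F integrable_on {1/2..1}"
    by (rule integrable_subinterval_real[OF int]; simp)+
  then have i: "(?F has_integral integral {0..1/2} ?F) (cbox 0 (1/2))" "(?F has_integral integral {1/2..1} ?F) (cbox (1/2) 1)"
    by (simp_all add: integrable_integral)
  have "((\<lambda>s. ?F ((1/2) * s + 0)) has_integral 2 * integral {0..1/2} ?F) {0..1}"
    using has_integral_affinity'[OF i(1), of "1/2" 0] by simp
  moreover have "linepath a b ((1/2) * s + 0) = linepath a ?m s" for s
    by (simp add: linepath_def midpoint_def vec_eq_iff field_simps)
  ultimately have first: "((\<lambda>s. f (linepath a ?m s)) has_integral 2 * integral {0..1/2} ?F) {0..1}"
    by simp
  have "((\<lambda>s. ?F ((1/2) * s + 1/2)) has_integral 2 * integral {1/2..1} ?F) {0..1}"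
    using has_integral_affinity'[OF i(2), of "1/2" "1/2"] by simp
  moreover have "linepath a b ((1/2) * s + 1/2) = linepath ?m b s" for s
    by (simp add: linepath_def midpoint_def vec_eq_iff field_simps)
  ultimately have second: "((\<lambda>s. f (linepath ?m b s)) has_integral 2 * integral {1/2..1} ?F) {0..1}"
    by simp
  have "integral {0..1/2} ?F + integral {1/2..1} ?F = integral {0..1} ?F"
    using int by (intro Henstock_Kurzweil_Integration.integral_combine) auto
  moreover have "a \<noteq> ?m" "?m \<noteq> b"
    using ab by (metis midpoint_eq_endpoint)+
  ultimately show ?thesis
    using ab integral_unique[OF first] integral_unique[OF second] by (simp add: segment_mean_eq)
qed

lemma segment_mean_lipschitz:
  assumes f: "\<And>v w. v \<in> C \<Longrightarrow> w \<in> C \<Longrightarrow> \<bar>f v - f w\<bar> \<le> L * dist v w" and L: "L \<ge> 0"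
    and C: "convex C" "x \<in> C" "y \<in> C" "u \<in> C" and ne: "u \<noteq> x" "u \<noteq> y"
  shows "\<bar>segment_mean f u x - segment_mean f u y\<bar> \<le> L * dist x y"
proof -
  have cont: "continuous_on C f"
  proof (rule Lipschitz.lipschitz_on_continuous_on[of L])
    show "L-lipschitz_on C f"
      using f L by (auto simp: lipschitz_on_def dist_real_def)
  qed
  have sub: "closed_segment u v \<subseteq> C" if "v \<in> C" for v
    using that C by (simp add: closed_segment_subset)
  have c: "continuous_on {0..1} (\<lambda>t. f (linepath u v t))" if "v \<in> C" for v
    using sub[OF that] linepath_in_path
    by (intro continuous_on_compose2[OF cont] continuous_on_linepath) blast
  have "\<bar>integral {0..1} (\<lambda>t. f (linepath u x t) - f (linepath u y t))\<bar> \<le> L * dist x y * Henstock_Kurzweil_Integration.content (cbox 0 (1::real))"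
  proof (rule has_integral_bound[of _ "\<lambda>t. f (linepath u x t) - f (linepath u y t)", unfolded real_norm_def])
    show "((\<lambda>t. f (linepath u x t) - f (linepath u y t)) has_integral
        integral {0..1} (\<lambda>t. f (linepath u x t) - f (linepath u y t))) (cbox 0 1)"
      using c C(2,3) by (simp add: integrable_integral integrable_continuous_real continuous_on_diff)
    fix t :: real assume "t \<in> cbox 0 1"
    then have t: "t \<in> {0..1}"
      by simp
    have "linepath u x t - linepath u y t = t *\<^sub>R (x - y)"
      by (simp add: linepath_def algebra_simps)
    then have "dist (linepath u x t) (linepath u y t) \<le> dist x y"
      using t by (simp add: dist_norm mult_left_le_one_le)
    then have "L * dist (linepath u x t) (linepath u y t) \<le> L * dist x y"
      using L by (rule mult_left_mono)
    then show "\<bar>f (linepath u x t) - f (linepath u y t)\<bar> \<le> L * dist x y"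
      using f[of "linepath u x t" "linepath u y t"] sub[OF C(2)] sub[OF C(3)] linepath_in_path[OF t] by force
  qed (use L in auto)
  then show ?thesis
    using ne c C(2,3) by (simp add: segment_mean_eq integral_diff integrable_continuous_real)
qed

text \<open>
  The difference of the values at two vertices is twice the difference of the means over the sides that
  join them to the third vertex. These means compare the function at points that are no farther apart
  than the two vertices.
\<close>

lemma gradient_of_segment_means:
  assumes p: "proper_triangle K" and leg: "leg2 K \<le> \<sigma> * area K" and \<sigma>: "\<sigma> > 0"
    and f: "\<And>v w. v \<in> region K \<Longrightarrow> w \<in> region K \<Longrightarrow> \<bar>f v - f w\<bar> \<le> L * dist v w" and L: "L \<ge> 0"
    and g: "\<And>x y. x \<in> vertices K \<Longrightarrow> y \<in> vertices K \<Longrightarrow> x \<noteq> y \<Longrightarrow> c + g \<bullet> midpoint x y = segment_mean f x y"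
  shows "area K * (norm g)\<^sup>2 \<le> 4 * \<sigma>\<^sup>2 * L\<^sup>2 * area K"
proof -
  define M where "M = 2 * L * sqrt (2 * \<sigma> * area K)"
  have ar: "area K > 0"
    using area_pos[OF p] .
  have "\<bar>g \<bullet> (x - y)\<bar> \<le> M" if xy: "x \<in> vertices K" "y \<in> vertices K" for x y
  proof (cases "x = y")
    case True
    then show ?thesis
      using L \<sigma> ar by (simp add: M_def)
  next
    case False
    obtain u where u: "vertices K = {x, y, u}" "u \<noteq> x" "u \<noteq> y"
      using obtain_third_vertex[OF p xy False] by blast
    have "g \<bullet> (x - y) = 2 * ((c + g \<bullet> midpoint u x) - (c + g \<bullet> midpoint u y))"
      by (simp add: midpoint_def inner_simps field_simps)
    also have "\<dots> = 2 * (segment_mean f u x - segment_mean f u y)"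
      using g u by simp
    finally have "\<bar>g \<bullet> (x - y)\<bar> \<le> 2 * (L * dist x y)"
      using segment_mean_lipschitz[of "region K" f L x y u, OF f L convex_region] u vertices_subset_region[of K] by force
    also have "\<dots> \<le> M"
    proof -
      have "(dist x y)\<^sup>2 \<le> 2 * \<sigma> * area K"
        using dist_vertices_le[OF p xy] leg by simp
      then have "dist x y \<le> sqrt (2 * \<sigma> * area K)"
        by (rule real_le_rsqrt)
      then show ?thesis
        using L by (simp add: M_def mult_left_mono)
    qed
    finally show ?thesis .
  qed
  then have "area K * (norm g)\<^sup>2 \<le> \<sigma> * M\<^sup>2 / 2"
    by (rule gradient_bound[OF p leg])
  also have "M\<^sup>2 = 4 * L\<^sup>2 * (2 * \<sigma> * area K)"
    using \<sigma> ar by (simp add: M_def power_mult_distrib)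
  finally show ?thesis
    by (simp add: power2_eq_square algebra_simps)
qed

section \<open>A stable right inverse of interpolation\<close>

text \<open>
  Exchanging the order of summation, each triangle is counted once for each of its three vertices and each
  triangle at that vertex.
\<close>

lemma sum_vertex_patches:
  assumes conf: "conforming_triangulation \<Omega> \<T>" and q: "\<And>K. K \<in> \<T> \<Longrightarrow> q K \<ge> (0::real)"
    and N: "\<And>z. card {K \<in> \<T>. z \<in> vertices K} \<le> N"
  shows "(\<Sum>T\<in>\<T>. \<Sum>z\<in>vertices T. \<Sum>K\<in>{K \<in> \<T>. z \<in> vertices K}. q K) \<le> 3 * N * (\<Sum>K\<in>\<T>. q K)"
proof -
  define Z where "Z = (\<Union>T\<in>\<T>. vertices T)"
  have fin: "finite \<T>" "finite Z"
    using conformingD(1,2)[OF conf] finite_vertices by (auto simp: Z_def)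
  have V: "vertices T = {z. z \<in> Z \<and> z \<in> vertices T}" if "T \<in> \<T>" for T
    using that by (auto simp: Z_def)
  have swap: "(\<Sum>T\<in>\<T>. \<Sum>z\<in>vertices T. h T z) = (\<Sum>z\<in>Z. \<Sum>T\<in>{T \<in> \<T>. z \<in> vertices T}. h T z)"
    for h :: "triangle \<Rightarrow> real^2 \<Rightarrow> real"
  proof -
    have "(\<Sum>T\<in>\<T>. \<Sum>z\<in>vertices T. h T z) = (\<Sum>T\<in>\<T>. \<Sum>z | z \<in> Z \<and> z \<in> vertices T. h T z)"
      using V by (intro sum.cong) auto
    also have "\<dots> = (\<Sum>z\<in>Z. \<Sum>T | T \<in> \<T> \<and> z \<in> vertices T. h T z)"
      by (rule sum.swap_restrict[OF fin])
    finally show ?thesis .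
  qed
  define Q where "Q z = (\<Sum>K\<in>{K \<in> \<T>. z \<in> vertices K}. q K)" for z
  have Q0: "Q z \<ge> 0" for z
    using q by (auto simp: Q_def intro: sum_nonneg)
  have "(\<Sum>T\<in>\<T>. \<Sum>z\<in>vertices T. Q z) = (\<Sum>z\<in>Z. card {T \<in> \<T>. z \<in> vertices T} * Q z)"
    by (simp add: swap)
  also have "\<dots> \<le> (\<Sum>z\<in>Z. N * Q z)"
    using N Q0 by (intro sum_mono mult_right_mono) auto
  also have "\<dots> = N * (\<Sum>z\<in>Z. Q z)"
    by (simp add: sum_distrib_left)
  also have "(\<Sum>z\<in>Z. Q z) = (\<Sum>K\<in>\<T>. \<Sum>z\<in>vertices K. q K)"
    by (simp only: swap Q_def)
  also have "\<dots> = (\<Sum>K\<in>\<T>. 3 * q K)"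
  proof (rule sum.cong[OF refl])
    fix K assume "K \<in> \<T>"
    then have "card (vertices K) = 3"
      using conformingD(2)[OF conf] by (fastforce simp: vertices_def elim!: proper_triangleE)
    then show "(\<Sum>z\<in>vertices K. q K) = 3 * q K"
      by simp
  qed
  also have "\<dots> = 3 * (\<Sum>K\<in>\<T>. q K)"
    by (simp add: sum_distrib_left)
  finally show ?thesis
    by (simp add: Q_def mult_ac)
qed

lemma sum_area_below:
  assumes ref: "tree_refines P Q" and T: "T \<in> P"
  shows "(\<Sum>K\<in>below Q T. area K) = area T"
proof -
  have Q: "tiling (below Q T)"
    using ref tiling_subset[of Q "below Q T"] by (auto simp: tree_refines_def below_def)
  have "negligible (region K \<inter> region L)" if KL: "K \<in> below Q T" "L \<in> below Q T" "K \<noteq> L" for K L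
  proof (rule negligible_subset)
    show "negligible (frontier (region K))"
      by (rule negligible_frontier_region)
    have "interior (region K) \<inter> region L = {}"
      using tilingD(3)[OF Q KL(1,2)] KL(3) interiors_meet tilingD(2)[OF Q] KL(1,2) by blast
    then show "region K \<inter> region L \<subseteq> frontier (region K)"
      using closure_subset[of "region K"] by (auto simp: frontier_def)
  qed
  then have "measure lebesgue (\<Union>(region ` below Q T)) = (\<Sum>K\<in>below Q T. measure lebesgue (region K))"
    using tilingD(1,2)[OF Q] by (intro measure_negligible_finite_Union_image) (auto simp: pairwise_def lmeasurable_region)
  then show ?thesis
    using cover_below[OF ref T] by (simp add: area_def)
qed

text \<open>
  Interpolating the companion of \<open>w\<close> on the finer triangulation gives a function \<open>z\<close> there whose
  interpolant on the coarser one is \<open>w\<close> again. The interpolation is stable because on every triangle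
  it is controlled by the Lipschitz constant of the companion, and areas add up.
\<close>

lemma stable_right_inverse:
  assumes \<sigma>: "\<sigma> > 0"
  shows "\<exists>C>0. \<forall>\<Omega> \<T> \<T>' w. polygonal_domain \<Omega> \<and>
    conforming_triangulation \<Omega> \<T> \<and> conforming_triangulation \<Omega> \<T>' \<and> shape \<sigma> \<T> \<and> shape \<sigma> \<T>' \<and>
    tree_refines \<T> \<T>' \<and> w \<in> CR \<Omega> \<T> \<longrightarrow>
    (\<exists>z\<in>CR \<Omega> \<T>'. interpolates \<T> \<T>' z w \<and>
      (\<Sum>K\<in>\<T>'. area K * (norm (grad_on K z))\<^sup>2) \<le> C * (\<Sum>T\<in>\<T>. area T * (norm (grad_on T w))\<^sup>2))"
proof -
  (* N bounds the number of triangles at a vertex, k the number of steps of a walk around it plus one. *)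
  define N where "N = nat \<lceil>2 * \<sigma> * measure lebesgue (cball (0::real^2) 1)\<rceil>"
  define k where "k = real (N * N) + 1"
  define A where "A = 3025 * \<sigma> * (3 * (k\<^sup>2 * real N))"
  define C where "C = 4 * \<sigma>\<^sup>2 * (2 + A * (3 * N * (2 * \<sigma>)))"
  have A0: "A \<ge> 0"
    using \<sigma> by (simp add: A_def)
  have "C > 0"
    unfolding C_def using \<sigma> A0 by (intro mult_pos_pos add_pos_nonneg) auto
  moreover have "\<exists>z\<in>CR \<Omega> \<T>'. interpolates \<T> \<T>' z w \<and>
      (\<Sum>K\<in>\<T>'. area K * (norm (grad_on K z))\<^sup>2) \<le> C * (\<Sum>T\<in>\<T>. area T * (norm (grad_on T w))\<^sup>2)"
    if dom: "polygonal_domain \<Omega>" and conf: "conforming_triangulation \<Omega> \<T>" "conforming_triangulation \<Omega> \<T>'"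
      and sh: "shape \<sigma> \<T>" "shape \<sigma> \<T>'" and ref: "tree_refines \<T> \<T>'" and w: "w \<in> CR \<Omega> \<T>" for \<Omega> \<T> \<T>' w
  proof -
    let ?f = "companion \<Omega> \<T> w"
    let ?q = "\<lambda>T. area T * (norm (grad_on T w))\<^sup>2"
    have q0: "?q T \<ge> 0" for T
      by (simp add: area_def)
    have N: "card {K \<in> \<T>. z \<in> vertices K} \<le> N" for z
      using card_vertex_patch[OF conf(1) sh(1) \<sigma>, of z] unfolding N_def by linarith
    have fin: "finite \<T>"
      using conformingD(1)[OF conf(1)] .
    have "\<forall>T\<in>\<T>. \<exists>L. L \<ge> 0 \<and> (\<forall>x\<in>region T. \<forall>y\<in>region T. \<bar>?f x - ?f y\<bar> \<le> L * dist x y) \<and>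
        area T * L\<^sup>2 \<le> 2 * ?q T + 3025 * \<sigma> * (\<Sum>z\<in>vertices T. \<bar>node_value \<Omega> \<T> w z - side_trace T w z\<bar>)\<^sup>2"
    proof
      fix T assume T: "T \<in> \<T>"
      show "\<exists>L. L \<ge> 0 \<and> (\<forall>x\<in>region T. \<forall>y\<in>region T. \<bar>?f x - ?f y\<bar> \<le> L * dist x y) \<and>
          area T * L\<^sup>2 \<le> 2 * ?q T + 3025 * \<sigma> * (\<Sum>z\<in>vertices T. \<bar>node_value \<Omega> \<T> w z - side_trace T w z\<bar>)\<^sup>2"
        by (rule companion_lipschitz[OF conf(1) sh(1) \<sigma> w T]) blast
    qed
    from bchoice[OF this] obtain L where L0: "\<And>T. T \<in> \<T> \<Longrightarrow> L T \<ge> 0"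
      and Lip: "\<And>T x y. T \<in> \<T> \<Longrightarrow> x \<in> region T \<Longrightarrow> y \<in> region T \<Longrightarrow> \<bar>?f x - ?f y\<bar> \<le> L T * dist x y"
      and L2: "\<And>T. T \<in> \<T> \<Longrightarrow> area T * (L T)\<^sup>2 \<le> 2 * ?q T
        + 3025 * \<sigma> * (\<Sum>z\<in>vertices T. \<bar>node_value \<Omega> \<T> w z - side_trace T w z\<bar>)\<^sup>2"
      by blast
    have L_sum: "area T * (L T)\<^sup>2 \<le> 2 * ?q T + A * (\<Sum>z\<in>vertices T. \<Sum>K\<in>{K \<in> \<T>. z \<in> vertices K}. 2 * \<sigma> * ?q K)"
      if T: "T \<in> \<T>" for T
    proof -
      have node: "\<bar>node_value \<Omega> \<T> w z - side_trace T w z\<bar>\<^sup>2 \<le> (k\<^sup>2 * N) * (\<Sum>K\<in>{K \<in> \<T>. z \<in> vertices K}. 2 * \<sigma> * ?q K)"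
        if z: "z \<in> vertices T" for z
      proof -
        let ?P = "{K \<in> \<T>. z \<in> vertices K}" and ?D = "\<Sum>K\<in>{K \<in> \<T>. z \<in> vertices K}. osc \<sigma> K (grad_on K w)"
        have D0: "?D \<ge> 0"
          using osc_nonneg[OF \<sigma>] by (simp add: sum_nonneg)
        have "real (card ?P * card ?P) + 1 \<le> k"
          using mult_le_mono[OF N[of z] N[of z]] unfolding k_def by (simp only: of_nat_le_iff add_le_cancel_right)
        then have "(real (card ?P * card ?P) + 1) * ?D \<le> k * ?D"
          using D0 by (rule mult_right_mono)
        then have "\<bar>node_value \<Omega> \<T> w z - side_trace T w z\<bar> \<le> k * ?D"
          using node_value_close[OF dom conf(1) sh(1) \<sigma> w T z refl] by linarith
        then have "\<bar>node_value \<Omega> \<T> w z - side_trace T w z\<bar>\<^sup>2 \<le> (k * ?D)\<^sup>2"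
          by (intro power_mono) auto
        also have "\<dots> = k\<^sup>2 * ?D\<^sup>2"
          by (simp add: power_mult_distrib)
        also have "\<dots> \<le> k\<^sup>2 * ((\<Sum>K\<in>?P. (osc \<sigma> K (grad_on K w))\<^sup>2) * card ?P)"
          by (intro mult_left_mono sum_squared_le_sum_of_squares) auto
        also have "\<dots> \<le> k\<^sup>2 * ((\<Sum>K\<in>?P. (osc \<sigma> K (grad_on K w))\<^sup>2) * N)"
          using N[of z] by (intro mult_left_mono) (auto simp: sum_nonneg)
        finally show ?thesis
          using \<sigma> by (simp add: osc_power2 mult_ac)
      qed
      have "card (vertices T) = 3"
        using conformingD(2)[OF conf(1) T] by (auto simp: vertices_def elim!: proper_triangleE)
      then have "(\<Sum>z\<in>vertices T. \<bar>node_value \<Omega> \<T> w z - side_trace T w z\<bar>)\<^sup>2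
          \<le> 3 * (\<Sum>z\<in>vertices T. \<bar>node_value \<Omega> \<T> w z - side_trace T w z\<bar>\<^sup>2)"
        using sum_squared_le_sum_of_squares[of "\<lambda>z. \<bar>node_value \<Omega> \<T> w z - side_trace T w z\<bar>" "vertices T"]
        by (simp add: mult.commute)
      also have "\<dots> \<le> 3 * (\<Sum>z\<in>vertices T. (k\<^sup>2 * N) * (\<Sum>K\<in>{K \<in> \<T>. z \<in> vertices K}. 2 * \<sigma> * ?q K))"
        using node by (intro mult_left_mono sum_mono) auto
      also have "\<dots> = (3 * (k\<^sup>2 * N)) * (\<Sum>z\<in>vertices T. \<Sum>K\<in>{K \<in> \<T>. z \<in> vertices K}. 2 * \<sigma> * ?q K)"
        by (simp add: sum_distrib_left mult.assoc)
      finally have "3025 * \<sigma> * (\<Sum>z\<in>vertices T. \<bar>node_value \<Omega> \<T> w z - side_trace T w z\<bar>)\<^sup>2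
          \<le> 3025 * \<sigma> * ((3 * (k\<^sup>2 * N)) * (\<Sum>z\<in>vertices T. \<Sum>K\<in>{K \<in> \<T>. z \<in> vertices K}. 2 * \<sigma> * ?q K))"
        using \<sigma> by (intro mult_left_mono) auto
      also have "\<dots> = A * (\<Sum>z\<in>vertices T. \<Sum>K\<in>{K \<in> \<T>. z \<in> vertices K}. 2 * \<sigma> * ?q K)"
        by (simp only: A_def mult.assoc)
      finally show ?thesis
        using L2[OF T] by linarith
    qed
    have "(\<Sum>T\<in>\<T>. area T * (L T)\<^sup>2) \<le> (\<Sum>T\<in>\<T>. 2 * ?q T
        + A * (\<Sum>z\<in>vertices T. \<Sum>K\<in>{K \<in> \<T>. z \<in> vertices K}. 2 * \<sigma> * ?q K))"
      by (intro sum_mono L_sum)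
    also have "\<dots> = 2 * (\<Sum>T\<in>\<T>. ?q T) + A * (\<Sum>T\<in>\<T>. \<Sum>z\<in>vertices T. \<Sum>K\<in>{K \<in> \<T>. z \<in> vertices K}. 2 * \<sigma> * ?q K)"
      by (simp only: sum.distrib sum_distrib_left)
    also have "\<dots> \<le> 2 * (\<Sum>T\<in>\<T>. ?q T) + A * (3 * N * (\<Sum>K\<in>\<T>. 2 * \<sigma> * ?q K))"
      using \<sigma> q0 N A0 by (intro add_left_mono mult_left_mono sum_vertex_patches[OF conf(1)]) auto
    also have "\<dots> = (2 + A * (3 * N * (2 * \<sigma>))) * (\<Sum>T\<in>\<T>. ?q T)"
      unfolding sum_distrib_left[symmetric] by (simp add: algebra_simps)
    finally have sumL: "(\<Sum>T\<in>\<T>. area T * (L T)\<^sup>2) \<le> (2 + A * (3 * N * (2 * \<sigma>))) * (\<Sum>T\<in>\<T>. ?q T)" .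
    have "continuous_on (region T) ?f" if T: "T \<in> \<T>" for T
      using Lip[OF T] L0[OF T]
      by (intro Lipschitz.lipschitz_on_continuous_on[of "L T"]) (auto simp: lipschitz_on_def dist_real_def)
    then have cont: "continuous_on (cover \<T>) ?f"
      using fin conformingD(2)[OF conf(1)]
      by (intro continuous_on_closed_Union) (auto simp: compact_imp_closed compact_region)
    have cov: "cover \<T>' = cover \<T>" "cover \<T> = closure \<Omega>"
      using conformingD(4) conf by auto
    have zero: "segment_mean ?f x y = 0" if "x \<noteq> y" "closed_segment x y \<subseteq> frontier \<Omega>" for x y
    proof -
      have "?f (linepath x y t) = 0" if "t \<in> {0..1}" for t
        using companion_frontier[OF dom conf(1) w] linepath_in_path[OF that] \<open>closed_segment x y \<subseteq> frontier \<Omega>\<close> by blast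
      then have "integral {0..1} (\<lambda>t. ?f (linepath x y t)) = integral {0..1} (\<lambda>t::real. 0)"
        by (intro Henstock_Kurzweil_Integration.integral_cong) auto
      then show ?thesis
        using that(1) by (simp add: segment_mean_eq)
    qed
    obtain z where z: "z \<in> CR \<Omega> \<T>'"
      and zm: "\<And>K x y. K \<in> \<T>' \<Longrightarrow> x \<in> vertices K \<Longrightarrow> y \<in> vertices K \<Longrightarrow> x \<noteq> y \<Longrightarrow>
        side_trace K z (midpoint x y) = segment_mean ?f x y"
      using CR_exists[OF dom conf(2), of "segment_mean ?f"] segment_mean_commute zero by metis
    have zw: "side_trace T w (midpoint x y) = side_mean \<T>' z x y"
      if T: "T \<in> \<T>" "x \<in> vertices T" "y \<in> vertices T" "x \<noteq> y" for T x y
    proof -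
      have "side_mean \<T>' z x y = segment_mean ?f x y"
      proof (rule side_values_agree[OF tree_refines_imp_coarser_eq[OF ref] conforming_tiling[OF conf(1)]
            side_mean_commute segment_mean_commute _ _ _ T])
        show "side_mean \<T>' z a b = (side_mean \<T>' z a (midpoint a b) + side_mean \<T>' z (midpoint a b) b) / 2"
          if "a \<noteq> b" "midpoint a b \<in> (\<Union>K\<in>\<T>'. vertices K)" for a b
          using side_mean_split[OF conf(2)] that by blast
        show "segment_mean ?f a b = (segment_mean ?f a (midpoint a b) + segment_mean ?f (midpoint a b) b) / 2"
          if "a \<noteq> b" "closed_segment a b \<subseteq> cover \<T>'" for a b
          using that cont cov by (intro segment_mean_split) (auto intro: continuous_on_subset)
        show "side_mean \<T>' z a b = segment_mean ?f a b"
          if "K \<in> \<T>'" "a \<in> vertices K" "b \<in> vertices K" "a \<noteq> b" for K a b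
          using side_mean_side[OF conf(2) z that] zm[OF that] by simp
      qed
      then show ?thesis
        using segment_mean_companion[OF conf(1) w T] by simp
    qed
    have "interpolates \<T> \<T>' z w"
      using zw by (simp add: interpolates_def)
    moreover have "(\<Sum>K\<in>\<T>'. area K * (norm (grad_on K z))\<^sup>2) \<le> C * (\<Sum>T\<in>\<T>. ?q T)"
    proof -
      have "(\<Sum>K\<in>\<T>'. area K * (norm (grad_on K z))\<^sup>2) = (\<Sum>T\<in>\<T>. \<Sum>K\<in>below \<T>' T. area K * (norm (grad_on K z))\<^sup>2)"
        by (rule sum_below[OF ref])
      also have "\<dots> \<le> (\<Sum>T\<in>\<T>. \<Sum>K\<in>below \<T>' T. 4 * \<sigma>\<^sup>2 * (L T)\<^sup>2 * area K)"
      proof (intro sum_mono)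
        fix T K assume T: "T \<in> \<T>" and "K \<in> below \<T>' T"
        then have K: "K \<in> \<T>'" "region K \<subseteq> region T"
          using desc_subset conformingD(2)[OF conf(1) T] by (auto simp: below_def)
        show "area K * (norm (grad_on K z))\<^sup>2 \<le> 4 * \<sigma>\<^sup>2 * (L T)\<^sup>2 * area K"
        proof (rule gradient_of_segment_means[where f = ?f and c = "fst (affine_rep K z)"])
          show "leg2 K \<le> \<sigma> * area K"
            using sh(2) K(1) by (simp add: shape_def)
          show "\<bar>?f v - ?f w\<bar> \<le> L T * dist v w" if "v \<in> region K" "w \<in> region K" for v w
            using Lip[OF T] that K(2) by blast
          show "fst (affine_rep K z) + grad_on K z \<bullet> midpoint x y = segment_mean ?f x y"
            if "x \<in> vertices K" "y \<in> vertices K" "x \<noteq> y" for x y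
            using zm[OF K(1) that] by (simp add: side_trace_def)
        qed (use \<sigma> L0[OF T] conformingD(2)[OF conf(2) K(1)] in auto)
      qed
      also have "\<dots> = (\<Sum>T\<in>\<T>. 4 * \<sigma>\<^sup>2 * (area T * (L T)\<^sup>2))"
        by (intro sum.cong refl) (simp add: sum_distrib_left[symmetric] sum_area_below[OF ref])
      also have "\<dots> = 4 * \<sigma>\<^sup>2 * (\<Sum>T\<in>\<T>. area T * (L T)\<^sup>2)"
        by (simp add: sum_distrib_left)
      also have "\<dots> \<le> 4 * \<sigma>\<^sup>2 * ((2 + A * (3 * N * (2 * \<sigma>))) * (\<Sum>T\<in>\<T>. ?q T))"
        using sumL by (intro mult_left_mono) auto
      finally show ?thesis
        by (simp add: C_def mult.assoc)
    qed
    ultimately show ?thesis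
      using z by blast
  qed
  ultimately show ?thesis
    by (intro exI[of _ C] conjI allI impI; (elim conjE)?)
qed

section \<open>Integrals over tilings\<close>

lemma integrable_lebesgue_AE:
  fixes F G :: "real^2 \<Rightarrow> real"
  assumes "integrable lebesgue F" "AE x in lebesgue. F x = G x"
  shows "integrable lebesgue G" "integral\<^sup>L lebesgue G = integral\<^sup>L lebesgue F"
proof -
  have m: "G \<in> borel_measurable lebesgue"
    by (rule borel_measurable_AE[OF borel_measurable_integrable[OF assms(1)] assms(2)])
  have eq: "AE x in lebesgue. G x = F x"
    using assms(2) by eventually_elim simp
  note mF = borel_measurable_integrable[OF assms(1)]
  show "integrable lebesgue G"
    using integrable_cong_AE[OF m mF eq] assms(1) by blast
  show "integral\<^sup>L lebesgue G = integral\<^sup>L lebesgue F"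
    by (rule integral_cong_AE[OF m mF eq])
qed

lemma lebesgue_on_eq:
  fixes F :: "real^2 \<Rightarrow> real"
  assumes "S \<in> sets lebesgue"
  shows "integrable (lebesgue_on S) F \<longleftrightarrow> integrable lebesgue (\<lambda>x. indicator S x * F x)"
    "(LINT x|lebesgue_on S. F x) = (LINT x|lebesgue. indicator S x * F x)"
  using assms by (simp_all add: integrable_restrict_space integral_restrict_space)

lemma region_sets: "proper_triangle T \<Longrightarrow> region T \<in> sets lebesgue"
  by (simp add: lmeasurable_region fmeasurableD)

lemma AE_interior_region: "AE x in lebesgue. x \<in> region T \<longrightarrow> x \<in> interior (region T)"
proof -
  have "AE x in lebesgue. x \<notin> frontier (region T)"
    using negligible_frontier_region by (intro AE_not_in) (simp add: negligible_iff_null_sets)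
  then show ?thesis
    using closure_subset[of "region T"] by (elim eventually_mono) (auto simp: frontier_def)
qed

lemma integral_region_cong:
  fixes F G :: "real^2 \<Rightarrow> real"
  assumes T: "proper_triangle T" and F: "integrable (lebesgue_on (region T)) F"
    and eq: "\<And>x. x \<in> interior (region T) \<Longrightarrow> F x = G x"
  shows "integrable (lebesgue_on (region T)) G" "(LINT x|lebesgue_on (region T). G x) = (LINT x|lebesgue_on (region T). F x)"
proof -
  have "AE x in lebesgue. indicator (region T) x * F x = indicator (region T) x * G x"
    using AE_interior_region[of T] by (elim eventually_mono) (auto simp: eq indicator_def)
  then show "integrable (lebesgue_on (region T)) G" "(LINT x|lebesgue_on (region T). G x) = (LINT x|lebesgue_on (region T). F x)"
    using integrable_lebesgue_AE[of "\<lambda>x. indicator (region T) x * F x" "\<lambda>x. indicator (region T) x * G x"] F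
    by (simp_all add: lebesgue_on_eq[OF region_sets[OF T]])
qed

lemma integral_region_const:
  assumes T: "proper_triangle T" and eq: "\<And>x. x \<in> interior (region T) \<Longrightarrow> F x = (c::real)"
  shows "integrable (lebesgue_on (region T)) F" "(LINT x|lebesgue_on (region T). F x) = area T * c"
proof -
  have fin: "finite_measure (lebesgue_on (region T))"
    by (rule finite_measure_lebesgue_on[OF lmeasurable_region[OF T]])
  have "integrable (lebesgue_on (region T)) (\<lambda>x. c)"
    by (rule finite_measure.integrable_const[OF fin])
  moreover have "(LINT x|lebesgue_on (region T). c) = area T * c"
    using region_sets[OF T] by (simp add: area_def measure_restrict_space space_restrict_space)
  ultimately show "integrable (lebesgue_on (region T)) F" "(LINT x|lebesgue_on (region T). F x) = area T * c"
    using integral_region_cong[OF T, of "\<lambda>x. c" F] eq by auto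
qed

text \<open>
  Equality up to a null set accommodates the domain, which does not contain its boundary.
\<close>

definition tiles :: "triangle set \<Rightarrow> (real^2) set \<Rightarrow> bool" where
  "tiles P S \<longleftrightarrow> tiling P \<and> S \<in> sets lebesgue \<and> (AE x in lebesgue. x \<in> S \<longleftrightarrow> x \<in> cover P)"

lemma tiles_indicator:
  assumes "tiles P S"
  shows "AE x in lebesgue. indicator S x = (\<Sum>T\<in>P. indicator (region T) x :: real)"
proof -
  have P: "tiling P" "finite P"
    using assms tilingD(1) by (auto simp: tiles_def)
  have "AE x in lebesgue. \<forall>T\<in>P. x \<in> region T \<longrightarrow> x \<in> interior (region T)"
    using P(2) AE_interior_region by (simp add: AE_finite_all)
  moreover have "AE x in lebesgue. x \<in> S \<longleftrightarrow> x \<in> cover P"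
    using assms by (simp add: tiles_def)
  ultimately show ?thesis
  proof eventually_elim
    case (elim x)
    show ?case
    proof (cases "x \<in> cover P")
      case True
      then obtain T where T: "T \<in> P" "x \<in> region T"
        by blast
      have "x \<notin> region K" if "K \<in> P - {T}" for K
        using elim(1) that T tilingD(3)[OF P(1) T(1), of K] by blast
      then have "(\<Sum>K\<in>P. indicator (region K) x :: real) = indicator (region T) x"
        using P(2) T(1) by (subst sum.remove[of _ T]) auto
      then show ?thesis
        using True T(2) elim(2) by simp
    next
      case False
      then show ?thesis
        using elim(2) by simp
    qed
  qed
qed

lemma integral_tiles:
  fixes F :: "real^2 \<Rightarrow> real"
  assumes tiles: "tiles P S" and F: "\<And>T. T \<in> P \<Longrightarrow> integrable (lebesgue_on (region T)) F"
  shows "integrable (lebesgue_on S) F" "(LINT x|lebesgue_on S. F x) = (\<Sum>T\<in>P. LINT x|lebesgue_on (region T). F x)"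
proof -
  have P: "tiling P" "finite P" and S: "S \<in> sets lebesgue"
    using assms tilingD(1) by (auto simp: tiles_def)
  have R: "region T \<in> sets lebesgue" if "T \<in> P" for T
    using tilingD(2)[OF P(1) that] by (rule region_sets)
  have i: "integrable lebesgue (\<lambda>x. indicator (region T) x * F x)" if "T \<in> P" for T
    using F[OF that] lebesgue_on_eq(1)[OF R[OF that]] by simp
  have AE: "AE x in lebesgue. (\<Sum>T\<in>P. indicator (region T) x * F x) = indicator S x * F x"
    using tiles_indicator[OF tiles] by eventually_elim (simp add: sum_distrib_right)
  have "integrable lebesgue (\<lambda>x. \<Sum>T\<in>P. indicator (region T) x * F x)"
    using i by (rule Bochner_Integration.integrable_sum)
  note int = integrable_lebesgue_AE[OF this AE]
  show "integrable (lebesgue_on S) F"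
    using int(1) by (simp add: lebesgue_on_eq[OF S])
  have "(LINT x|lebesgue_on S. F x) = (LINT x|lebesgue. (\<Sum>T\<in>P. indicator (region T) x * F x))"
    using int(2) by (simp add: lebesgue_on_eq[OF S])
  also have "\<dots> = (\<Sum>T\<in>P. (LINT x|lebesgue. indicator (region T) x * F x))"
    using i by (rule Bochner_Integration.integral_sum)
  also have "\<dots> = (\<Sum>T\<in>P. LINT x|lebesgue_on (region T). F x)"
    using lebesgue_on_eq(2)[OF R] by (intro sum.cong) auto
  finally show "(LINT x|lebesgue_on S. F x) = (\<Sum>T\<in>P. LINT x|lebesgue_on (region T). F x)" .
qed

lemma integrable_tile:
  fixes F :: "real^2 \<Rightarrow> real"
  assumes tiles: "tiles P S" and F: "integrable (lebesgue_on S) F" and T: "T \<in> P"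
  shows "integrable (lebesgue_on (region T)) F"
proof -
  have P: "tiling P" and S: "S \<in> sets lebesgue" and ae: "AE x in lebesgue. x \<in> S \<longleftrightarrow> x \<in> cover P"
    using tiles by (auto simp: tiles_def)
  have R: "region T \<in> sets lebesgue"
    using tilingD(2)[OF P T] by (rule region_sets)
  have "integrable lebesgue (\<lambda>x. indicator (region T) x *\<^sub>R (indicator S x * F x))"
    using F R by (intro integrable_mult_indicator) (auto simp: lebesgue_on_eq[OF S])
  moreover have "AE x in lebesgue. indicator (region T) x *\<^sub>R (indicator S x * F x) = indicator (region T) x * F x"
    using ae by eventually_elim (use T in \<open>auto simp: indicator_def\<close>)
  ultimately have "integrable lebesgue (\<lambda>x. indicator (region T) x * F x)"
    by (rule integrable_lebesgue_AE)
  then show ?thesis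
    by (simp add: lebesgue_on_eq[OF R])
qed

lemma integral_piecewise_const:
  assumes tiles: "tiles P S" and c: "\<And>T x. T \<in> P \<Longrightarrow> x \<in> interior (region T) \<Longrightarrow> F x = (c T :: real)"
  shows "integrable (lebesgue_on S) F" "(LINT x|lebesgue_on S. F x) = (\<Sum>T\<in>P. area T * c T)"
proof -
  have p: "proper_triangle T" if "T \<in> P" for T
    using tiles that tilingD(2) by (auto simp: tiles_def)
  have "integrable (lebesgue_on (region T)) F" "(LINT x|lebesgue_on (region T). F x) = area T * c T" if "T \<in> P" for T
    using integral_region_const[OF p[OF that], of F "c T"] c that by auto
  then show "integrable (lebesgue_on S) F" "(LINT x|lebesgue_on S. F x) = (\<Sum>T\<in>P. area T * c T)"
    using integral_tiles[OF tiles, of F] by auto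
qed

lemma tiles_domain:
  assumes dom: "polygonal_domain \<Omega>" and conf: "conforming_triangulation \<Omega> \<T>"
  shows "tiles \<T> \<Omega>"
proof -
  obtain \<F> where \<F>: "finite \<F>" "\<forall>S\<in>\<F>. \<exists>a b. a \<noteq> b \<and> S = closed_segment a b" "frontier \<Omega> = \<Union>\<F>" and op: "open \<Omega>"
    using dom by (auto simp: polygonal_domain_def)
  have "negligible (closed_segment a b)" for a b :: "real^2"
  proof -
    have "interior (closed_segment a b) = {}"
      by (simp add: interior_closed_segment_ge2)
    then show ?thesis
      by (simp add: negligible_convex_interior)
  qed
  then have "negligible (\<Union>\<F>)"
    using \<F> by (intro negligible_Union) auto
  then have "AE x in lebesgue. x \<notin> frontier \<Omega>"
    unfolding \<F>(3) by (intro AE_not_in) (simp add: negligible_iff_null_sets)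
  then have "AE x in lebesgue. x \<in> \<Omega> \<longleftrightarrow> x \<in> cover \<T>"
    unfolding conformingD(4)[OF conf]
    using op closure_subset[of \<Omega>] by (elim eventually_mono) (auto simp: frontier_def interior_open)
  then show ?thesis
    using conforming_tiling[OF conf] op by (simp add: tiles_def borel_open)
qed

lemma tiles_below:
  assumes ref: "tree_refines P Q" and T: "T \<in> P"
  shows "tiles (below Q T) (region T)"
proof -
  have "proper_triangle T" "tiling (below Q T)"
    using ref T tilingD(2) tiling_subset[of Q "below Q T"] by (auto simp: tree_refines_def below_def)
  then show ?thesis
    using cover_below[OF ref T] by (simp add: tiles_def region_sets)
qed

lemma indicator_sum_interior:
  fixes h :: "triangle \<Rightarrow> 'a::real_vector"
  assumes P: "tiling P" and T: "T \<in> P" "x \<in> interior (region T)"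
  shows "(\<Sum>K\<in>P. indicator (interior (region K)) x *\<^sub>R h K) = h T"
proof -
  have "x \<notin> interior (region K)" if "K \<in> P - {T}" for K
    using tilingD(3)[OF P T(1), of K] that T(2) by blast
  then show ?thesis
    using T tilingD(1)[OF P] by (subst sum.remove[of _ T]) auto
qed

lemma nc_grad_interior: "tiling P \<Longrightarrow> T \<in> P \<Longrightarrow> x \<in> interior (region T) \<Longrightarrow> nc_grad P v x = grad_on T v"
  by (simp add: nc_grad_def indicator_sum_interior)

lemma mesh_size_interior: "tiling P \<Longrightarrow> T \<in> P \<Longrightarrow> x \<in> interior (region T) \<Longrightarrow> mesh_size P x = sqrt (area T)"
  using indicator_sum_interior[of P T x "\<lambda>T. sqrt (area T)"] by (simp add: mesh_size_def area_def)

lemma L2_product: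
  fixes u v :: "real^2 \<Rightarrow> real"
  assumes "L2 \<Omega> u" "L2 \<Omega> v"
  shows "integrable (lebesgue_on \<Omega>) (\<lambda>x. u x * v x)" "integrable (lebesgue_on \<Omega>) (\<lambda>x. (u x)\<^sup>2)"
proof -
  have m [measurable]: "u \<in> borel_measurable (lebesgue_on \<Omega>)" "v \<in> borel_measurable (lebesgue_on \<Omega>)"
    and i: "integrable (lebesgue_on \<Omega>) (\<lambda>x. (u x)\<^sup>2)" "integrable (lebesgue_on \<Omega>) (\<lambda>x. (v x)\<^sup>2)"
    using assms by (auto simp: L2_def)
  show "integrable (lebesgue_on \<Omega>) (\<lambda>x. (u x)\<^sup>2)"
    by (rule i)
  show "integrable (lebesgue_on \<Omega>) (\<lambda>x. u x * v x)"
  proof (rule Bochner_Integration.integrable_bound)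
    show "integrable (lebesgue_on \<Omega>) (\<lambda>x. (u x)\<^sup>2 + (v x)\<^sup>2)"
      using i by simp
    have "\<bar>u x * v x\<bar> \<le> (u x)\<^sup>2 + (v x)\<^sup>2" for x
    proof -
      have "2 * \<bar>u x\<bar> * \<bar>v x\<bar> \<le> (u x)\<^sup>2 + (v x)\<^sup>2"
        using sum_squares_bound[of "\<bar>u x\<bar>" "\<bar>v x\<bar>"] by simp
      moreover have "0 \<le> \<bar>u x\<bar> * \<bar>v x\<bar>"
        by simp
      ultimately show ?thesis
        unfolding abs_mult by linarith
    qed
    then show "AE x in lebesgue_on \<Omega>. norm (u x * v x) \<le> norm ((u x)\<^sup>2 + (v x)\<^sup>2)"
      by simp
  qed measurable
qed

lemma L2_diff: "L2 \<Omega> u \<Longrightarrow> L2 \<Omega> v \<Longrightarrow> L2 \<Omega> (\<lambda>x. u x - v x)" for u v :: "real^2 \<Rightarrow> real"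
  using L2_add[of \<Omega> u "\<lambda>x. - v x"] L2_uminus[of \<Omega> v] by simp

lemma CR_L2: "v \<in> CR \<Omega> \<T> \<Longrightarrow> L2 \<Omega> v"
  by (simp add: CR_def)

section \<open>The generalised energy\<close>

definition source :: "(real^2 \<Rightarrow> real) \<Rightarrow> triangle \<Rightarrow> real" where
  "source f T = (LINT x|lebesgue_on (region T). (f x)\<^sup>2)"

lemma source_nonneg: "source f T \<ge> 0"
  by (simp add: source_def)

lemma CR_solution_eq:
  assumes dom: "polygonal_domain \<Omega>" and conf: "conforming_triangulation \<Omega> \<T>" and u: "CR_solution \<Omega> \<T> f u"
    and v: "v \<in> CR \<Omega> \<T>"
  shows "(\<Sum>T\<in>\<T>. area T * (grad_on T u \<bullet> grad_on T v)) = (LINT x|lebesgue_on \<Omega>. f x * v x)"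
proof -
  have "(LINT x|lebesgue_on \<Omega>. nc_grad \<T> u x \<bullet> nc_grad \<T> v x) = (\<Sum>T\<in>\<T>. area T * (grad_on T u \<bullet> grad_on T v))"
    by (rule integral_piecewise_const(2)[OF tiles_domain[OF dom conf]])
      (simp add: nc_grad_interior[OF conforming_tiling[OF conf]])
  then show ?thesis
    using u v by (simp add: CR_solution_def)
qed

lemma energy_eq:
  assumes dom: "polygonal_domain \<Omega>" and conf: "conforming_triangulation \<Omega> \<T>" and f: "L2 \<Omega> f"
    and u: "CR_solution \<Omega> \<T> f (u \<T>)"
  shows "generalised_energy \<Omega> \<gamma> f u \<T> =
    (\<Sum>T\<in>\<T>. area T * (norm (grad_on T (u \<T>)))\<^sup>2) / 2 + \<gamma> * (\<Sum>T\<in>\<T>. area T * source f T)"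
proof -
  note tiles = tiles_domain[OF dom conf]
  have til: "tiling \<T>"
    using conforming_tiling[OF conf] .
  have uCR: "u \<T> \<in> CR \<Omega> \<T>"
    using u by (simp add: CR_solution_def)
  define U where "U = (\<Sum>T\<in>\<T>. area T * (norm (grad_on T (u \<T>)))\<^sup>2)"
  have "(1/2) * (norm (nc_grad \<T> (u \<T>) x))\<^sup>2 = (1/2) * (norm (grad_on T (u \<T>)))\<^sup>2"
    if "T \<in> \<T>" "x \<in> interior (region T)" for T x
    using that by (simp add: nc_grad_interior[OF til])
  note half = integral_piecewise_const[OF tiles this]
  have "(LINT x|lebesgue_on \<Omega>. (1/2) * (norm (nc_grad \<T> (u \<T>) x))\<^sup>2 - f x * u \<T> x)
      = (\<Sum>T\<in>\<T>. area T * ((1/2) * (norm (grad_on T (u \<T>)))\<^sup>2)) - (LINT x|lebesgue_on \<Omega>. f x * u \<T> x)"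
    using L2_product(1)[OF f CR_L2[OF uCR]] half by simp
  also have "(LINT x|lebesgue_on \<Omega>. f x * u \<T> x) = U"
    using CR_solution_eq[OF dom conf u uCR] by (simp add: U_def power2_norm_eq_inner)
  also have "(\<Sum>T\<in>\<T>. area T * ((1/2) * (norm (grad_on T (u \<T>)))\<^sup>2)) = U / 2"
    by (simp add: U_def sum_divide_distrib)
  finally have energy: "(LINT x|lebesgue_on \<Omega>. (1/2) * (norm (nc_grad \<T> (u \<T>) x))\<^sup>2 - f x * u \<T> x) = - (U / 2)"
    by simp
  have piece: "integrable (lebesgue_on (region T)) (\<lambda>x. (norm (mesh_size \<T> x * f x))\<^sup>2)"
    "(LINT x|lebesgue_on (region T). (norm (mesh_size \<T> x * f x))\<^sup>2) = area T * source f T" if T: "T \<in> \<T>" for T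
  proof -
    have p: "proper_triangle T"
      using conformingD(2)[OF conf T] .
    have i: "integrable (lebesgue_on (region T)) (\<lambda>x. area T * (f x)\<^sup>2)"
      using integrable_tile[OF tiles L2_product(2)[OF f f] T] by simp
    have eq: "area T * (f x)\<^sup>2 = (norm (mesh_size \<T> x * f x))\<^sup>2" if "x \<in> interior (region T)" for x
      using mesh_size_interior[OF til T that] area_pos[OF p] by (simp add: power_mult_distrib)
    show "integrable (lebesgue_on (region T)) (\<lambda>x. (norm (mesh_size \<T> x * f x))\<^sup>2)"
      "(LINT x|lebesgue_on (region T). (norm (mesh_size \<T> x * f x))\<^sup>2) = area T * source f T"
      using integral_region_cong[OF p i eq] by (auto simp: source_def)
  qed
  have "(LINT x|lebesgue_on \<Omega>. (norm (mesh_size \<T> x * f x))\<^sup>2) = (\<Sum>T\<in>\<T>. area T * source f T)"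
    using integral_tiles(2)[OF tiles piece(1)] piece(2) by simp
  moreover have "(\<Sum>T\<in>\<T>. area T * source f T) \<ge> 0"
    by (intro sum_nonneg mult_nonneg_nonneg source_nonneg) (simp add: area_def)
  ultimately have "(L2_norm \<Omega> (\<lambda>x. mesh_size \<T> x * f x))\<^sup>2 = (\<Sum>T\<in>\<T>. area T * source f T)"
    by (simp add: L2_norm_def)
  then show ?thesis
    unfolding generalised_energy_def energy U_def by simp
qed

section \<open>Local interpolation errors\<close>

text \<open>
  The squared \<open>L2\<close> distance on \<open>T\<close> of the piecewise gradient of \<open>v\<close> from the constant \<open>g\<close>.
\<close>

definition gap :: "triangle set \<Rightarrow> triangle \<Rightarrow> (real^2 \<Rightarrow> real) \<Rightarrow> real^2 \<Rightarrow> real" where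
  "gap Q T v g = (\<Sum>K\<in>below Q T. area K * (norm (grad_on K v - g))\<^sup>2)"

lemma gap_nonneg: "gap Q T v g \<ge> 0"
  by (simp add: gap_def area_def sum_nonneg)

text \<open>The mean gradient is the best constant approximation (Pythagoras).\<close>

lemma gap_pythagoras:
  assumes ref: "tree_refines P Q" and T: "T \<in> P"
    and mean: "area T *\<^sub>R g = (\<Sum>K\<in>below Q T. area K *\<^sub>R grad_on K v)"
  shows "gap Q T v h = gap Q T v g + area T * (norm (g - h))\<^sup>2"
    and "(\<Sum>K\<in>below Q T. area K * (grad_on K v \<bullet> h)) = area T * (g \<bullet> h)"
    and "gap Q T v h = (\<Sum>K\<in>below Q T. area K * (norm (grad_on K v))\<^sup>2) - 2 * (area T * (g \<bullet> h)) + area T * (norm h)\<^sup>2"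
proof -
  have lin: "(\<Sum>K\<in>below Q T. area K * (grad_on K v \<bullet> h)) = area T * (g \<bullet> h)" for h
  proof -
    have "(\<Sum>K\<in>below Q T. area K * (grad_on K v \<bullet> h)) = (\<Sum>K\<in>below Q T. area K *\<^sub>R grad_on K v) \<bullet> h"
      by (simp add: inner_sum_left)
    then show ?thesis
      by (simp flip: mean)
  qed
  then show "(\<Sum>K\<in>below Q T. area K * (grad_on K v \<bullet> h)) = area T * (g \<bullet> h)" .
  have expand: "gap Q T v h = (\<Sum>K\<in>below Q T. area K * (norm (grad_on K v))\<^sup>2) - 2 * (area T * (g \<bullet> h)) + area T * (norm h)\<^sup>2" for h
  proof -
    have "area K * (norm (grad_on K v - h))\<^sup>2
        = area K * (norm (grad_on K v))\<^sup>2 - 2 * (area K * (grad_on K v \<bullet> h)) + area K * (norm h)\<^sup>2" for K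
      unfolding power2_norm_eq_inner by (simp add: inner_simps inner_commute algebra_simps)
    then have "gap Q T v h = (\<Sum>K\<in>below Q T. area K * (norm (grad_on K v))\<^sup>2)
        - 2 * (\<Sum>K\<in>below Q T. area K * (grad_on K v \<bullet> h)) + (\<Sum>K\<in>below Q T. area K) * (norm h)\<^sup>2"
      by (simp add: gap_def sum.distrib sum_subtractf sum_distrib_left sum_distrib_right)
    then show ?thesis
      by (simp add: lin sum_area_below[OF ref T])
  qed
  then show "gap Q T v h = (\<Sum>K\<in>below Q T. area K * (norm (grad_on K v))\<^sup>2) - 2 * (area T * (g \<bullet> h)) + area T * (norm h)\<^sup>2" .
  show "gap Q T v h = gap Q T v g + area T * (norm (g - h))\<^sup>2"
    unfolding expand[of h] expand[of g] power2_norm_eq_inner by (simp add: inner_simps inner_commute algebra_simps)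
qed

text \<open>
  The constant is the mean gradient of \<open>v\<close> on \<open>T\<close>, that is, the gradient of its interpolant. It is written
  in terms of \<open>v\<close> alone, so that the value is the same for every coarse triangulation that contains \<open>T\<close>.
\<close>

definition local_error :: "triangle set \<Rightarrow> (real^2 \<Rightarrow> real) \<Rightarrow> (real^2 \<Rightarrow> real) \<Rightarrow> triangle \<Rightarrow> real" where
  "local_error Q v f T =
     gap Q T v ((1 / area T) *\<^sub>R (\<Sum>K\<in>below Q T. area K *\<^sub>R grad_on K v)) + area T * source f T"

context
  fixes \<Omega> \<T>\<^sub>0 \<Lambda> \<T> \<T>'
  assumes dom: "polygonal_domain \<Omega>" and conf0: "conforming_triangulation \<Omega> \<T>\<^sub>0"
    and \<Lambda>: "\<Lambda> > 0" and est: "interpolation_estimate \<Omega> \<T>\<^sub>0 \<Lambda>"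
    and \<T>: "\<T> \<in> refinements \<Omega> \<T>\<^sub>0" and \<T>': "\<T>' \<in> refinements \<Omega> \<T>\<^sub>0"
    and coarser: "coarser_eq \<T> \<T>'"
begin

lemma conforming_pair: "conforming_triangulation \<Omega> \<T>" "conforming_triangulation \<Omega> \<T>'"
  using refinementsD(1)[OF conf0] \<T> \<T>' by auto

lemma tree_refines_pair: "tree_refines \<T> \<T>'"
  using coarser coarser_eq_iff_tree_refines[OF conforming_tiling[OF conforming_pair(1)]] by simp

lemma mean_gradient:
  assumes "v \<in> CR \<Omega> \<T>'" "interpolates \<T> \<T>' v w" "T \<in> \<T>"
  shows "area T *\<^sub>R grad_on T w = (\<Sum>K\<in>below \<T>' T. area K *\<^sub>R grad_on K v)"
  using assms by (intro area_grad_sum[OF conforming_pair tree_refines_pair]) (auto simp: interpolates_def)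

lemma local_interpolation_error:
  assumes v: "v \<in> CR \<Omega> \<T>'" and w: "w \<in> CR \<Omega> \<T>" "interpolates \<T> \<T>' v w" and T: "T \<in> \<T>"
  shows "(LINT x|lebesgue_on (region T). (v x - w x)\<^sup>2) \<le> area T * (\<Lambda>\<^sup>2 * gap \<T>' T v (grad_on T w))"
proof -
  have p: "proper_triangle T"
    using conformingD(2)[OF conforming_pair(1) T] .
  have til: "tiling \<T>" "tiling \<T>'"
    using conforming_tiling conforming_pair by auto
  have ar: "area T > 0"
    using area_pos[OF p] .
  have "interpolable \<Omega> \<T>\<^sub>0 \<T> v (nc_grad \<T>' v) (CR_side_integral \<T>' v)"
    by (rule interpolable.CR[OF \<T>' coarser v])
  moreover have "is_interpolant \<Omega> \<T> (CR_side_integral \<T>' v) w"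
    by (rule interpolates_is_interpolant[OF conforming_pair(1) w])
  ultimately have le: "L2_norm (region T) (\<lambda>x. inverse (mesh_size \<T> x) * (v x - w x))
      \<le> \<Lambda> * L2_norm (region T) (\<lambda>x. nc_grad \<T>' v x - nc_grad \<T> w x)"
    using est \<T> T unfolding interpolation_estimate_def by blast
  have "integrable (lebesgue_on \<Omega>) (\<lambda>x. (v x - w x)\<^sup>2)"
    using L2_product(2) L2_diff[OF CR_L2[OF v] CR_L2[OF w(1)]] by blast
  then have "integrable (lebesgue_on (region T)) (\<lambda>x. (v x - w x)\<^sup>2)"
    using integrable_tile[OF tiles_domain[OF dom conforming_pair(1)] _ T] by blast
  then have i: "integrable (lebesgue_on (region T)) (\<lambda>x. (v x - w x)\<^sup>2 / area T)"
    by simp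
  have "(v x - w x)\<^sup>2 / area T = (norm (inverse (mesh_size \<T> x) * (v x - w x)))\<^sup>2" if "x \<in> interior (region T)" for x
    using mesh_size_interior[OF til(1) T that] ar by (simp add: power_mult_distrib power_inverse divide_inverse)
  then have lhs: "(LINT x|lebesgue_on (region T). (norm (inverse (mesh_size \<T> x) * (v x - w x)))\<^sup>2)
      = (LINT x|lebesgue_on (region T). (v x - w x)\<^sup>2) / area T"
    using integral_region_cong(2)[OF p i] by simp
  have rhs: "(LINT x|lebesgue_on (region T). (norm (nc_grad \<T>' v x - nc_grad \<T> w x))\<^sup>2) = gap \<T>' T v (grad_on T w)"
    unfolding gap_def
  proof (rule integral_piecewise_const(2)[OF tiles_below[OF tree_refines_pair T]])
    fix K x assume K: "K \<in> below \<T>' T" "x \<in> interior (region K)"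
    then have "x \<in> interior (region T)"
      using desc_subset[of T K] p interior_mono by (auto simp: below_def)
    then show "(norm (nc_grad \<T>' v x - nc_grad \<T> w x))\<^sup>2 = (norm (grad_on K v - grad_on T w))\<^sup>2"
      using K nc_grad_interior[OF til(1) T] nc_grad_interior[OF til(2), of K x] by (simp add: below_def)
  qed
  have "sqrt ((LINT x|lebesgue_on (region T). (v x - w x)\<^sup>2) / area T) \<le> \<Lambda> * sqrt (gap \<T>' T v (grad_on T w))"
    using le by (simp only: L2_norm_def lhs rhs)
  then have "(sqrt ((LINT x|lebesgue_on (region T). (v x - w x)\<^sup>2) / area T))\<^sup>2 \<le> (\<Lambda> * sqrt (gap \<T>' T v (grad_on T w)))\<^sup>2"
    using ar by (intro power_mono) auto
  then have "(LINT x|lebesgue_on (region T). (v x - w x)\<^sup>2) / area T \<le> \<Lambda>\<^sup>2 * gap \<T>' T v (grad_on T w)"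
    using ar gap_nonneg by (simp add: power_mult_distrib)
  then show ?thesis
    using ar by (simp add: field_simps)
qed

lemma gap_leaf:
  assumes "v \<in> CR \<Omega> \<T>'" "interpolates \<T> \<T>' v w" "T \<in> \<T>" "T \<in> \<T>'"
  shows "gap \<T>' T v (grad_on T w) = 0"
proof -
  have b: "below \<T>' T = {T}"
    by (rule below_leaf[OF tree_refines_pair assms(3,4)])
  have "area T *\<^sub>R grad_on T w = area T *\<^sub>R grad_on T v"
    using mean_gradient[OF assms(1-3)] by (simp add: b)
  then show ?thesis
    using area_pos[OF conformingD(2)[OF conforming_pair(1) assms(3)]] by (simp add: gap_def b)
qed

text \<open>
  The consistency error: the load sees the difference between a function and its interpolant only on
  the refined triangles, where Young's inequality with weight \<open>\<delta>\<close> applies.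
\<close>

lemma load_error:
  assumes f: "L2 \<Omega> f" and v: "v \<in> CR \<Omega> \<T>'" and w: "w \<in> CR \<Omega> \<T>" "interpolates \<T> \<T>' v w" and \<delta>: "\<delta> > 0"
  shows "\<bar>LINT x|lebesgue_on \<Omega>. f x * (v x - w x)\<bar>
    \<le> (\<Sum>T\<in>\<T> - \<T>'. (\<delta> / 2) * (area T * source f T) + \<Lambda>\<^sup>2 / (2 * \<delta>) * gap \<T>' T v (grad_on T w))"
proof -
  note tiles = tiles_domain[OF dom conforming_pair(1)]
  let ?d = "\<lambda>x. v x - w x"
  have d: "L2 \<Omega> ?d"
    using L2_diff[OF CR_L2[OF v] CR_L2[OF w(1)]] .
  have fin: "finite \<T>"
    using conformingD(1)[OF conforming_pair(1)] .
  have int: "integrable (lebesgue_on (region T)) (\<lambda>x. f x * ?d x)" "integrable (lebesgue_on (region T)) (\<lambda>x. (f x)\<^sup>2)"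
    "integrable (lebesgue_on (region T)) (\<lambda>x. (?d x)\<^sup>2)" if "T \<in> \<T>" for T
    using integrable_tile[OF tiles _ that] L2_product[OF f d] L2_product(2)[OF d d] by auto
  have local: "\<bar>LINT x|lebesgue_on (region T). f x * ?d x\<bar>
      \<le> (\<delta> / 2) * (area T * source f T) + \<Lambda>\<^sup>2 / (2 * \<delta>) * gap \<T>' T v (grad_on T w)" if T: "T \<in> \<T>" for T
  proof -
    (* Scaling the weight by the area matches the factor area T in the interpolation estimate. *)
    define s where "s = \<delta> * area T"
    have s: "s > 0"
      using \<delta> area_pos[OF conformingD(2)[OF conforming_pair(1) T]] by (simp add: s_def)
    have young: "\<bar>f x * ?d x\<bar> \<le> (s / 2) * (f x)\<^sup>2 + (1 / (2 * s)) * (?d x)\<^sup>2" for x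
    proof -
      have "2 * s * (\<bar>f x\<bar> * \<bar>?d x\<bar>) \<le> s\<^sup>2 * (f x)\<^sup>2 + (?d x)\<^sup>2"
        using sum_squares_bound[of "s * \<bar>f x\<bar>" "\<bar>?d x\<bar>"] by (simp add: power_mult_distrib mult_ac)
      then have "\<bar>f x\<bar> * \<bar>?d x\<bar> \<le> (s\<^sup>2 * (f x)\<^sup>2 + (?d x)\<^sup>2) / (2 * s)"
        using s by (simp add: pos_le_divide_eq mult_ac)
      also have "\<dots> = (s / 2) * (f x)\<^sup>2 + (1 / (2 * s)) * (?d x)\<^sup>2"
        using s by (simp add: power2_eq_square field_simps)
      finally show ?thesis
        by (simp add: abs_mult)
    qed
    have "\<bar>LINT x|lebesgue_on (region T). f x * ?d x\<bar> \<le> (LINT x|lebesgue_on (region T). \<bar>f x * ?d x\<bar>)"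
      by (rule integral_abs_bound)
    also have "\<dots> \<le> (LINT x|lebesgue_on (region T). (s / 2) * (f x)\<^sup>2 + (1 / (2 * s)) * (?d x)\<^sup>2)"
      using young int[OF T] by (intro integral_mono integrable_abs Bochner_Integration.integrable_add integrable_mult_right) auto
    also have "\<dots> = (s / 2) * source f T + (1 / (2 * s)) * (LINT x|lebesgue_on (region T). (?d x)\<^sup>2)"
      using int[OF T] by (simp add: source_def)
    also have "\<dots> \<le> (s / 2) * source f T + (1 / (2 * s)) * (area T * (\<Lambda>\<^sup>2 * gap \<T>' T v (grad_on T w)))"
      using s local_interpolation_error[OF v w T] by (intro add_left_mono mult_left_mono) auto
    also have "\<dots> = (\<delta> / 2) * (area T * source f T) + \<Lambda>\<^sup>2 / (2 * \<delta>) * gap \<T>' T v (grad_on T w)"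
      using \<delta> area_pos[OF conformingD(2)[OF conforming_pair(1) T]] by (simp add: s_def field_simps)
    finally show ?thesis .
  qed
  have leaf: "(LINT x|lebesgue_on (region T). f x * ?d x) = 0" if T: "T \<in> \<T>" "T \<in> \<T>'" for T
  proof -
    have "(LINT x|lebesgue_on (region T). (?d x)\<^sup>2) \<le> 0"
      using local_interpolation_error[OF v w T(1)] gap_leaf[OF v w(2) T] by simp
    then have "(LINT x|lebesgue_on (region T). (?d x)\<^sup>2) = 0"
      by (intro antisym) auto
    then have "AE x in lebesgue_on (region T). (?d x)\<^sup>2 = 0"
      using integral_nonneg_eq_0_iff_AE[OF int(3)[OF T(1)]] by simp
    then have "AE x in lebesgue_on (region T). f x * ?d x = 0"
      by eventually_elim simp
    then show ?thesis
      by (rule integral_eq_zero_AE)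
  qed
  have "(LINT x|lebesgue_on \<Omega>. f x * ?d x) = (\<Sum>T\<in>\<T>. LINT x|lebesgue_on (region T). f x * ?d x)"
    by (rule integral_tiles(2)[OF tiles int(1)])
  also have "\<dots> = (\<Sum>T\<in>\<T> - \<T>'. LINT x|lebesgue_on (region T). f x * ?d x)"
    using fin leaf by (intro sum.mono_neutral_right) auto
  finally have "\<bar>LINT x|lebesgue_on \<Omega>. f x * ?d x\<bar> \<le> (\<Sum>T\<in>\<T> - \<T>'. \<bar>LINT x|lebesgue_on (region T). f x * ?d x\<bar>)"
    by simp
  also have "\<dots> \<le> (\<Sum>T\<in>\<T> - \<T>'. (\<delta> / 2) * (area T * source f T) + \<Lambda>\<^sup>2 / (2 * \<delta>) * gap \<T>' T v (grad_on T w))"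
    using local by (intro sum_mono) auto
  finally show ?thesis .
qed

text \<open>
  The leaves below a refined triangle have at most half its area.
\<close>

lemma load_reduction:
  assumes f: "L2 \<Omega> f"
  shows "(\<Sum>T\<in>\<T> - \<T>'. area T * source f T) / 2
      \<le> (\<Sum>T\<in>\<T>. area T * source f T) - (\<Sum>K\<in>\<T>'. area K * source f K)"
    and "(\<Sum>T\<in>\<T>. area T * source f T) - (\<Sum>K\<in>\<T>'. area K * source f K) \<le> (\<Sum>T\<in>\<T> - \<T>'. area T * source f T)"
proof -
  have fin: "finite \<T>"
    using conformingD(1)[OF conforming_pair(1)] .
  let ?h = "\<lambda>T. area T * source f T - (\<Sum>K\<in>below \<T>' T. area K * source f K)"
  have "(\<Sum>T\<in>\<T>. area T * source f T) - (\<Sum>K\<in>\<T>'. area K * source f K) = (\<Sum>T\<in>\<T>. ?h T)"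
    by (simp add: sum_below[OF tree_refines_pair, of "\<lambda>K. area K * source f K"] sum_subtractf)
  also have "\<dots> = (\<Sum>T\<in>\<T> - \<T>'. ?h T)"
    using fin below_leaf[OF tree_refines_pair] by (intro sum.mono_neutral_right) auto
  finally have eq: "(\<Sum>T\<in>\<T>. area T * source f T) - (\<Sum>K\<in>\<T>'. area K * source f K) = (\<Sum>T\<in>\<T> - \<T>'. ?h T)" .
  have nn: "area K * source f K \<ge> 0" for K
    by (simp add: area_def source_nonneg)
  have half: "area T * source f T / 2 \<le> ?h T" if T: "T \<in> \<T> - \<T>'" for T
  proof -
    have p: "proper_triangle T"
      using T conformingD(2)[OF conforming_pair(1)] by blast
    have i: "integrable (lebesgue_on (region T)) (\<lambda>x. (f x)\<^sup>2)"
      using integrable_tile[OF tiles_domain[OF dom conforming_pair(1)] L2_product(2)[OF f f]] T by blast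
    note tb = tiles_below[OF tree_refines_pair, of T]
    have "source f T = (\<Sum>K\<in>below \<T>' T. source f K)"
      unfolding source_def using T by (intro integral_tiles(2) tb integrable_tile[OF tb i]) auto
    then have "area T * source f T / 2 = (\<Sum>K\<in>below \<T>' T. (area T / 2) * source f K)"
      by (simp add: sum_distrib_left sum_divide_distrib)
    moreover have "(\<Sum>K\<in>below \<T>' T. area K * source f K) \<le> (\<Sum>K\<in>below \<T>' T. (area T / 2) * source f K)"
      using T p by (intro sum_mono mult_right_mono source_nonneg desc_area_half) (auto simp: below_def)
    ultimately show ?thesis
      by simp
  qed
  show "(\<Sum>T\<in>\<T> - \<T>'. area T * source f T) / 2
      \<le> (\<Sum>T\<in>\<T>. area T * source f T) - (\<Sum>K\<in>\<T>'. area K * source f K)"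
    unfolding eq sum_divide_distrib by (intro sum_mono half)
  show "(\<Sum>T\<in>\<T>. area T * source f T) - (\<Sum>K\<in>\<T>'. area K * source f K) \<le> (\<Sum>T\<in>\<T> - \<T>'. area T * source f T)"
    unfolding eq using nn by (intro sum_mono) (simp add: sum_nonneg)
qed

section \<open>Energy differences are local\<close>

context
  fixes f u v
  assumes f: "L2 \<Omega> f" and u: "CR_solution \<Omega> \<T> f u" and v: "CR_solution \<Omega> \<T>' f v"
begin

lemma uCR: "u \<in> CR \<Omega> \<T>" and vCR: "v \<in> CR \<Omega> \<T>'"
  using u v by (auto simp: CR_solution_def)

lemma sum_local_error:
  assumes "interpolates \<T> \<T>' v i"
  shows "(\<Sum>T\<in>\<T> - \<T>'. local_error \<T>' v f T)
    = (\<Sum>T\<in>\<T>. gap \<T>' T v (grad_on T i)) + (\<Sum>T\<in>\<T> - \<T>'. area T * source f T)"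
proof -
  have fin: "finite \<T>"
    using conformingD(1)[OF conforming_pair(1)] .
  have "local_error \<T>' v f T = gap \<T>' T v (grad_on T i) + area T * source f T" if T: "T \<in> \<T>" for T
    using area_pos[OF conformingD(2)[OF conforming_pair(1) T]]
    by (simp add: local_error_def mean_gradient[OF vCR assms T, symmetric])
  then have "(\<Sum>T\<in>\<T> - \<T>'. local_error \<T>' v f T)
      = (\<Sum>T\<in>\<T> - \<T>'. gap \<T>' T v (grad_on T i)) + (\<Sum>T\<in>\<T> - \<T>'. area T * source f T)"
    by (simp add: sum.distrib)
  also have "(\<Sum>T\<in>\<T> - \<T>'. gap \<T>' T v (grad_on T i)) = (\<Sum>T\<in>\<T>. gap \<T>' T v (grad_on T i))"
    using fin gap_leaf[OF vCR assms] by (intro sum.mono_neutral_left) auto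
  finally show ?thesis .
qed

text \<open>
  Expand the squared norm of the gradient of \<open>v - u\<close>. Since interpolation preserves mean gradients, its
  mixed term is that of \<open>i\<close> and \<open>u\<close>, to which the coarse discrete equation applies.
\<close>

lemma energy_identity:
  assumes i: "i \<in> CR \<Omega> \<T>" "interpolates \<T> \<T>' v i"
  shows "(\<Sum>T\<in>\<T>. area T * (norm (grad_on T u))\<^sup>2) - (\<Sum>K\<in>\<T>'. area K * (norm (grad_on K v))\<^sup>2)
    = (\<Sum>T\<in>\<T>. gap \<T>' T v (grad_on T i)) + (\<Sum>T\<in>\<T>. area T * (norm (grad_on T i - grad_on T u))\<^sup>2)
      - 2 * (LINT x|lebesgue_on \<Omega>. f x * (v x - i x))"
proof -
  let ?U = "\<Sum>T\<in>\<T>. area T * (norm (grad_on T u))\<^sup>2" and ?V = "\<Sum>K\<in>\<T>'. area K * (norm (grad_on K v))\<^sup>2"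
  have V: "?V = (LINT x|lebesgue_on \<Omega>. f x * v x)"
    using CR_solution_eq[OF dom conforming_pair(2) v vCR] by (simp add: power2_norm_eq_inner)
  have ui: "(\<Sum>T\<in>\<T>. area T * (grad_on T i \<bullet> grad_on T u)) = (LINT x|lebesgue_on \<Omega>. f x * i x)"
    using CR_solution_eq[OF dom conforming_pair(1) u i(1)] by (simp add: inner_commute)
  have "gap \<T>' T v (grad_on T i) + area T * (norm (grad_on T i - grad_on T u))\<^sup>2
      = (\<Sum>K\<in>below \<T>' T. area K * (norm (grad_on K v))\<^sup>2) - 2 * (area T * (grad_on T i \<bullet> grad_on T u))
        + area T * (norm (grad_on T u))\<^sup>2" if T: "T \<in> \<T>" for T
    using gap_pythagoras(1,3)[OF tree_refines_pair T mean_gradient[OF vCR i(2) T], of "grad_on T u"] by simp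
  then have "(\<Sum>T\<in>\<T>. gap \<T>' T v (grad_on T i) + area T * (norm (grad_on T i - grad_on T u))\<^sup>2)
      = (\<Sum>T\<in>\<T>. (\<Sum>K\<in>below \<T>' T. area K * (norm (grad_on K v))\<^sup>2) - 2 * (area T * (grad_on T i \<bullet> grad_on T u))
        + area T * (norm (grad_on T u))\<^sup>2)"
    by (rule sum.cong[OF refl])
  then have "(\<Sum>T\<in>\<T>. gap \<T>' T v (grad_on T i)) + (\<Sum>T\<in>\<T>. area T * (norm (grad_on T i - grad_on T u))\<^sup>2)
      = ?V - 2 * (\<Sum>T\<in>\<T>. area T * (grad_on T i \<bullet> grad_on T u)) + ?U"
    by (simp add: sum_below[OF tree_refines_pair] sum_subtractf sum_distrib_left sum.distrib)
  moreover have "(LINT x|lebesgue_on \<Omega>. f x * (v x - i x)) = (LINT x|lebesgue_on \<Omega>. f x * v x) - (LINT x|lebesgue_on \<Omega>. f x * i x)"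
    using L2_product(1)[OF f CR_L2[OF vCR]] L2_product(1)[OF f CR_L2[OF i(1)]]
    by (simp add: right_diff_distrib)
  ultimately show ?thesis
    by (simp add: V ui)
qed

text \<open>
  The nonconforming part of the error: \<open>w = i - u\<close> is tested in both discrete problems, in the finer
  one through the right inverse \<open>z\<close> of the interpolation.
\<close>

lemma interpolant_error:
  assumes i: "i \<in> CR \<Omega> \<T>" "interpolates \<T> \<T>' v i" and C: "C > 0"
    and z: "z \<in> CR \<Omega> \<T>'" "interpolates \<T> \<T>' z (\<lambda>x. i x - u x)"
    and stable: "(\<Sum>K\<in>\<T>'. area K * (norm (grad_on K z))\<^sup>2) \<le> C * (\<Sum>T\<in>\<T>. area T * (norm (grad_on T (\<lambda>x. i x - u x)))\<^sup>2)"
  shows "(\<Sum>T\<in>\<T>. area T * (norm (grad_on T i - grad_on T u))\<^sup>2)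
    \<le> 2 * C * (\<Sum>T\<in>\<T>. gap \<T>' T v (grad_on T i)) + 2 * C * \<Lambda>\<^sup>2 * (\<Sum>T\<in>\<T> - \<T>'. area T * source f T)"
proof -
  let ?w = "\<lambda>x. i x - u x"
  define E where "E = (\<Sum>T\<in>\<T>. gap \<T>' T v (grad_on T i))"
  define H where "H = (\<Sum>T\<in>\<T> - \<T>'. area T * source f T)"
  define W where "W = (\<Sum>T\<in>\<T>. area T * (norm (grad_on T ?w))\<^sup>2)"
  define Z where "Z = (\<Sum>T\<in>\<T>. gap \<T>' T z (grad_on T ?w))"
  have w: "?w \<in> CR \<Omega> \<T>" and gw: "\<And>T. T \<in> \<T> \<Longrightarrow> grad_on T ?w = grad_on T i - grad_on T u"
    using CR_diff[OF conforming_pair(1) i(1) uCR] by auto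
  have fin: "finite \<T>"
    using conformingD(1)[OF conforming_pair(1)] .
  have ar: "area T \<ge> 0" for T
    by (simp add: area_def)
  have Z: "Z \<le> C * W"
  proof -
    have "gap \<T>' T z (grad_on T ?w) \<le> (\<Sum>K\<in>below \<T>' T. area K * (norm (grad_on K z))\<^sup>2)" if T: "T \<in> \<T>" for T
      using gap_pythagoras(3)[OF tree_refines_pair T mean_gradient[OF z(1,2) T], of "grad_on T ?w"] ar[of T]
      by (simp add: power2_norm_eq_inner)
    then have "Z \<le> (\<Sum>T\<in>\<T>. \<Sum>K\<in>below \<T>' T. area K * (norm (grad_on K z))\<^sup>2)"
      unfolding Z_def by (rule sum_mono)
    also have "\<dots> = (\<Sum>K\<in>\<T>'. area K * (norm (grad_on K z))\<^sup>2)"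
      by (rule sum_below[OF tree_refines_pair, symmetric])
    finally show ?thesis
      using stable by (simp add: W_def)
  qed
  have iw: "(\<Sum>T\<in>\<T>. area T * (grad_on T i \<bullet> grad_on T ?w)) = (\<Sum>T\<in>\<T>. \<Sum>K\<in>below \<T>' T. area K * (grad_on K v \<bullet> grad_on T ?w))"
    using gap_pythagoras(2)[OF tree_refines_pair _ mean_gradient[OF vCR i(2)]] by simp
  have uw: "(\<Sum>T\<in>\<T>. area T * (grad_on T u \<bullet> grad_on T ?w)) = (LINT x|lebesgue_on \<Omega>. f x * ?w x)"
    by (rule CR_solution_eq[OF dom conforming_pair(1) u w])
  have vz: "(\<Sum>T\<in>\<T>. \<Sum>K\<in>below \<T>' T. area K * (grad_on K v \<bullet> grad_on K z)) = (LINT x|lebesgue_on \<Omega>. f x * z x)"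
    unfolding sum_below[OF tree_refines_pair, symmetric] by (rule CR_solution_eq[OF dom conforming_pair(2) v z(1)])
  have load: "(LINT x|lebesgue_on \<Omega>. f x * (z x - ?w x)) = (LINT x|lebesgue_on \<Omega>. f x * z x) - (LINT x|lebesgue_on \<Omega>. f x * ?w x)"
    using L2_product(1)[OF f CR_L2[OF z(1)]] L2_product(1)[OF f CR_L2[OF w]]
    by (simp add: right_diff_distrib[of "f _" "z _"])
  have "W = (\<Sum>T\<in>\<T>. area T * (grad_on T i \<bullet> grad_on T ?w)) - (\<Sum>T\<in>\<T>. area T * (grad_on T u \<bullet> grad_on T ?w))"
    unfolding W_def sum_subtractf[symmetric]
    by (intro sum.cong refl) (simp add: gw power2_norm_eq_inner inner_diff_left right_diff_distrib)
  also have "\<dots> = (\<Sum>T\<in>\<T>. \<Sum>K\<in>below \<T>' T. area K * (grad_on K v \<bullet> (grad_on T ?w - grad_on K z)))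
      + (LINT x|lebesgue_on \<Omega>. f x * (z x - ?w x))"
    unfolding iw uw load vz[symmetric] by (simp add: inner_diff_right right_diff_distrib sum_subtractf)
  finally have W: "W = (\<Sum>T\<in>\<T>. \<Sum>K\<in>below \<T>' T. area K * (grad_on K v \<bullet> (grad_on T ?w - grad_on K z)))
      + (LINT x|lebesgue_on \<Omega>. f x * (z x - ?w x))" .
  have first: "(\<Sum>K\<in>below \<T>' T. area K * (grad_on K v \<bullet> (grad_on T ?w - grad_on K z)))
      \<le> C * gap \<T>' T v (grad_on T i) + (1 / (4 * C)) * gap \<T>' T z (grad_on T ?w)" if T: "T \<in> \<T>" for T
  proof -
    have "(\<Sum>K\<in>below \<T>' T. area K * (grad_on T i \<bullet> (grad_on T ?w - grad_on K z)))
        = (\<Sum>K\<in>below \<T>' T. area K) * (grad_on T i \<bullet> grad_on T ?w) - (\<Sum>K\<in>below \<T>' T. area K * (grad_on K z \<bullet> grad_on T i))"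
      by (simp add: inner_diff_right right_diff_distrib sum_subtractf sum_distrib_right inner_commute)
    also have "\<dots> = 0"
      using gap_pythagoras(2)[OF tree_refines_pair T mean_gradient[OF z(1,2) T], of "grad_on T i"]
      by (simp add: sum_area_below[OF tree_refines_pair T] inner_commute)
    finally have "(\<Sum>K\<in>below \<T>' T. area K * (grad_on K v \<bullet> (grad_on T ?w - grad_on K z)))
        = (\<Sum>K\<in>below \<T>' T. area K * ((grad_on K v - grad_on T i) \<bullet> (grad_on T ?w - grad_on K z)))"
      by (simp add: inner_diff_left[of "grad_on _ v"] right_diff_distrib[of "area _"] sum_subtractf)
    also have "\<dots> \<le> (\<Sum>K\<in>below \<T>' T. area K * (C * (norm (grad_on K v - grad_on T i))\<^sup>2
        + (1 / (4 * C)) * (norm (grad_on K z - grad_on T ?w))\<^sup>2))"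
    proof (intro sum_mono mult_left_mono ar)
      fix K
      let ?a = "grad_on K v - grad_on T i" and ?b = "grad_on T ?w - grad_on K z"
      (* Young's inequality; the weight makes the second part at most W / 4 after summation. *)
      have "4 * C * (?a \<bullet> ?b) \<le> 2 * (2 * C * norm ?a) * norm ?b"
        using C norm_cauchy_schwarz[of ?a ?b] by simp
      also have "\<dots> \<le> (2 * C * norm ?a)\<^sup>2 + (norm ?b)\<^sup>2"
        by (rule sum_squares_bound)
      finally have "?a \<bullet> ?b \<le> ((2 * C * norm ?a)\<^sup>2 + (norm ?b)\<^sup>2) / (4 * C)"
        using C by (simp add: pos_le_divide_eq mult_ac)
      also have "\<dots> = C * (norm ?a)\<^sup>2 + (1 / (4 * C)) * (norm ?b)\<^sup>2"
        using C by (simp add: power2_eq_square field_simps)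
      finally show "?a \<bullet> ?b \<le> C * (norm ?a)\<^sup>2 + (1 / (4 * C)) * (norm (grad_on K z - grad_on T ?w))\<^sup>2"
        by (simp add: norm_minus_commute)
    qed
    also have "\<dots> = C * gap \<T>' T v (grad_on T i) + (1 / (4 * C)) * gap \<T>' T z (grad_on T ?w)"
      by (simp add: gap_def distrib_left sum.distrib sum_distrib_left mult_ac)
    finally show ?thesis .
  qed
  then have "(\<Sum>T\<in>\<T>. \<Sum>K\<in>below \<T>' T. area K * (grad_on K v \<bullet> (grad_on T ?w - grad_on K z)))
      \<le> (\<Sum>T\<in>\<T>. C * gap \<T>' T v (grad_on T i) + (1 / (4 * C)) * gap \<T>' T z (grad_on T ?w))"
    by (rule sum_mono)
  also have "\<dots> = C * E + (1 / (4 * C)) * Z"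
    by (simp add: E_def Z_def sum.distrib sum_distrib_left)
  finally have one: "(\<Sum>T\<in>\<T>. \<Sum>K\<in>below \<T>' T. area K * (grad_on K v \<bullet> (grad_on T ?w - grad_on K z))) \<le> C * E + (1 / (4 * C)) * Z" .
  (* The weight 2 C \<Lambda>^2 again leaves the factor 1 / (4 C) in front of Z. *)
  have "\<bar>LINT x|lebesgue_on \<Omega>. f x * (z x - ?w x)\<bar>
      \<le> (\<Sum>T\<in>\<T> - \<T>'. (2 * C * \<Lambda>\<^sup>2 / 2) * (area T * source f T) + \<Lambda>\<^sup>2 / (2 * (2 * C * \<Lambda>\<^sup>2)) * gap \<T>' T z (grad_on T ?w))"
    using C \<Lambda> by (intro load_error[OF f z(1) w z(2)]) auto
  also have "\<dots> = C * \<Lambda>\<^sup>2 * H + (1 / (4 * C)) * (\<Sum>T\<in>\<T> - \<T>'. gap \<T>' T z (grad_on T ?w))"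
    using \<Lambda> by (simp add: H_def sum.distrib sum_distrib_left mult_ac)
  also have "\<dots> \<le> C * \<Lambda>\<^sup>2 * H + (1 / (4 * C)) * Z"
    unfolding Z_def using C fin gap_nonneg by (intro add_left_mono mult_left_mono sum_mono2) auto
  finally have two: "(LINT x|lebesgue_on \<Omega>. f x * (z x - ?w x)) \<le> C * \<Lambda>\<^sup>2 * H + (1 / (4 * C)) * Z"
    by linarith
  have "(1 / (4 * C)) * Z \<le> W / 4"
    using Z C by (simp add: field_simps)
  then have "W \<le> 2 * C * E + 2 * C * \<Lambda>\<^sup>2 * H"
    using W one two by linarith
  then show ?thesis
    by (simp add: W_def E_def H_def gw)
qed

text \<open>
  In \<open>load_error\<close> the weight \<open>2 \<Lambda>\<^sup>2\<close> leaves the factor \<open>1/4\<close> on the gradient part, which the energy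
  identity absorbs, and the factor \<open>\<Lambda>\<^sup>2\<close> on the load part, which is below \<open>\<gamma> / 2\<close>.
\<close>

lemma energy_difference_bounds:
  assumes i: "i \<in> CR \<Omega> \<T>" "interpolates \<T> \<T>' v i" and C: "C > 0"
    and W: "(\<Sum>T\<in>\<T>. area T * (norm (grad_on T i - grad_on T u))\<^sup>2)
      \<le> 2 * C * (\<Sum>T\<in>\<T>. gap \<T>' T v (grad_on T i)) + 2 * C * \<Lambda>\<^sup>2 * (\<Sum>T\<in>\<T> - \<T>'. area T * source f T)"
    and \<gamma>: "\<gamma> > 2 * \<Lambda>\<^sup>2" and un: "un \<T> = u" "un \<T>' = v"
  shows "min (1/4) (\<gamma> / 2 - \<Lambda>\<^sup>2) * (\<Sum>T\<in>\<T> - \<T>'. local_error \<T>' v f T)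
      \<le> generalised_energy \<Omega> \<gamma> f un \<T> - generalised_energy \<Omega> \<gamma> f un \<T>'"
    and "generalised_energy \<Omega> \<gamma> f un \<T> - generalised_energy \<Omega> \<gamma> f un \<T>'
      \<le> (1 + C + C * \<Lambda>\<^sup>2 + \<Lambda>\<^sup>2 + \<gamma>) * (\<Sum>T\<in>\<T> - \<T>'. local_error \<T>' v f T)"
proof -
  define E where "E = (\<Sum>T\<in>\<T>. gap \<T>' T v (grad_on T i))"
  define H where "H = (\<Sum>T\<in>\<T> - \<T>'. area T * source f T)"
  define Wn where "Wn = (\<Sum>T\<in>\<T>. area T * (norm (grad_on T i - grad_on T u))\<^sup>2)"
  define D where "D = (\<Sum>T\<in>\<T>. area T * source f T) - (\<Sum>K\<in>\<T>'. area K * source f K)"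
  define I where "I = (LINT x|lebesgue_on \<Omega>. f x * (v x - i x))"
  have fin: "finite \<T>"
    using conformingD(1)[OF conforming_pair(1)] .
  have nn: "E \<ge> 0" "H \<ge> 0" "Wn \<ge> 0"
    by (auto simp: E_def H_def Wn_def area_def intro!: sum_nonneg gap_nonneg source_nonneg mult_nonneg_nonneg)
  have G: "generalised_energy \<Omega> \<gamma> f un \<T> - generalised_energy \<Omega> \<gamma> f un \<T>' = E / 2 + Wn / 2 - I + \<gamma> * D"
  proof -
    have "generalised_energy \<Omega> \<gamma> f un \<T> - generalised_energy \<Omega> \<gamma> f un \<T>'
        = ((\<Sum>T\<in>\<T>. area T * (norm (grad_on T u))\<^sup>2) - (\<Sum>K\<in>\<T>'. area K * (norm (grad_on K v))\<^sup>2)) / 2 + \<gamma> * D"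
      using u v by (simp add: energy_eq[OF dom conforming_pair(1) f] energy_eq[OF dom conforming_pair(2) f] un D_def diff_divide_distrib right_diff_distrib)
    also have "\<dots> = (E + Wn - 2 * I) / 2 + \<gamma> * D"
      unfolding energy_identity[OF i] E_def Wn_def I_def ..
    finally show ?thesis
      by (simp add: diff_divide_distrib add_divide_distrib)
  qed
  have "\<bar>I\<bar> \<le> (\<Sum>T\<in>\<T> - \<T>'. (2 * \<Lambda>\<^sup>2 / 2) * (area T * source f T) + \<Lambda>\<^sup>2 / (2 * (2 * \<Lambda>\<^sup>2)) * gap \<T>' T v (grad_on T i))"
    unfolding I_def using \<Lambda> by (intro load_error[OF f vCR i]) auto
  also have "\<dots> = \<Lambda>\<^sup>2 * H + (1/4) * (\<Sum>T\<in>\<T> - \<T>'. gap \<T>' T v (grad_on T i))"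
    using \<Lambda> by (simp add: H_def sum.distrib sum_distrib_left)
  also have "\<dots> \<le> \<Lambda>\<^sup>2 * H + (1/4) * E"
    unfolding E_def using fin gap_nonneg by (intro add_left_mono mult_left_mono sum_mono2) auto
  finally have I: "\<bar>I\<bar> \<le> \<Lambda>\<^sup>2 * H + E / 4"
    by simp
  have D: "H / 2 \<le> D" "D \<le> H"
    using load_reduction[OF f] by (auto simp: H_def D_def)
  have \<gamma>0: "\<gamma> > 0"
    using \<gamma> zero_le_power2[of \<Lambda>] by linarith
  have X: "(\<Sum>T\<in>\<T> - \<T>'. local_error \<T>' v f T) = E + H"
    unfolding E_def H_def by (rule sum_local_error[OF i(2)])
  have gD: "\<gamma> * (H / 2) \<le> \<gamma> * D" "\<gamma> * D \<le> \<gamma> * H"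
    using D \<gamma>0 by (auto intro: mult_left_mono)
  let ?c = "min (1/4) (\<gamma> / 2 - \<Lambda>\<^sup>2)"
  have "?c * E \<le> (1/4) * E" "?c * H \<le> (\<gamma> / 2 - \<Lambda>\<^sup>2) * H"
    using mult_right_mono[OF min.cobounded1 nn(1)] mult_right_mono[OF min.cobounded2 nn(2)] by blast+
  then have "?c * (E + H) \<le> E / 4 + (\<gamma> / 2 - \<Lambda>\<^sup>2) * H"
    unfolding distrib_left by linarith
  also have "\<dots> = E / 4 + \<gamma> * (H / 2) - \<Lambda>\<^sup>2 * H"
    by (simp add: algebra_simps)
  also have "\<dots> \<le> E / 2 + Wn / 2 - I + \<gamma> * D"
    using I gD(1) nn by linarith
  finally show "?c * (\<Sum>T\<in>\<T> - \<T>'. local_error \<T>' v f T)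
      \<le> generalised_energy \<Omega> \<gamma> f un \<T> - generalised_energy \<Omega> \<gamma> f un \<T>'"
    unfolding X G .
  have W': "Wn \<le> 2 * (C * E) + 2 * (C * \<Lambda>\<^sup>2 * H)"
    using W by (simp add: Wn_def E_def H_def mult.assoc)
  have "E / 2 + Wn / 2 - I + \<gamma> * D \<le> E + C * E + C * \<Lambda>\<^sup>2 * H + \<Lambda>\<^sup>2 * H + \<gamma> * H"
    using I gD(2) W' nn by linarith
  also have "\<dots> \<le> (1 + C + C * \<Lambda>\<^sup>2 + \<Lambda>\<^sup>2 + \<gamma>) * (E + H)"
  proof -
    have "0 \<le> (C * \<Lambda>\<^sup>2 + \<Lambda>\<^sup>2 + \<gamma>) * E" "0 \<le> (1 + C) * H"
      using nn C \<gamma>0 by (auto intro!: mult_nonneg_nonneg add_nonneg_nonneg)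
    then show ?thesis
      by (simp add: algebra_simps)
  qed
  finally show "generalised_energy \<Omega> \<gamma> f un \<T> - generalised_energy \<Omega> \<gamma> f un \<T>'
      \<le> (1 + C + C * \<Lambda>\<^sup>2 + \<Lambda>\<^sup>2 + \<gamma>) * (\<Sum>T\<in>\<T> - \<T>'. local_error \<T>' v f T)"
    unfolding X G .
qed

end

end

theorem energy_difference_local:
  assumes dom: "polygonal_domain \<Omega>" and conf0: "conforming_triangulation \<Omega> \<T>\<^sub>0"
    and \<Lambda>: "\<Lambda> > 0" and est: "interpolation_estimate \<Omega> \<T>\<^sub>0 \<Lambda>" and \<gamma>: "\<gamma> > 2 * \<Lambda>\<^sup>2"
  shows "\<exists>c1>0. \<exists>c2>0. \<forall>\<T> \<T>' f u. \<T> \<in> refinements \<Omega> \<T>\<^sub>0 \<and> \<T>' \<in> refinements \<Omega> \<T>\<^sub>0 \<and>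
    coarser_eq \<T> \<T>' \<and> L2 \<Omega> f \<and> CR_solution \<Omega> \<T> f (u \<T>) \<and> CR_solution \<Omega> \<T>' f (u \<T>') \<longrightarrow>
    c1 * (\<Sum>T\<in>\<T> - \<T>'. local_error \<T>' (u \<T>') f T)
      \<le> generalised_energy \<Omega> \<gamma> f u \<T> - generalised_energy \<Omega> \<gamma> f u \<T>' \<and>
    generalised_energy \<Omega> \<gamma> f u \<T> - generalised_energy \<Omega> \<gamma> f u \<T>'
      \<le> c2 * (\<Sum>T\<in>\<T> - \<T>'. local_error \<T>' (u \<T>') f T)"
proof -
  obtain \<sigma> where \<sigma>: "\<sigma> > 0" "\<And>Q. tree_refines \<T>\<^sub>0 Q \<Longrightarrow> shape \<sigma> Q"
    using shape_refinements[OF conforming_tiling[OF conf0]] by blast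
  obtain C where C: "C > 0" and inverse: "\<forall>\<Omega> \<T> \<T>' w. polygonal_domain \<Omega> \<and>
    conforming_triangulation \<Omega> \<T> \<and> conforming_triangulation \<Omega> \<T>' \<and> shape \<sigma> \<T> \<and> shape \<sigma> \<T>' \<and>
    tree_refines \<T> \<T>' \<and> w \<in> CR \<Omega> \<T> \<longrightarrow>
    (\<exists>z\<in>CR \<Omega> \<T>'. interpolates \<T> \<T>' z w \<and>
      (\<Sum>K\<in>\<T>'. area K * (norm (grad_on K z))\<^sup>2) \<le> C * (\<Sum>T\<in>\<T>. area T * (norm (grad_on T w))\<^sup>2))"
    using stable_right_inverse[OF \<sigma>(1)] by blast
  let ?c1 = "min (1/4) (\<gamma> / 2 - \<Lambda>\<^sup>2)" and ?c2 = "1 + C + C * \<Lambda>\<^sup>2 + \<Lambda>\<^sup>2 + \<gamma>"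
  show ?thesis
  proof (rule exI[of _ ?c1], intro conjI, goal_cases)
    case 1
    show ?case
      using \<gamma> by simp
  next
    case 2
    show ?case
    proof (rule exI[of _ ?c2], intro conjI allI impI; (elim conjE)?)
    have "\<gamma> > 0"
      using \<gamma> zero_le_power2[of \<Lambda>] by linarith
    then show "?c2 > 0"
      using C by (intro add_nonneg_pos add_nonneg_nonneg) auto
    fix \<T> \<T>' f u
    assume T: "\<T> \<in> refinements \<Omega> \<T>\<^sub>0" "\<T>' \<in> refinements \<Omega> \<T>\<^sub>0" "coarser_eq \<T> \<T>'"
      and f: "L2 \<Omega> f" and u: "CR_solution \<Omega> \<T> f (u \<T>)" "CR_solution \<Omega> \<T>' f (u \<T>')"
    note ctx = dom conf0 \<Lambda> est T f u
    have conf: "conforming_triangulation \<Omega> \<T>" "conforming_triangulation \<Omega> \<T>'"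
      and sh: "shape \<sigma> \<T>" "shape \<sigma> \<T>'"
      using refinementsD[OF conf0] T(1,2) \<sigma>(2) by auto
    have ref: "tree_refines \<T> \<T>'"
      using T(3) coarser_eq_iff_tree_refines[OF conforming_tiling[OF conf(1)]] by simp
    have CR: "u \<T> \<in> CR \<Omega> \<T>" "u \<T>' \<in> CR \<Omega> \<T>'"
      using u by (auto simp: CR_solution_def)
    obtain i where i: "i \<in> CR \<Omega> \<T>" "interpolates \<T> \<T>' (u \<T>') i"
      using interpolant_exists[OF dom conf CR(2)] by blast
    obtain z where z: "z \<in> CR \<Omega> \<T>'" "interpolates \<T> \<T>' z (\<lambda>x. i x - u \<T> x)"
      and st: "(\<Sum>K\<in>\<T>'. area K * (norm (grad_on K z))\<^sup>2) \<le> C * (\<Sum>T\<in>\<T>. area T * (norm (grad_on T (\<lambda>x. i x - u \<T> x)))\<^sup>2)"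
      using inverse dom conf sh ref CR_diff(1)[OF conf(1) i(1) CR(1)] by blast
    note W = interpolant_error[OF ctx i C z st]
    show "?c1 * (\<Sum>T\<in>\<T> - \<T>'. local_error \<T>' (u \<T>') f T)
        \<le> generalised_energy \<Omega> \<gamma> f u \<T> - generalised_energy \<Omega> \<gamma> f u \<T>'"
      by (rule energy_difference_bounds(1)[OF ctx i C W \<gamma> refl refl])
    show "generalised_energy \<Omega> \<gamma> f u \<T> - generalised_energy \<Omega> \<gamma> f u \<T>'
        \<le> ?c2 * (\<Sum>T\<in>\<T> - \<T>'. local_error \<T>' (u \<T>') f T)"
      by (rule energy_difference_bounds(2)[OF ctx i C W \<gamma> refl refl])
    qed
  qed
qed

section \<open>The lower diamond estimate\<close>

theorem theorem3p9:
  fixes \<Omega> :: "(real^2) set" and \<T>\<^sub>0 :: "triangle set" and \<Lambda> \<gamma> :: real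
  assumes "polygonal_domain \<Omega>"
    and "conforming_triangulation \<Omega> \<T>\<^sub>0"
    and "matching \<T>\<^sub>0"
    and "\<Lambda> > 0"
    and "interpolation_estimate \<Omega> \<T>\<^sub>0 \<Lambda>"
    and "\<gamma> > 2 * \<Lambda>\<^sup>2"
  shows "\<exists>c>0. \<forall>f u.
    L2 \<Omega> f \<longrightarrow>
    (\<forall>\<T>\<in>refinements \<Omega> \<T>\<^sub>0. CR_solution \<Omega> \<T> f (u \<T>)) \<longrightarrow>
    (\<forall>m\<ge>1. \<forall>\<M> \<J> \<T>s. lower_diamond (refinements \<Omega> \<T>\<^sub>0) m \<M> \<J> \<T>s \<longrightarrow>
      (let \<G> = generalised_energy \<Omega> \<gamma> f u;
           A = \<G> \<M> - \<G> \<J>;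
           B = (\<Sum>j=1..m. (\<G> (\<T>s j) - \<G> \<J>))
       in inverse c * A \<le> B \<and> B \<le> c * A))"
proof -
  obtain c1 c2 where c: "c1 > 0" "c2 > 0" and local: "\<forall>\<T> \<T>' f u. \<T> \<in> refinements \<Omega> \<T>\<^sub>0 \<and> \<T>' \<in> refinements \<Omega> \<T>\<^sub>0 \<and>
    coarser_eq \<T> \<T>' \<and> L2 \<Omega> f \<and> CR_solution \<Omega> \<T> f (u \<T>) \<and> CR_solution \<Omega> \<T>' f (u \<T>') \<longrightarrow>
    c1 * (\<Sum>T\<in>\<T> - \<T>'. local_error \<T>' (u \<T>') f T)
      \<le> generalised_energy \<Omega> \<gamma> f u \<T> - generalised_energy \<Omega> \<gamma> f u \<T>' \<and>
    generalised_energy \<Omega> \<gamma> f u \<T> - generalised_energy \<Omega> \<gamma> f u \<T>'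
      \<le> c2 * (\<Sum>T\<in>\<T> - \<T>'. local_error \<T>' (u \<T>') f T)"
    using energy_difference_local[OF assms(1,2,4,5,6)] by blast
  have "inverse (c2 / c1) * (generalised_energy \<Omega> \<gamma> f u \<M> - generalised_energy \<Omega> \<gamma> f u \<J>)
        \<le> (\<Sum>j=1..m. (generalised_energy \<Omega> \<gamma> f u (\<T>s j) - generalised_energy \<Omega> \<gamma> f u \<J>)) \<and>
      (\<Sum>j=1..m. (generalised_energy \<Omega> \<gamma> f u (\<T>s j) - generalised_energy \<Omega> \<gamma> f u \<J>))
        \<le> (c2 / c1) * (generalised_energy \<Omega> \<gamma> f u \<M> - generalised_energy \<Omega> \<gamma> f u \<J>)"
    if f: "L2 \<Omega> f" and u: "\<forall>\<T>\<in>refinements \<Omega> \<T>\<^sub>0. CR_solution \<Omega> \<T> f (u \<T>)"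
      and m: "m \<ge> 1" and dia: "lower_diamond (refinements \<Omega> \<T>\<^sub>0) m \<M> \<J> \<T>s" for f u m \<M> \<J> \<T>s
  proof -
    let ?G = "generalised_energy \<Omega> \<gamma> f u"
    define X where "X \<T> = (\<Sum>T\<in>\<T> - \<J>. local_error \<J> (u \<J>) f T)" for \<T>
    have in_ref: "\<And>j. j \<in> {1..m} \<Longrightarrow> \<T>s j \<in> refinements \<Omega> \<T>\<^sub>0" "\<M> \<in> refinements \<Omega> \<T>\<^sub>0" "\<J> \<in> refinements \<Omega> \<T>\<^sub>0"
      and le: "\<And>j. j \<in> {1..m} \<Longrightarrow> coarser_eq \<M> (\<T>s j)" "\<And>j. j \<in> {1..m} \<Longrightarrow> coarser_eq (\<T>s j) \<J>"
      using dia by (auto simp: lower_diamond_def is_meet_def is_join_def)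
    have "coarser_eq \<M> \<J>"
      using le[of 1] m coarser_eq_trans by auto
    then have MJ: "c1 * X \<M> \<le> ?G \<M> - ?G \<J>" "?G \<M> - ?G \<J> \<le> c2 * X \<M>"
      using local[rule_format, of \<M> \<J> f u] in_ref f u by (auto simp: X_def)
    have TJ: "c1 * X (\<T>s j) \<le> ?G (\<T>s j) - ?G \<J>" "?G (\<T>s j) - ?G \<J> \<le> c2 * X (\<T>s j)" if "j \<in> {1..m}" for j
      using local[rule_format, of "\<T>s j" \<J> f u] in_ref le(2) f u that by (auto simp: X_def)
    have fin: "finite (\<T>s j - \<J>)" if "j \<in> {1..m}" for j
      using conformingD(1) in_ref(1)[OF that] refinementsD(1)[OF assms(2)] by blast
    have "X \<M> = (\<Sum>j\<in>{1..m}. X (\<T>s j))"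
      unfolding X_def lower_diamond_partition(1)[OF assms(2) m dia]
      using fin lower_diamond_partition(2)[OF assms(2) m dia]
      by (intro sum.UNION_disjoint) (auto simp: disjoint_family_on_def)
    then have "c1 * X \<M> \<le> (\<Sum>j=1..m. (?G (\<T>s j) - ?G \<J>))" "(\<Sum>j=1..m. (?G (\<T>s j) - ?G \<J>)) \<le> c2 * X \<M>"
      using TJ by (auto simp: sum_distrib_left intro!: sum_mono)
    note B = this
    have "(c1 / c2) * (?G \<M> - ?G \<J>) \<le> (c1 / c2) * (c2 * X \<M>)"
      using MJ(2) c by (intro mult_left_mono) auto
    also have "\<dots> \<le> (\<Sum>j=1..m. (?G (\<T>s j) - ?G \<J>))"
      using B(1) c by simp
    finally have lower: "(c1 / c2) * (?G \<M> - ?G \<J>) \<le> (\<Sum>j=1..m. (?G (\<T>s j) - ?G \<J>))" .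
    have "(\<Sum>j=1..m. (?G (\<T>s j) - ?G \<J>)) \<le> (c2 / c1) * (c1 * X \<M>)"
      using B(2) c by simp
    also have "\<dots> \<le> (c2 / c1) * (?G \<M> - ?G \<J>)"
      using MJ(1) c by (intro mult_left_mono) auto
    finally show ?thesis
      using lower by (simp only: inverse_divide)
  qed
  then show ?thesis
    using c unfolding Let_def by (intro exI[of _ "c2 / c1"]) auto
qed

end
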